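(* Let $K$ be an algebraically closed field of characteristic $0$, let $W$ be a $3$-dimensional $K$-vector space, and let $f\in\mathrm{Sym}^4(W^* )$ be stable with trivial reduced stabilizer. Then there exist three contravariants of $\mathrm{Sym}^4(W^* )$ of order $1$ which are linearly independent at $f$. Moreover, if $p_0,p_1,p_2$ are such contravariants, then $$\tilde f=\sum_{0\le i_1,\dots,i_4\le 2}\mathrm{D}\big(p_{i_1}(f)\cdots p_{i_4}(f),f\big)\,X_{i_1}\cdots X_{i_4}$$ is $\mathrm{GL}_3$-equivalent to $f$.
   Context: Fix a basis $w_0,w_1,w_2$ of $W$ with dual basis $x_0,x_1,x_2$ of $W^*$. $\mathrm{GL}_3=\mathrm{GL}(W)$ acts on $W$ by left multiplication, on $W^*$ by the contragredient action, and on symmetric powers by the induced actions. The form $\tilde f$ in the variables $X_0,X_1,X_2$ is regarded as an element of $\mathrm{Sym}^4(W^* )$ by identifying $X_i$ with $x_i$. Two forms are $\mathrm{GL}_3$-equivalent if they lie in the same $\mathrm{GL}_3(K)$-orbit. A contravariant of $\mathrm{Sym}^4(W^* )$ of order $1$ is an $\mathrm{SL}(W)$-equivariant homogeneous polynomial map $\mathrm{Sym}^4(W^* )\to W$. Contravariants $p_0,p_1,p_2$ are linearly independent at $f$ if $p_0(f),p_1(f),p_2(f)$ are linearly independent over $K$. $\mathrm{D}:\mathrm{Sym}(W)\times\mathrm{Sym}(W^* )\to\mathrm{Sym}(W^* )$ is the $K$-bilinear map with $\mathrm{D}(w_0^{\alpha_0}w_1^{\alpha_1}w_2^{\alpha_2},P)=\frac{\partial^{\alpha_0+\alpha_1+\alpha_2}P}{\partial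 x_0^{\alpha_0}\partial x_1^{\alpha_1}\partial x_2^{\alpha_2}}$. $f$ is stable if some homogeneous $\mathrm{SL}_3$-invariant polynomial of positive degree on $\mathrm{Sym}^4(W^* )$ does not vanish at $f$, the $\mathrm{SL}_3$-orbit of $f$ is closed, and its stabilizer in $\mathrm{SL}_3$ is finite. The reduced stabilizer of $f$ is $\{M\in\mathrm{GL}_3: M\cdot f=f\}/\{\mu I_3:\mu^4=1\}$ (equivalently, the stabilizer in $\mathrm{SL}_3$ modulo the scalar matrices $\mu I_3$ with $\mu^4=\mu^3=1$). *)

theory Defs
  imports
    "HOL-Analysis.Analysis"
    "HOL-Library.Poly_Mapping"
    "HOL-Algebra.Elementary_Groups"
begin

text \<open>
  Polynomials with coefficients in \<open>'k\<close> and variables indexed by \<open>'x\<close>: finitely supported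
  functions from exponent vectors to \<open>'k\<close>, with the ring structure of \<^theory>\<open>HOL-Library.Poly_Mapping\<close>.
\<close>

type_synonym ('x, 'k) mpoly = "('x \<Rightarrow>\<^sub>0 nat) \<Rightarrow>\<^sub>0 'k"

definition const :: "'k::zero \<Rightarrow> ('x, 'k) mpoly" where
  "const c = Poly_Mapping.single 0 c"

definition var :: "'x \<Rightarrow> ('x, 'k::zero_neq_one) mpoly" where
  "var i = Poly_Mapping.single (Poly_Mapping.single i 1) 1"

definition expdeg :: "('x \<Rightarrow>\<^sub>0 nat) \<Rightarrow> nat" where
  "expdeg \<alpha> = (\<Sum>i\<in>Poly_Mapping.keys \<alpha>. Poly_Mapping.lookup \<alpha> i)"

definition homogeneous :: "nat \<Rightarrow> ('x, 'k::zero) mpoly \<Rightarrow> bool" where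
  "homogeneous d P \<longleftrightarrow> (\<forall>\<alpha>\<in>Poly_Mapping.keys P. expdeg \<alpha> = d)"

definition eval_poly :: "('k \<Rightarrow> 'r) \<Rightarrow> ('x \<Rightarrow> 'r) \<Rightarrow> ('x, 'k::zero) mpoly \<Rightarrow> 'r::comm_semiring_1" where
  "eval_poly h v P = (\<Sum>\<alpha>\<in>Poly_Mapping.keys P.
     h (Poly_Mapping.lookup P \<alpha>) * (\<Prod>i\<in>Poly_Mapping.keys \<alpha>. v i ^ Poly_Mapping.lookup \<alpha> i))"

definition pdiff :: "'x \<Rightarrow> ('x, 'k::comm_semiring_1) mpoly \<Rightarrow> ('x, 'k) mpoly" where
  "pdiff i P = (\<Sum>\<alpha>\<in>Poly_Mapping.keys P.
     Poly_Mapping.single (\<alpha> - Poly_Mapping.single i 1)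
       (of_nat (Poly_Mapping.lookup \<alpha> i) * Poly_Mapping.lookup P \<alpha>))"

text \<open>
  The vector space \<open>W\<close> with its basis is \<open>'k^3\<close> with the standard basis; the index type \<open>3\<close> has the
  elements \<open>0, 1, 2\<close>. Both \<open>Sym(W)\<close> and \<open>Sym(W*)\<close> are polynomial rings in three variables,
  \<open>var i\<close> standing for \<open>w\<^sub>i\<close> in the former and for \<open>x\<^sub>i\<close> in the latter.
\<close>

definition Sym_pow :: "nat \<Rightarrow> (3, 'k::zero) mpoly set" where
  "Sym_pow d = {F. homogeneous d F}"

definition GL3 :: "('k::field^3^3) monoid" where
  "GL3 = \<lparr>carrier = {g. invertible g}, monoid.mult = (**), one = mat 1\<rparr>"

definition SL3 :: "('k::field^3^3) set" where
  "SL3 = {g. det g = 1}"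

text \<open>
  The contragredient action sends \<open>x\<^sub>i\<close> to the linear form \<open>x\<^sub>i \<circ> g\<^sup>-\<^sup>1\<close>, and is extended to
  \<open>Sym(W*)\<close> as a ring homomorphism.
\<close>

definition act :: "'k::field^3^3 \<Rightarrow> (3, 'k) mpoly \<Rightarrow> (3, 'k) mpoly" where
  "act g = eval_poly const (\<lambda>i. \<Sum>j\<in>UNIV. const (matrix_inv g $ i $ j) * var j)"

definition GL3_equivalent :: "(3, 'k::field) mpoly \<Rightarrow> (3, 'k) mpoly \<Rightarrow> bool" where
  "GL3_equivalent F G \<longleftrightarrow> (\<exists>g\<in>carrier GL3. G = act g F)"

definition SL3_orbit :: "(3, 'k::field) mpoly \<Rightarrow> (3, 'k) mpoly set" where
  "SL3_orbit F = {act g F | g. g \<in> SL3}"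

text \<open>
  A polynomial function on \<open>Sym\<^sup>4(W*)\<close> is given by a polynomial in the coefficients of a form, so its
  variables are indexed by exponent vectors. Variables belonging to exponent vectors of degree
  other than \<open>4\<close> may occur, but are evaluated at \<open>0\<close>.
\<close>

definition eval_at :: "(3 \<Rightarrow>\<^sub>0 nat, 'k::comm_semiring_1) mpoly \<Rightarrow> (3, 'k) mpoly \<Rightarrow> 'k" where
  "eval_at P F = eval_poly (\<lambda>c. c) (Poly_Mapping.lookup F) P"

definition Zariski_closed_quartics :: "(3, 'k::comm_semiring_1) mpoly set \<Rightarrow> bool" where
  "Zariski_closed_quartics S \<longleftrightarrow>
     (\<exists>T. S = {F \<in> Sym_pow 4. \<forall>P\<in>T. eval_at P F = 0})"

definition SL3_invariant :: "(3 \<Rightarrow>\<^sub>0 nat, 'k::field) mpoly \<Rightarrow> bool" where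
  "SL3_invariant P \<longleftrightarrow> (\<forall>g\<in>SL3. \<forall>F\<in>Sym_pow 4. eval_at P (act g F) = eval_at P F)"

definition stable_quartic :: "(3, 'k::field) mpoly \<Rightarrow> bool" where
  "stable_quartic f \<longleftrightarrow>
     (\<exists>d>0. \<exists>P. homogeneous d P \<and> SL3_invariant P \<and> eval_at P f \<noteq> 0) \<and>
     Zariski_closed_quartics (SL3_orbit f) \<and>
     finite {g \<in> SL3. act g f = f}"

definition GL3_stabilizer :: "(3, 'k::field) mpoly \<Rightarrow> ('k^3^3) monoid" where
  "GL3_stabilizer f = GL3\<lparr>carrier := {g \<in> carrier GL3. act g f = f}\<rparr>"

definition reduced_stabilizer :: "(3, 'k::field) mpoly \<Rightarrow> ('k^3^3) set monoid" where
  "reduced_stabilizer f = GL3_stabilizer f Mod {mat \<mu> | \<mu>. \<mu> ^ 4 = 1}"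

definition homogeneous_map :: "((3, 'k::comm_semiring_1) mpoly \<Rightarrow> 'k^3) \<Rightarrow> bool" where
  "homogeneous_map p \<longleftrightarrow>
     (\<exists>d. \<exists>P :: 3 \<Rightarrow> (3 \<Rightarrow>\<^sub>0 nat, 'k) mpoly. \<forall>i. homogeneous d (P i) \<and>
        (\<forall>F\<in>Sym_pow 4. p F $ i = eval_at (P i) F))"

definition contravariant :: "((3, 'k::field) mpoly \<Rightarrow> 'k^3) \<Rightarrow> bool" where
  "contravariant p \<longleftrightarrow> homogeneous_map p \<and>
     (\<forall>g\<in>SL3. \<forall>F\<in>Sym_pow 4. p (act g F) = g *v p F)"

definition independent_at :: "(3 \<Rightarrow> (3, 'k::field) mpoly \<Rightarrow> 'k^3) \<Rightarrow> (3, 'k) mpoly \<Rightarrow> bool" where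
  "independent_at p f \<longleftrightarrow> inj (\<lambda>i. p i f) \<and> vec.independent (range (\<lambda>i. p i f))"

definition vec_to_Sym :: "'k::comm_semiring_1^3 \<Rightarrow> (3, 'k) mpoly" where
  "vec_to_Sym v = (\<Sum>i\<in>UNIV. const (v $ i) * var i)"

definition D_op :: "(3, 'k::comm_semiring_1) mpoly \<Rightarrow> (3, 'k) mpoly \<Rightarrow> (3, 'k) mpoly" where
  "D_op Q P = (\<Sum>\<alpha>\<in>Poly_Mapping.keys Q. const (Poly_Mapping.lookup Q \<alpha>) *
     (pdiff 0 ^^ Poly_Mapping.lookup \<alpha> 0)
       ((pdiff 1 ^^ Poly_Mapping.lookup \<alpha> 1)
         ((pdiff 2 ^^ Poly_Mapping.lookup \<alpha> 2) P)))"

text \<open>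
  For \<open>f\<close> of degree \<open>4\<close>, each value of \<open>D_op\<close> below lies in \<open>Sym\<^sup>0(W*)\<close>, the constant polynomials.
\<close>

definition f_tilde :: "(3 \<Rightarrow> (3, 'k::field) mpoly \<Rightarrow> 'k^3) \<Rightarrow> (3, 'k) mpoly \<Rightarrow> (3, 'k) mpoly" where
  "f_tilde p f = (\<Sum>i1\<in>UNIV. \<Sum>i2\<in>UNIV. \<Sum>i3\<in>UNIV. \<Sum>i4\<in>UNIV.
     D_op (vec_to_Sym (p i1 f) * vec_to_Sym (p i2 f) * vec_to_Sym (p i3 f) * vec_to_Sym (p i4 f)) f
       * (var i1 * var i2 * var i3 * var i4))"

end

theory Submission
  imports Defs "HOL-Library.Function_Algebras"
begin

text \<open>
  Write \<open>A\<close> for the ring of functions \<open>h \<mapsto> P (f \<circ> h)\<close> on \<open>SL3\<close>, with \<open>P\<close> polynomial in the coefficients of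
  a quartic. Characters of \<open>A\<close> outside the zeros of a suitable element extend to points of \<open>SL3\<close>; in
  characteristic \<open>0\<close>, an entry of \<open>h\<close> outside the field of fractions of \<open>A\<close> would allow two different
  extensions, although a trivial stabilizer makes \<open>h \<mapsto> f \<circ> h\<close> injective. So every entry of \<open>h\<close> is a
  fraction of elements of \<open>A\<close>. The common denominators form an ideal stable under translation, which
  is all of \<open>A\<close> because the orbit is closed. Hence there are polynomial maps \<open>q\<close> on quartics with
  \<open>q (f \<circ> h) = h\<^sup>-\<^sup>1 w\<close>, and applying Cayley's \<open>\<Omega>\<close>-process in the variable \<open>z\<close> to \<open>z q (F \<circ> z)\<close>, suitably
  multiplied by powers of \<open>det z\<close>, turns the homogeneous parts of \<open>q\<close> into contravariants whose values
  at \<open>f\<close> span \<open>W\<close>.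

  The second assertion is Taylor's formula: \<open>D (p\<^sub>i\<^sub>1 \<cdots> p\<^sub>i\<^sub>4, f)\<close> is \<open>4!\<close> times the polarization of \<open>f\<close>, so the
  form in question is \<open>24 f (\<Sum> X\<^sub>i p\<^sub>i)\<close>, and \<open>24\<close> has a fourth root.
\<close>

section \<open>Extending characters and the Nullstellensatz\<close>

text \<open>Functions on SL3 are kept as functions on all matrices. Their ring has zero divisors, so
  a prime set \<open>Q\<close>, in the end \<open>SL3_ideal\<close>, takes the part of zero, and
  statements about fields of fractions become statements about denominators outside
  \<open>Q\<close>. The extension theorem also carries an element that has to stay nonzero: this
  condition is what lets extensions be chained one generator at a time, and over the constants the
  chain yields the Nullstellensatz.

  The identity \<open>z q(f \<circ> z) = w\<close> holds on SL3 only, while Cayley's operator also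
  evaluates at singular matrices. A regular \<open>z\<close> is moved into SL3 by a scalar
  \<open>u\<close> with \<open>u ^ 3 * det z = 1\<close>, and the part of \<open>q\<close> of degree
  \<open>d\<close> then contributes \<open>u ^ (4 * d + 1)\<close>, which is a power of
  \<open>det z\<close> only if 3 divides \<open>4 * d + 1\<close>. Adding the instances for the
  three choices of \<open>u\<close> removes the other degrees, and a sufficiently high power of
  \<open>det z\<close> makes the result an identity on all matrices.

  The operator is expressed by values instead of derivatives, so that its result visibly depends on
  the quartic as a homogeneous polynomial.\<close>

locale algebra_map =
  fixes \<iota> :: "'k::{alg_closed_field, field_char_0} \<Rightarrow> 'r::comm_ring_1"
  assumes \<iota>_add: "\<iota> (a + b) = \<iota> a + \<iota> b"
    and \<iota>_mult: "\<iota> (a * b) = \<iota> a * \<iota> b"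
    and \<iota>_1 [simp]: "\<iota> 1 = 1"
begin

definition subalgebra :: "'r set \<Rightarrow> bool" where
  "subalgebra R \<longleftrightarrow> range \<iota> \<subseteq> R \<and> (\<forall>a\<in>R. \<forall>b\<in>R. a + b \<in> R \<and> a * b \<in> R)"

text \<open>\<open>Q\<close> need not lie in \<open>R\<close>: one set serves for all the rings
  between the constants and the matrix polynomials, and its trace on each of them is the ideal
  meant.\<close>

definition ideal_of :: "'r set \<Rightarrow> 'r set \<Rightarrow> bool" where
  "ideal_of R Q \<longleftrightarrow> 0 \<in> Q \<and> (\<forall>a\<in>Q. \<forall>b\<in>Q. a + b \<in> Q) \<and> (\<forall>a\<in>R. \<forall>b\<in>Q. a * b \<in> Q)"

definition prime_of :: "'r set \<Rightarrow> 'r set \<Rightarrow> bool" where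
  "prime_of R Q \<longleftrightarrow> ideal_of R Q \<and> 1 \<notin> Q \<and> (\<forall>a\<in>R. \<forall>b\<in>R. a * b \<in> Q \<longrightarrow> a \<in> Q \<or> b \<in> Q)"

definition polys :: "'r set \<Rightarrow> 'r poly set" where
  "polys R = {p. \<forall>i. coeff p i \<in> R}"

definition adjoin :: "'r set \<Rightarrow> 'r \<Rightarrow> 'r set" where
  "adjoin R x = (\<lambda>p. poly p x) ` polys R"

text \<open>A total function with arbitrary values outside \<open>R\<close>; extending it means
  choosing another function that agrees with it on \<open>R\<close>.\<close>

definition character :: "'r set \<Rightarrow> ('r \<Rightarrow> 'k) \<Rightarrow> bool" where
  "character R \<psi> \<longleftrightarrow> (\<forall>c. \<psi> (\<iota> c) = c) \<and>
     (\<forall>a\<in>R. \<forall>b\<in>R. \<psi> (a + b) = \<psi> a + \<psi> b \<and> \<psi> (a * b) = \<psi> a * \<psi> b)"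

lemma \<iota>_0 [simp]: "\<iota> 0 = 0"
  using \<iota>_add[of 0 0] by simp

lemma \<iota>_minus: "\<iota> (- a) = - \<iota> a"
  using \<iota>_add[of a "- a"] by (simp add: eq_neg_iff_add_eq_0 add.commute)

lemma subalgebraD:
  assumes "subalgebra R"
  shows "\<iota> c \<in> R" "0 \<in> R" "1 \<in> R"
    "a \<in> R \<Longrightarrow> b \<in> R \<Longrightarrow> a + b \<in> R" "a \<in> R \<Longrightarrow> b \<in> R \<Longrightarrow> a * b \<in> R"
    "a \<in> R \<Longrightarrow> - a \<in> R" "a \<in> R \<Longrightarrow> b \<in> R \<Longrightarrow> a - b \<in> R" "a \<in> R \<Longrightarrow> a ^ n \<in> R"
proof -
  show 1: "\<iota> c \<in> R" for c using assms by (auto simp: subalgebra_def)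
  show "0 \<in> R" "1 \<in> R" using 1[of 0] 1[of 1] by auto
  show 2: "a \<in> R \<Longrightarrow> b \<in> R \<Longrightarrow> a + b \<in> R" "a \<in> R \<Longrightarrow> b \<in> R \<Longrightarrow> a * b \<in> R" for a b
    using assms by (auto simp: subalgebra_def)
  show 3: "a \<in> R \<Longrightarrow> - a \<in> R" for a
    using 2(2)[OF 1[of "-1"], of a] by (simp add: \<iota>_minus)
  show "a \<in> R \<Longrightarrow> b \<in> R \<Longrightarrow> a - b \<in> R" using 2(1)[of a "-b"] 3[of b] by simp
  show "a \<in> R \<Longrightarrow> a ^ n \<in> R" using \<open>1 \<in> R\<close> 2(2) by (induction n) auto
qed

lemma subalgebra_sum: "subalgebra R \<Longrightarrow> (\<And>i. i \<in> I \<Longrightarrow> f i \<in> R) \<Longrightarrow> sum f I \<in> R"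
  by (induction I rule: infinite_finite_induct) (auto intro: subalgebraD)

lemma subalgebra_prod: "subalgebra R \<Longrightarrow> (\<And>i. i \<in> I \<Longrightarrow> f i \<in> R) \<Longrightarrow> prod f I \<in> R"
  by (induction I rule: infinite_finite_induct) (auto intro: subalgebraD)

lemma ideal_ofD:
  assumes "ideal_of R Q" "subalgebra R"
  shows "0 \<in> Q" "a \<in> Q \<Longrightarrow> b \<in> Q \<Longrightarrow> a + b \<in> Q" "a \<in> R \<Longrightarrow> b \<in> Q \<Longrightarrow> a * b \<in> Q"
    "a \<in> Q \<Longrightarrow> b \<in> R \<Longrightarrow> a * b \<in> Q" "a \<in> Q \<Longrightarrow> - a \<in> Q" "a \<in> Q \<Longrightarrow> b \<in> Q \<Longrightarrow> a - b \<in> Q"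
proof -
  show "0 \<in> Q" and 1: "a \<in> Q \<Longrightarrow> b \<in> Q \<Longrightarrow> a + b \<in> Q" "a \<in> R \<Longrightarrow> b \<in> Q \<Longrightarrow> a * b \<in> Q" for a b
    using assms by (auto simp: ideal_of_def)
  show "a \<in> Q \<Longrightarrow> b \<in> R \<Longrightarrow> a * b \<in> Q" using 1(2)[of b a] by (simp add: mult.commute)
  have "\<iota> (-1) = -1" by (simp add: \<iota>_minus)
  then have "-1 \<in> R" using subalgebraD(1)[OF assms(2)] by metis
  then show 2: "a \<in> Q \<Longrightarrow> - a \<in> Q" for a using 1(2)[of "-1" a] by simp
  show "a \<in> Q \<Longrightarrow> b \<in> Q \<Longrightarrow> a - b \<in> Q" using 1(1)[of a "-b"] 2 by simp
qed

lemma ideal_of_sum: "ideal_of R Q \<Longrightarrow> (\<And>i. i \<in> I \<Longrightarrow> f i \<in> Q) \<Longrightarrow> sum f I \<in> Q"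
  by (induction I rule: infinite_finite_induct) (auto simp: ideal_of_def)

lemma primeD: "prime_of R Q \<Longrightarrow> a \<in> R \<Longrightarrow> b \<in> R \<Longrightarrow> a * b \<in> Q \<Longrightarrow> a \<in> Q \<or> b \<in> Q"
  by (auto simp: prime_of_def)

lemma prime_power:
  assumes "prime_of R Q" "subalgebra R" "a \<in> R" "a \<notin> Q"
  shows "a ^ n \<notin> Q"
  using assms by (induction n) (auto simp: prime_of_def subalgebraD)

lemma characterD:
  assumes "character R \<psi>" "subalgebra R"
  shows "\<psi> (\<iota> c) = c" "\<psi> 0 = 0" "\<psi> 1 = 1"
    "a \<in> R \<Longrightarrow> b \<in> R \<Longrightarrow> \<psi> (a + b) = \<psi> a + \<psi> b" "a \<in> R \<Longrightarrow> b \<in> R \<Longrightarrow> \<psi> (a * b) = \<psi> a * \<psi> b"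
    "a \<in> R \<Longrightarrow> \<psi> (- a) = - \<psi> a"
    "a \<in> R \<Longrightarrow> b \<in> R \<Longrightarrow> \<psi> (a - b) = \<psi> a - \<psi> b" "a \<in> R \<Longrightarrow> \<psi> (a ^ n) = \<psi> a ^ n"
proof -
  show 1: "\<psi> (\<iota> c) = c" for c using assms by (auto simp: character_def)
  show z: "\<psi> 0 = 0" "\<psi> 1 = 1" using 1[of 0] 1[of 1] by auto
  show 2: "a \<in> R \<Longrightarrow> b \<in> R \<Longrightarrow> \<psi> (a + b) = \<psi> a + \<psi> b" "a \<in> R \<Longrightarrow> b \<in> R \<Longrightarrow> \<psi> (a * b) = \<psi> a * \<psi> b" for a b
    using assms by (auto simp: character_def)
  show 3: "a \<in> R \<Longrightarrow> \<psi> (- a) = - \<psi> a" for a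
    using 2(1)[of a "-a"] z subalgebraD[OF assms(2)] by (simp add: eq_neg_iff_add_eq_0 add.commute)
  show "a \<in> R \<Longrightarrow> b \<in> R \<Longrightarrow> \<psi> (a - b) = \<psi> a - \<psi> b"
    using 2(1)[of a "-b"] 3[of b] subalgebraD(6)[OF assms(2), of b] by simp
  show "a \<in> R \<Longrightarrow> \<psi> (a ^ n) = \<psi> a ^ n" using z 2(2) subalgebraD[OF assms(2)] by (induction n) auto
qed

lemma character_sum:
  assumes "character R \<psi>" "subalgebra R" "\<And>i. i \<in> I \<Longrightarrow> f i \<in> R"
  shows "\<psi> (sum f I) = (\<Sum>i\<in>I. \<psi> (f i))"
  using assms(3)
  by (induction I rule: infinite_finite_induct)
     (auto simp: characterD[OF assms(1,2)] subalgebra_sum[OF assms(2)])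

lemma character_prod:
  assumes "character R \<psi>" "subalgebra R" "\<And>i. i \<in> I \<Longrightarrow> f i \<in> R"
  shows "\<psi> (prod f I) = (\<Prod>i\<in>I. \<psi> (f i))"
  using assms(3)
  by (induction I rule: infinite_finite_induct)
     (auto simp: characterD[OF assms(1,2)] subalgebra_prod[OF assms(2)])

section \<open>Polynomials with coefficients in a subring, and adjunction of an element\<close>

text \<open>The coefficient ring may have zero divisors here; \<open>pderiv\<close> takes over once
  a character has carried the coefficients into the field, see
  \<open>map_poly_character\<close>.\<close>

definition formal_deriv :: "'r poly \<Rightarrow> 'r poly" where
  "formal_deriv p = (\<Sum>i\<le>degree p. monom (of_nat (Suc i) * coeff p (Suc i)) i)"

lemma coeff_formal_deriv: "coeff (formal_deriv p) i = of_nat (Suc i) * coeff p (Suc i)"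
  by (auto simp: formal_deriv_def coeff_sum coeff_eq_0 simp del: of_nat_Suc)

lemma degree_formal_deriv: "degree p > 0 \<Longrightarrow> degree (formal_deriv p) < degree p"
  by (intro degree_lessI) (auto simp: coeff_formal_deriv coeff_eq_0)

lemma of_nat_closed: "subalgebra R \<Longrightarrow> of_nat n \<in> R"
  by (induction n) (auto simp: subalgebraD)

lemma polysD: "p \<in> polys R \<Longrightarrow> coeff p i \<in> R"
  by (auto simp: polys_def)

lemma polys_closed:
  assumes "subalgebra R"
  shows "0 \<in> polys R" "1 \<in> polys R" "p \<in> polys R \<Longrightarrow> q \<in> polys R \<Longrightarrow> p + q \<in> polys R"
    "p \<in> polys R \<Longrightarrow> q \<in> polys R \<Longrightarrow> p - q \<in> polys R"
    "p \<in> polys R \<Longrightarrow> q \<in> polys R \<Longrightarrow> p * q \<in> polys R"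
    "a \<in> R \<Longrightarrow> q \<in> polys R \<Longrightarrow> smult a q \<in> polys R" "a \<in> R \<Longrightarrow> monom a n \<in> polys R"
    "a \<in> R \<Longrightarrow> [:a:] \<in> polys R" "p \<in> polys R \<Longrightarrow> formal_deriv p \<in> polys R"
    "a \<in> R \<Longrightarrow> q \<in> polys R \<Longrightarrow> pCons a q \<in> polys R"
  using subalgebraD[OF assms]
  by (auto simp: polys_def coeff_mult coeff_formal_deriv coeff_1 coeff_pCons of_nat_closed[OF assms]
      simp del: of_nat_Suc split: nat.splits intro!: subalgebra_sum[OF assms])

lemma polys_ideal:
  assumes "subalgebra R" "ideal_of R Q"
  shows "0 \<in> polys Q" "p \<in> polys Q \<Longrightarrow> q \<in> polys Q \<Longrightarrow> p + q \<in> polys Q"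
    "p \<in> polys Q \<Longrightarrow> q \<in> polys Q \<Longrightarrow> p - q \<in> polys Q"
    "p \<in> polys R \<Longrightarrow> q \<in> polys Q \<Longrightarrow> p * q \<in> polys Q"
    "p \<in> polys Q \<Longrightarrow> q \<in> polys R \<Longrightarrow> p * q \<in> polys Q"
    "a \<in> R \<Longrightarrow> q \<in> polys Q \<Longrightarrow> smult a q \<in> polys Q"
    "a \<in> Q \<Longrightarrow> q \<in> polys R \<Longrightarrow> smult a q \<in> polys Q"
    "a \<in> Q \<Longrightarrow> monom a n \<in> polys Q"
  using ideal_ofD[OF assms(2,1)]
  by (auto simp: polys_def coeff_mult intro!: ideal_of_sum[OF assms(2)])

lemma adjoin_iff: "y \<in> adjoin R x \<longleftrightarrow> (\<exists>p\<in>polys R. y = poly p x)"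
  by (auto simp: adjoin_def)

lemma adjoin_subset: assumes "subalgebra R" shows "R \<subseteq> adjoin R x"
proof
  fix a assume "a \<in> R"
  then show "a \<in> adjoin R x" unfolding adjoin_iff
    by (intro bexI[of _ "[:a:]"]) (auto simp: polys_closed assms)
qed

lemma adjoin_self: assumes "subalgebra R" shows "x \<in> adjoin R x"
  unfolding adjoin_iff
  by (intro bexI[of _ "[:0, 1:]"]) (auto simp: polys_closed subalgebraD assms)

lemma subalgebra_adjoin: assumes "subalgebra R" shows "subalgebra (adjoin R x)"
  unfolding subalgebra_def
proof (intro conjI ballI)
  show "range \<iota> \<subseteq> adjoin R x" using adjoin_subset[OF assms] subalgebraD(1)[OF assms] by auto
  fix a b assume "a \<in> adjoin R x" "b \<in> adjoin R x"
  then obtain p q where p: "p \<in> polys R" "q \<in> polys R" "a = poly p x" "b = poly q x"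
    by (auto simp: adjoin_iff)
  show "a + b \<in> adjoin R x" unfolding adjoin_iff using p
    by (intro bexI[of _ "p + q"]) (auto simp: polys_closed assms)
  show "a * b \<in> adjoin R x" unfolding adjoin_iff using p
    by (intro bexI[of _ "p * q"]) (auto simp: polys_closed assms)
qed

lemma adjoin_minimal:
  assumes "subalgebra T" "R \<subseteq> T" "x \<in> T"
  shows "adjoin R x \<subseteq> T"
  using assms(2)
  by (auto simp: adjoin_def poly_altdef polys_def intro!: subalgebra_sum[OF assms(1)] subalgebraD[OF assms(1)] assms(3))

lemma prime_of_subset: "prime_of S Q \<Longrightarrow> R \<subseteq> S \<Longrightarrow> prime_of R Q"
  unfolding prime_of_def ideal_of_def by blast

lemma poly_in_ideal:
  assumes "subalgebra R" "ideal_of (adjoin R x) Q" "p \<in> polys Q"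
  shows "poly p x \<in> Q"
  unfolding poly_altdef
  using assms(3) subalgebraD(8)[OF subalgebra_adjoin[OF assms(1)] adjoin_self[OF assms(1)]]
  by (intro ideal_of_sum[OF assms(2)] ideal_ofD(4)[OF assms(2) subalgebra_adjoin[OF assms(1)]]) (auto simp: polys_def)

text \<open>Long division without inverting the leading coefficient of \<open>e\<close>: each step
  costs one factor of it. The bound on \<open>degree s\<close> makes the cofactor smaller than a
  minimal polynomial in \<open>bezout_modulo_prime\<close>.\<close>

lemma pseudo_division:
  assumes R: "subalgebra R" and e: "e \<in> polys R" "degree e > 0" and q: "q \<in> polys R"
  shows "\<exists>k s r. s \<in> polys R \<and> r \<in> polys R \<and> degree r < degree e \<and> degree s \<le> degree q - degree e
     \<and> smult (lead_coeff e ^ k) q = s * e + r"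
  using q
proof (induction "degree q" arbitrary: q rule: less_induct)
  case less
  show ?case
  proof (cases "degree q < degree e")
    case True
    then show ?thesis using less(2) polys_closed(1)[OF R]
      by (intro exI[of _ "0::nat"] exI[of _ 0] exI[of _ q]) auto
  next
    case False
    define l where "l = lead_coeff e"
    define t where "t = monom (lead_coeff q) (degree q - degree e)"
    define q1 where "q1 = smult l q - t * e"
    have lR: "l \<in> R" "lead_coeff q \<in> R" using e(1) less(2) by (auto simp: polys_def l_def)
    have tR: "t \<in> polys R" unfolding t_def using lR polys_closed[OF R] by auto
    have q1R: "q1 \<in> polys R" unfolding q1_def using tR lR e less(2) polys_closed[OF R] by auto
    have "degree q1 < degree q"
    proof -
      have "coeff q1 i = 0" if "i \<ge> degree q" for i
      proof (cases "i = degree q")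
        case True
        then show ?thesis using False
          by (simp add: q1_def t_def l_def coeff_monom_mult)
      next
        case ne: False
        then have "i > degree q" using that by simp
        moreover from this have "coeff e (i - (degree q - degree e)) = 0"
          using False by (intro coeff_eq_0) auto
        ultimately show ?thesis
          by (simp add: q1_def t_def coeff_monom_mult coeff_eq_0)
      qed
      moreover have "degree q > 0" using False e by auto
      ultimately show ?thesis
        by (metis degree_0 leading_coeff_0_iff not_le)
    qed
    from less(1)[OF this q1R] obtain k s r where ksr: "s \<in> polys R" "r \<in> polys R" "degree r < degree e"
      "degree s \<le> degree q1 - degree e" "smult (l ^ k) q1 = s * e + r" unfolding l_def by blast
    have lk: "l ^ k \<in> R" using subalgebraD(8)[OF R lR(1)] .
    have "smult (l ^ Suc k) q = (s + smult (l ^ k) t) * e + r"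
    proof -
      have "smult (l ^ Suc k) q = smult (l ^ k) (q1 + t * e)"
        by (simp add: q1_def mult.commute)
      also have "\<dots> = (s + smult (l ^ k) t) * e + r"
        using ksr(5) by (simp add: smult_add_right algebra_simps)
      finally show ?thesis .
    qed
    moreover have "degree (s + smult (l ^ k) t) \<le> degree q - degree e"
    proof (rule degree_add_le)
      show "degree s \<le> degree q - degree e" using ksr(4) \<open>degree q1 < degree q\<close> by linarith
      show "degree (smult (l ^ k) t) \<le> degree q - degree e"
        unfolding t_def by (meson degree_monom_le degree_smult_le order_trans)
    qed
    moreover have "s + smult (l ^ k) t \<in> polys R" using ksr tR lk polys_closed[OF R] by auto
    ultimately show ?thesis using ksr unfolding l_def by blast
  qed
qed

text \<open>An ideal of the polynomials over \<open>R\<close> that contains those vanishing modulo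
  \<open>Q\<close>; it represents an ideal over the field of fractions of
  \<open>R / Q\<close>.\<close>

definition poly_ideal :: "'r set \<Rightarrow> 'r set \<Rightarrow> 'r poly set \<Rightarrow> bool" where
  "poly_ideal R Q X \<longleftrightarrow> X \<subseteq> polys R \<and> polys Q \<inter> polys R \<subseteq> X \<and> (\<forall>p\<in>X. \<forall>q\<in>X. p - q \<in> X)
     \<and> (\<forall>p\<in>polys R. \<forall>q\<in>X. p * q \<in> X)"

text \<open>Over the field of fractions of \<open>R / Q\<close> the ideal is principal, and
  \<open>e\<close> plays its generator. Least degree is sought only among polynomials whose leading
  coefficient survives modulo \<open>Q\<close>; leading terms in \<open>Q\<close> can be stripped
  off without leaving \<open>X\<close>.\<close>

lemma poly_ideal_minimal:
  assumes R: "subalgebra R" and Q: "ideal_of R Q" and X: "poly_ideal R Q X" and nt: "\<not> X \<subseteq> polys Q"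
  obtains e where "e \<in> X" "lead_coeff e \<notin> Q" "\<And>q. q \<in> X \<Longrightarrow> degree q < degree e \<Longrightarrow> q \<in> polys Q"
proof -
  have strip: "\<exists>p'\<in>X. lead_coeff p' \<notin> Q \<and> degree p' \<le> degree p" if "p \<in> X" "p \<notin> polys Q" for p
    using that
  proof (induction "degree p" arbitrary: p rule: less_induct)
    case less
    show ?case
    proof (cases "lead_coeff p \<in> Q")
      case True
      define p1 where "p1 = p - monom (lead_coeff p) (degree p)"
      have pR: "p \<in> polys R" using less X by (auto simp: poly_ideal_def)
      have mQ: "monom (lead_coeff p) (degree p) \<in> polys Q" using True polys_ideal[OF R Q] by auto
      moreover have "monom (lead_coeff p) (degree p) \<in> polys R"
        using pR polys_closed[OF R] by (auto simp: polys_def)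
      ultimately have p1X: "p1 \<in> X" using less X by (auto simp: poly_ideal_def p1_def)
      have p1Q: "p1 \<notin> polys Q" using less(3) mQ polys_ideal(2)[OF R Q, of p1 "monom (lead_coeff p) (degree p)"]
        by (auto simp: p1_def)
      then have "p1 \<noteq> 0" using polys_ideal(1)[OF R Q] by auto
      moreover have "coeff p1 i = 0" if "i \<ge> degree p" for i
        using that by (cases "i = degree p") (auto simp: p1_def coeff_eq_0)
      ultimately have "degree p1 < degree p" by (metis leading_coeff_0_iff not_le)
      from less(1)[OF this p1X p1Q] show ?thesis using \<open>degree p1 < degree p\<close> by (meson less_imp_le order_trans)
    qed (use less in auto)
  qed
  from nt obtain p0 where p0: "p0 \<in> X" "p0 \<notin> polys Q" by blast
  define P where "P = (\<lambda>p. p \<in> X \<and> lead_coeff p \<notin> Q)"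
  obtain p1 where p1: "P p1" using strip[OF p0] by (auto simp: P_def)
  obtain e where e: "P e" "\<And>q. P q \<Longrightarrow> degree e \<le> degree q"
    using ex_has_least_nat[of P p1 degree] p1 by auto
  show ?thesis
  proof (rule that[of e])
    fix q assume q: "q \<in> X" "degree q < degree e"
    show "q \<in> polys Q"
    proof (rule ccontr)
      assume "q \<notin> polys Q"
      from strip[OF q(1) this] e(2) q(2) show False by (fastforce simp: P_def)
    qed
  qed (use e in \<open>auto simp: P_def\<close>)
qed

text \<open>The remainder of the pseudo-division lies in \<open>X\<close> and has smaller degree
  than \<open>e\<close>, so it vanishes modulo \<open>Q\<close>: up to a power of its leading
  coefficient, \<open>e\<close> divides \<open>q\<close>.\<close>

lemma poly_ideal_reduce:
  assumes R: "subalgebra R" and Q: "ideal_of R Q" and X: "poly_ideal R Q X"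
    and e: "e \<in> X" "degree e > 0" "\<And>q. q \<in> X \<Longrightarrow> degree q < degree e \<Longrightarrow> q \<in> polys Q"
    and q: "q \<in> X"
  obtains k s r where "s \<in> polys R" "r \<in> polys R" "r \<in> polys Q" "degree s \<le> degree q - degree e"
     "smult (lead_coeff e ^ k) q = s * e + r"
proof -
  have XR: "X \<subseteq> polys R" using X by (auto simp: poly_ideal_def)
  obtain k s r where *: "s \<in> polys R" "r \<in> polys R" "degree r < degree e" "degree s \<le> degree q - degree e"
     "smult (lead_coeff e ^ k) q = s * e + r"
    using pseudo_division[OF R, of e q] e q XR by blast
  have lk: "lead_coeff e ^ k \<in> R" using e(1) XR by (intro subalgebraD(8)[OF R]) (auto simp: polys_def)
  have "r = [:lead_coeff e ^ k:] * q - s * e" using *(5) by simp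
  then have "r \<in> X" using X e(1) q *(1) polys_closed(8)[OF R lk] unfolding poly_ideal_def by blast
  then show ?thesis using that * e(3) by blast
qed

lemma map_poly_character:
  assumes "character R \<psi>" "subalgebra R"
  shows "p \<in> polys R \<Longrightarrow> q \<in> polys R \<Longrightarrow> map_poly \<psi> (p + q) = map_poly \<psi> p + map_poly \<psi> q"
    "p \<in> polys R \<Longrightarrow> q \<in> polys R \<Longrightarrow> map_poly \<psi> (p - q) = map_poly \<psi> p - map_poly \<psi> q"
    "p \<in> polys R \<Longrightarrow> q \<in> polys R \<Longrightarrow> map_poly \<psi> (p * q) = map_poly \<psi> p * map_poly \<psi> q"
    "a \<in> R \<Longrightarrow> q \<in> polys R \<Longrightarrow> map_poly \<psi> (smult a q) = smult (\<psi> a) (map_poly \<psi> q)"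
    "p \<in> polys R \<Longrightarrow> map_poly \<psi> (formal_deriv p) = pderiv (map_poly \<psi> p)"
proof -
  note D = characterD[OF assms]
  note c = coeff_map_poly[of \<psi>, OF D(2)]
  show "p \<in> polys R \<Longrightarrow> q \<in> polys R \<Longrightarrow> map_poly \<psi> (p + q) = map_poly \<psi> p + map_poly \<psi> q"
    by (rule poly_eqI) (auto simp: c D polys_def)
  show "p \<in> polys R \<Longrightarrow> q \<in> polys R \<Longrightarrow> map_poly \<psi> (p - q) = map_poly \<psi> p - map_poly \<psi> q"
    by (rule poly_eqI) (auto simp: c D polys_def)
  show "p \<in> polys R \<Longrightarrow> q \<in> polys R \<Longrightarrow> map_poly \<psi> (p * q) = map_poly \<psi> p * map_poly \<psi> q"
    by (rule poly_eqI)
       (auto simp: c D polys_def coeff_mult character_sum[OF assms] subalgebraD[OF assms(2)])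
  show "a \<in> R \<Longrightarrow> q \<in> polys R \<Longrightarrow> map_poly \<psi> (smult a q) = smult (\<psi> a) (map_poly \<psi> q)"
    by (rule poly_eqI) (auto simp: c D polys_def)
  have nat: "of_nat n \<in> R \<and> \<psi> (of_nat n) = of_nat n" for n
    by (induction n) (auto simp: D subalgebraD[OF assms(2)])
  show "p \<in> polys R \<Longrightarrow> map_poly \<psi> (formal_deriv p) = pderiv (map_poly \<psi> p)"
    using nat
    by (intro poly_eqI) (auto simp: c D polys_def coeff_formal_deriv coeff_pderiv simp del: of_nat_Suc)
qed

lemma map_poly_ideal:
  assumes "\<And>a. a \<in> Q \<inter> R \<Longrightarrow> \<psi> a = 0" "p \<in> polys Q" "p \<in> polys R" "\<psi> 0 = 0"
  shows "map_poly \<psi> p = 0"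
  using assms by (intro poly_eqI) (auto simp: polys_def coeff_map_poly)

text \<open>The value at \<open>poly p x\<close> has to be
  \<open>poly (map_poly \<psi> p) s\<close>. By \<open>root\<close>, every relation of
  \<open>x\<close> modulo \<open>Q\<close> holds at \<open>s\<close>, so this value does not depend
  on the choice of \<open>p\<close>.\<close>

lemma character_extend:
  assumes R: "subalgebra R" and \<psi>: "character R \<psi>" and Q: "ideal_of (adjoin R x) Q"
    and root: "\<And>p. p \<in> polys R \<Longrightarrow> poly p x \<in> Q \<Longrightarrow> poly (map_poly \<psi> p) s = 0"
  obtains \<psi>' where "character (adjoin R x) \<psi>'" "\<And>a. a \<in> R \<Longrightarrow> \<psi>' a = \<psi> a"
    "\<And>a. a \<in> Q \<inter> adjoin R x \<Longrightarrow> \<psi>' a = 0" "\<psi>' x = s"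
    "\<And>p. p \<in> polys R \<Longrightarrow> \<psi>' (poly p x) = poly (map_poly \<psi> p) s"
proof -
  define rep where "rep = (\<lambda>y. SOME p. p \<in> polys R \<and> y = poly p x)"
  define \<psi>' where "\<psi>' = (\<lambda>y. poly (map_poly \<psi> (rep y)) s)"
  have eq: "\<psi>' (poly p x) = poly (map_poly \<psi> p) s" if p: "p \<in> polys R" for p
  proof -
    have rep: "rep (poly p x) \<in> polys R \<and> poly p x = poly (rep (poly p x)) x"
      unfolding rep_def by (rule someI[of _ p]) (use p in auto)
    then have "poly (rep (poly p x) - p) x = 0" by simp
    then have "poly (map_poly \<psi> (rep (poly p x) - p)) s = 0"
      using rep p polys_closed[OF R] Q by (intro root) (auto simp: ideal_of_def)
    then show ?thesis using rep p by (simp add: map_poly_character[OF \<psi> R] \<psi>'_def)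
  qed
  have R': "\<psi>' a = \<psi> a" if "a \<in> R" for a
    using eq[of "[:a:]"] that polys_closed[OF R] characterD[OF \<psi> R] by (simp add: map_poly_pCons)
  have x: "\<psi>' x = s"
    using eq[of "[:0,1:]"] subalgebraD[OF R] polys_closed[OF R] characterD[OF \<psi> R] by (simp add: map_poly_pCons)
  show ?thesis
  proof (rule that[of \<psi>'])
    show "character (adjoin R x) \<psi>'" unfolding character_def
    proof (intro conjI allI ballI)
      show "\<psi>' (\<iota> c) = c" for c using R'[of "\<iota> c"] subalgebraD(1)[OF R] characterD[OF \<psi> R] by simp
      fix a b assume "a \<in> adjoin R x" "b \<in> adjoin R x"
      then obtain p q where p: "p \<in> polys R" "q \<in> polys R" "a = poly p x" "b = poly q x"
        by (auto simp: adjoin_iff)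
      show "\<psi>' (a + b) = \<psi>' a + \<psi>' b"
        using eq[of "p + q"] eq[of p] eq[of q] p polys_closed[OF R] by (simp add: map_poly_character[OF \<psi> R])
      show "\<psi>' (a * b) = \<psi>' a * \<psi>' b"
        using eq[of "p * q"] eq[of p] eq[of q] p polys_closed[OF R] by (simp add: map_poly_character[OF \<psi> R])
    qed
    show "\<psi>' a = 0" if "a \<in> Q \<inter> adjoin R x" for a
      using that root eq by (auto simp: adjoin_iff)
  qed (use R' eq x in auto)
qed

text \<open>\<open>p\<close> is a minimal polynomial of \<open>x\<close> over the field of fractions
  of \<open>R / Q\<close>, hence irreducible there, and \<open>b\<close> is prime to it because it
  does not vanish at \<open>x\<close>. Bezout's identity holds with its denominators collected in
  \<open>a\<close> and an error \<open>w\<close> that vanishes modulo \<open>Q\<close>.\<close>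

lemma bezout_modulo_prime:
  assumes R: "subalgebra R" and Q: "prime_of (adjoin R x) Q"
    and p: "p \<in> polys R" "poly p x \<in> Q" "lead_coeff p \<notin> Q" "degree p > 0"
    and min: "\<And>q. q \<in> polys R \<Longrightarrow> poly q x \<in> Q \<Longrightarrow> degree q < degree p \<Longrightarrow> q \<in> polys Q"
    and b: "b \<in> polys R" "poly b x \<notin> Q"
  obtains a u v w where "a \<in> R" "a \<notin> Q" "u \<in> polys R" "v \<in> polys R" "w \<in> polys Q" "w \<in> polys R"
    "[:a:] = u * p + v * b + w"
proof -
  note AR = adjoin_subset[OF R, of x]
  note SA = subalgebra_adjoin[OF R, of x]
  have QA: "ideal_of (adjoin R x) Q" and QR: "ideal_of R Q" and PR: "prime_of R Q"
    using Q prime_of_subset[OF Q AR] by (auto simp: prime_of_def)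
  note pc = polys_closed[OF R] and pi = polys_ideal[OF R QR]
  define X where "X = {u * p + v * b + w |u v w. u \<in> polys R \<and> v \<in> polys R \<and> w \<in> polys Q \<and> w \<in> polys R}"
  have XI: "poly_ideal R Q X" unfolding poly_ideal_def
  proof (intro conjI ballI subsetI)
    show "y \<in> polys R" if "y \<in> X" for y using that p b pc by (auto simp: X_def)
    show "y \<in> X" if "y \<in> polys Q \<inter> polys R" for y
      using that pc(1) unfolding X_def
      by (intro CollectI exI[of _ 0] exI[of _ y]) auto
    fix y z assume "z \<in> X"
    then obtain u v w where z: "u \<in> polys R" "v \<in> polys R" "w \<in> polys Q" "w \<in> polys R" "z = u * p + v * b + w"
      by (auto simp: X_def)
    { assume "y \<in> X"
      then obtain u' v' w' where y: "u' \<in> polys R" "v' \<in> polys R" "w' \<in> polys Q" "w' \<in> polys R" "y = u' * p + v' * b + w'"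
        by (auto simp: X_def)
      show "y - z \<in> X" unfolding X_def using y z pc pi
        by (intro CollectI exI[of _ "u' - u"] exI[of _ "v' - v"] exI[of _ "w' - w"]) (auto simp: algebra_simps) }
    { assume "y \<in> polys R"
      then show "y * z \<in> X" unfolding X_def using z pc pi
        by (intro CollectI exI[of _ "y * u"] exI[of _ "y * v"] exI[of _ "y * w"]) (auto simp: algebra_simps) }
  qed
  have pX: "p \<in> X" unfolding X_def
    by (intro CollectI exI[of _ 1] exI[of _ 0]) (auto simp: pc pi)
  have bX: "b \<in> X" unfolding X_def
    by (intro CollectI exI[of _ 0] exI[of _ 1] exI[of _ 0]) (auto simp: pc pi)
  have "\<not> X \<subseteq> polys Q" using pX p(3) by (auto simp: polys_def)
  from poly_ideal_minimal[OF R QR XI this] obtain e where e: "e \<in> X" "lead_coeff e \<notin> Q"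
    "\<And>q. q \<in> X \<Longrightarrow> degree q < degree e \<Longrightarrow> q \<in> polys Q" by metis
  have eR: "e \<in> polys R" using e(1) XI by (auto simp: poly_ideal_def)
  have dege: "degree e = 0"
  proof (rule ccontr)
    assume "degree e \<noteq> 0"
    then have de: "degree e > 0" by simp
    have deq: "degree e \<le> degree p"
    proof (rule ccontr)
      assume "\<not> degree e \<le> degree p"
      then have "p \<in> polys Q" using e(3)[OF pX] by simp
      then show False using p(3) polysD by blast
    qed
    have mem: "poly q x \<in> adjoin R x" if "q \<in> polys R" for q using that by (auto simp: adjoin_iff)
    have lk: "lead_coeff e ^ k \<notin> Q" "lead_coeff e ^ k \<in> R" for k
      using prime_power[OF PR R polysD[OF eR] e(2)] subalgebraD(8)[OF R polysD[OF eR]] by blast+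
    obtain k s r where s: "s \<in> polys R" "r \<in> polys R" "r \<in> polys Q" "degree s \<le> degree p - degree e"
       "smult (lead_coeff e ^ k) p = s * e + r"
      using poly_ideal_reduce[OF R QR XI e(1) de e(3) pX] by blast
    \<comment> \<open>Modulo \<open>Q\<close> and up to a nonzero factor, \<open>p\<close> is
      \<open>s * e\<close>, so one of the two vanishes at \<open>x\<close>. If \<open>s\<close>
      does, it vanishes modulo \<open>Q\<close> by its degree, and \<open>p\<close> with it; if
      \<open>e\<close> does, then so does its multiple \<open>b\<close>.\<close>
    have "poly (s * e) x \<in> Q"
    proof -
      have "s * e = smult (lead_coeff e ^ k) p - r" using s(5) by simp
      then have "poly (s * e) x = lead_coeff e ^ k * poly p x - poly r x" by simp
      moreover have "lead_coeff e ^ k * poly p x \<in> Q"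
        using ideal_ofD(3)[OF QA SA] lk(2) AR p(2) by blast
      moreover have "poly r x \<in> Q" using poly_in_ideal[OF R QA s(3)] .
      ultimately show ?thesis using ideal_ofD(6)[OF QA SA] by metis
    qed
    then have "poly s x \<in> Q \<or> poly e x \<in> Q"
      using primeD[OF Q mem[OF s(1)] mem[OF eR]] by simp
    then show False
    proof
      assume "poly s x \<in> Q"
      moreover have "degree s < degree p" using s(4) de deq by linarith
      ultimately have "s \<in> polys Q" using min s by blast
      then have "s * e + r \<in> polys Q" using pi(2)[OF pi(5)[OF _ eR] s(3)] by blast
      then have "smult (lead_coeff e ^ k) p \<in> polys Q" by (simp only: s(5))
      then have "coeff (smult (lead_coeff e ^ k) p) (degree p) \<in> Q" by (rule polysD)
      then have "lead_coeff e ^ k * lead_coeff p \<in> Q" by (simp only: coeff_smult)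
      then show False using primeD[OF PR lk(2) polysD[OF p(1)]] lk(1) p(3) by blast
    next
      assume eQ: "poly e x \<in> Q"
      obtain k s r where s: "s \<in> polys R" "r \<in> polys R" "r \<in> polys Q" "degree s \<le> degree b - degree e"
         "smult (lead_coeff e ^ k) b = s * e + r"
        using poly_ideal_reduce[OF R QR XI e(1) de e(3) bX] by blast
      have "lead_coeff e ^ k * poly b x = poly s x * poly e x + poly r x"
        using arg_cong[OF s(5), of "\<lambda>q. poly q x"] by simp
      also have "\<dots> \<in> Q" using ideal_ofD(2,3)[OF QA SA] eQ mem[OF s(1)] poly_in_ideal[OF R QA s(3)] by blast
      finally show False using primeD[OF Q _ mem[OF b(1)]] lk[of k] b(2) AR by blast
    qed
  qed
  then obtain a where a: "e = [:a:]" by (metis degree_eq_zeroE)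
  from e(1) obtain u v w where "u \<in> polys R" "v \<in> polys R" "w \<in> polys Q" "w \<in> polys R" "e = u * p + v * b + w"
    by (auto simp: X_def)
  moreover have "a \<in> R" "a \<notin> Q" using eR polysD[OF eR, of 0] e(2) by (auto simp: a)
  ultimately show ?thesis using that a by metis
qed

section \<open>Extending characters by one element\<close>

definition character_mod :: "'r set \<Rightarrow> 'r set \<Rightarrow> ('r \<Rightarrow> 'k) \<Rightarrow> bool" where
  "character_mod R Q \<psi> \<longleftrightarrow> character R \<psi> \<and> (\<forall>a\<in>Q \<inter> R. \<psi> a = 0)"

text \<open>The condition on \<open>b\<close> is what the next extension in a chain asks of this
  one.\<close>

definition extends :: "'r set \<Rightarrow> 'r set \<Rightarrow> 'r set \<Rightarrow> 'r \<Rightarrow> ('r \<Rightarrow> 'k) \<Rightarrow> ('r \<Rightarrow> 'k) \<Rightarrow> bool" where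
  "extends R S Q b \<psi> \<psi>' \<longleftrightarrow> character_mod S Q \<psi>' \<and> (\<forall>a\<in>R. \<psi>' a = \<psi> a) \<and> \<psi>' b \<noteq> 0"

text \<open>Modulo \<open>Q\<close>, \<open>x\<close> is the fraction \<open>m / l\<close>.\<close>

definition fractional :: "'r set \<Rightarrow> 'r set \<Rightarrow> 'r \<Rightarrow> bool" where
  "fractional R Q x \<longleftrightarrow> (\<exists>l\<in>R. \<exists>m\<in>R. l \<notin> Q \<and> l * x - m \<in> Q)"

lemma two_roots:
  fixes p :: "'k poly"
  assumes "degree p \<ge> 2" "\<And>s. poly p s = 0 \<Longrightarrow> poly (pderiv p) s \<noteq> 0"
  obtains s t where "poly p s = 0" "poly p t = 0" "s \<noteq> t"
proof -
  obtain s where s: "poly p s = 0" using alg_closed_imp_poly_has_root[of p] assms by auto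
  then obtain g where g: "p = [:- s, 1:] * g" by (auto simp: poly_eq_0_iff_dvd)
  then have "g \<noteq> 0" using assms by auto
  then have "degree p = 1 + degree g" unfolding g by (subst degree_mult_eq) auto
  then have "degree g > 0" using assms(1) by simp
  then obtain t where t: "poly g t = 0" using alg_closed_imp_poly_has_root[of g] by auto
  show ?thesis
  proof (rule that[of s t])
    show "poly p t = 0" using t g by simp
    show "s \<noteq> t" using t g assms(2)[OF s] by (auto simp: pderiv_mult pderiv_pCons simp del: mult_pCons_left)
  qed (use s in auto)
qed

text \<open>If \<open>x\<close> is transcendental, it may be sent to any value off the roots of the
  image of \<open>b\<close>. Otherwise it has to go to a root of the image of its minimal polynomial
  \<open>p\<close>. In characteristic 0 the derivative of \<open>p\<close> is nonzero at
  \<open>x\<close>, so Bezout's identity for the product of \<open>b\<close> with this derivative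
  yields an \<open>a\<close> whose nonvanishing makes all these roots simple and keeps
  \<open>b\<close> nonzero there; degree at least 2 then provides two of them.\<close>

lemma extension_step:
  assumes R: "subalgebra R" and Q: "prime_of (adjoin R x) Q" and b: "b \<in> adjoin R x" "b \<notin> Q"
  obtains a where "a \<in> R" "a \<notin> Q"
    "\<And>\<psi>. character_mod R Q \<psi> \<Longrightarrow> \<psi> a \<noteq> 0 \<Longrightarrow> \<exists>\<psi>'. extends R (adjoin R x) Q b \<psi> \<psi>'"
    "\<And>\<psi>. character_mod R Q \<psi> \<Longrightarrow> \<psi> a \<noteq> 0 \<Longrightarrow> \<not> fractional R Q x \<Longrightarrow>
      \<exists>\<psi>1 \<psi>2. extends R (adjoin R x) Q b \<psi> \<psi>1 \<and> extends R (adjoin R x) Q b \<psi> \<psi>2 \<and> \<psi>1 x \<noteq> \<psi>2 x"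
proof -
  note AR = adjoin_subset[OF R, of x]
  note SA = subalgebra_adjoin[OF R, of x]
  have QA: "ideal_of (adjoin R x) Q" and QR: "ideal_of R Q" and PR: "prime_of R Q"
    using Q prime_of_subset[OF Q AR] by (auto simp: prime_of_def)
  note pc = polys_closed[OF R] and pi = polys_ideal[OF R QR]
  have mem: "poly q x \<in> adjoin R x" if "q \<in> polys R" for q using that by (auto simp: adjoin_iff)
  obtain \<beta> where \<beta>: "\<beta> \<in> polys R" "b = poly \<beta> x" using b(1) by (auto simp: adjoin_iff)
  define Z where "Z = {p \<in> polys R. poly p x \<in> Q}"
  have Z: "poly_ideal R Q Z" unfolding poly_ideal_def
  proof (intro conjI ballI subsetI)
    show "y \<in> polys R" if "y \<in> Z" for y using that by (auto simp: Z_def)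
    show "y \<in> Z" if "y \<in> polys Q \<inter> polys R" for y
      using that poly_in_ideal[OF R QA] by (auto simp: Z_def)
    show "y - z \<in> Z" if "y \<in> Z" "z \<in> Z" for y z
      using that pc ideal_ofD(6)[OF QA SA] by (auto simp: Z_def)
    show "y * z \<in> Z" if "y \<in> polys R" "z \<in> Z" for y z
      using that pc ideal_ofD(3)[OF QA SA] mem by (auto simp: Z_def)
  qed
  have ext: "\<exists>\<psi>'. extends R (adjoin R x) Q b \<psi> \<psi>' \<and> \<psi>' x = s"
    if \<psi>: "character_mod R Q \<psi>" and s: "\<And>q. q \<in> Z \<Longrightarrow> poly (map_poly \<psi> q) s = 0"
      "poly (map_poly \<psi> \<beta>) s \<noteq> 0" for \<psi> s
  proof -
    obtain \<psi>' where "character (adjoin R x) \<psi>'" "\<And>a. a \<in> R \<Longrightarrow> \<psi>' a = \<psi> a"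
      "\<And>a. a \<in> Q \<inter> adjoin R x \<Longrightarrow> \<psi>' a = 0" "\<psi>' x = s"
      "\<And>p. p \<in> polys R \<Longrightarrow> \<psi>' (poly p x) = poly (map_poly \<psi> p) s"
      using \<psi> s(1) by (elim character_extend[OF R _ QA, of \<psi> s, rotated -1]) (auto simp: character_mod_def Z_def)
    then show ?thesis using s \<beta> unfolding extends_def character_mod_def by metis
  qed
  show ?thesis
  proof (cases "Z \<subseteq> polys Q")
    \<comment> \<open>All relations have coefficients in \<open>Q\<close>: \<open>x\<close> is
      transcendental over the fractions of \<open>R / Q\<close>, and all but finitely many values
      are admissible.\<close>
    case True
    have "\<beta> \<notin> polys Q" using poly_in_ideal[OF R QA] b \<beta> by auto
    then obtain i where i: "coeff \<beta> i \<notin> Q" by (auto simp: polys_def)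
    have two: "\<exists>\<psi>1 \<psi>2. extends R (adjoin R x) Q b \<psi> \<psi>1 \<and> extends R (adjoin R x) Q b \<psi> \<psi>2 \<and> \<psi>1 x \<noteq> \<psi>2 x"
      if \<psi>: "character_mod R Q \<psi>" and a: "\<psi> (coeff \<beta> i) \<noteq> 0" for \<psi>
    proof -
      have \<psi>0: "\<psi> 0 = 0" using characterD(2)[OF _ R] \<psi> by (auto simp: character_mod_def)
      have "map_poly \<psi> \<beta> \<noteq> 0" using a \<psi>0 by (metis coeff_0 coeff_map_poly)
      then have fin: "finite {s. poly (map_poly \<psi> \<beta>) s = 0}" by (rule poly_roots_finite)
      have inf: "infinite (UNIV :: 'k set)" by (rule infinite_UNIV_char_0)
      obtain s where s: "poly (map_poly \<psi> \<beta>) s \<noteq> 0" using ex_new_if_finite[OF inf fin] by auto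
      obtain t where t: "poly (map_poly \<psi> \<beta>) t \<noteq> 0" "t \<noteq> s"
        using ex_new_if_finite[OF inf, of "insert s {s. poly (map_poly \<psi> \<beta>) s = 0}"] fin by auto
      have zero: "map_poly \<psi> q = 0" if "q \<in> Z" for q
        using that True \<psi> \<psi>0 by (intro map_poly_ideal[of Q R]) (auto simp: character_mod_def Z_def)
      show ?thesis using ext[OF \<psi> _ s] ext[OF \<psi> _ t(1)] zero t(2) by (metis poly_0)
    qed
    show ?thesis
      by (rule that[of "coeff \<beta> i"]) (use i polysD[OF \<beta>(1)] two in blast)+
  next
    case False
    from poly_ideal_minimal[OF R QR Z this] obtain p where p: "p \<in> Z" "lead_coeff p \<notin> Q"
      "\<And>q. q \<in> Z \<Longrightarrow> degree q < degree p \<Longrightarrow> q \<in> polys Q" by metis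
    have pR: "p \<in> polys R" and px: "poly p x \<in> Q" using p by (auto simp: Z_def)
    have dp: "degree p > 0"
    proof (rule ccontr)
      assume "\<not> degree p > 0"
      then obtain c where "p = [:c:]" by (metis degree_eq_zeroE gr0I)
      then show False using p px by auto
    qed
    define d where "d = formal_deriv p"
    have dR: "d \<in> polys R" using pc pR by (auto simp: d_def)
    have dnQ: "poly d x \<notin> Q"
    proof
      assume "poly d x \<in> Q"
      then have "d \<in> polys Q" using p(3)[of d] degree_formal_deriv[OF dp] dR by (auto simp: Z_def d_def)
      then have "coeff d (degree p - 1) \<in> Q" by (rule polysD)
      then have "of_nat (degree p) * lead_coeff p \<in> Q" using dp by (simp add: d_def coeff_formal_deriv)
      moreover have "of_nat n = \<iota> (of_nat n)" for n by (induction n) (auto simp: \<iota>_add)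
      ultimately have "\<iota> (of_nat (degree p)) * lead_coeff p \<in> Q" by simp
      \<comment> \<open>Characteristic 0 enters here: the degree of \<open>p\<close> is
        invertible.\<close>
      then have "\<iota> (inverse (of_nat (degree p))) * (\<iota> (of_nat (degree p)) * lead_coeff p) \<in> Q"
        using ideal_ofD(3)[OF QR R] subalgebraD(1)[OF R] by blast
      moreover have "\<iota> (inverse (of_nat (degree p))) * (\<iota> (of_nat (degree p)) * lead_coeff p) = lead_coeff p"
        using dp by (simp add: mult.assoc[symmetric] \<iota>_mult[symmetric])
      ultimately show False using p by simp
    qed
    have min: "q \<in> polys Q" if "q \<in> polys R" "poly q x \<in> Q" "degree q < degree p" for q
      using that p(3) by (auto simp: Z_def)
    have nb: "poly (\<beta> * d) x \<notin> Q" using primeD[OF Q mem[OF \<beta>(1)] mem[OF dR]] b \<beta> dnQ by auto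
    obtain a u v w where a: "a \<in> R" "a \<notin> Q" "u \<in> polys R" "v \<in> polys R" "w \<in> polys Q" "w \<in> polys R"
      "[:a:] = u * p + v * (\<beta> * d) + w"
      by (rule bezout_modulo_prime[OF R Q pR px p(2) dp min pc(5)[OF \<beta>(1) dR] nb])
    define l where "l = lead_coeff p"
    have lR: "l \<in> R" using polysD[OF pR] by (simp add: l_def)
    have main: "degree (map_poly \<psi> p) = degree p \<and> (\<forall>s. poly (map_poly \<psi> p) s = 0 \<longrightarrow>
        poly (pderiv (map_poly \<psi> p)) s \<noteq> 0 \<and> (\<exists>\<psi>'. extends R (adjoin R x) Q b \<psi> \<psi>' \<and> \<psi>' x = s))"
      if \<psi>: "character_mod R Q \<psi>" and al: "\<psi> (a * l) \<noteq> 0" for \<psi>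
    proof -
      have ch: "character R \<psi>" and kill: "\<And>c. c \<in> Q \<inter> R \<Longrightarrow> \<psi> c = 0" using \<psi> by (auto simp: character_mod_def)
      note \<psi>D = characterD[OF ch R] and mp = map_poly_character[OF ch R]
      have al': "\<psi> a \<noteq> 0" "\<psi> l \<noteq> 0" using al \<psi>D(5)[OF a(1) lR] by auto
      have mpQ: "map_poly \<psi> r = 0" if "r \<in> polys Q" "r \<in> polys R" for r
        using map_poly_ideal[where Q = Q and R = R and \<psi> = \<psi>, OF kill that \<psi>D(2)] .
      have deg: "degree (map_poly \<psi> p) = degree p"
        using al'(2) \<psi>D(2) by (intro antisym le_degree degree_le) (auto simp: coeff_map_poly coeff_eq_0 l_def)
      { fix s assume s: "poly (map_poly \<psi> p) s = 0"
        have "[:\<psi> a:] = map_poly \<psi> [:a:]" using \<psi>D by (simp add: map_poly_pCons)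
        also have "\<dots> = map_poly \<psi> u * map_poly \<psi> p + map_poly \<psi> v * (map_poly \<psi> \<beta> * pderiv (map_poly \<psi> p))"
          unfolding a(7) using pc a pR \<beta> dR mpQ[OF a(5,6)] by (simp add: mp d_def)
        finally have "poly [:\<psi> a:] s = poly (map_poly \<psi> v) s * (poly (map_poly \<psi> \<beta>) s * poly (pderiv (map_poly \<psi> p)) s)"
          using s by simp
        then have nz: "poly (map_poly \<psi> \<beta>) s \<noteq> 0" "poly (pderiv (map_poly \<psi> p)) s \<noteq> 0"
          using al'(1) by auto
        have root: "poly (map_poly \<psi> q) s = 0" if q: "q \<in> Z" for q
        proof -
          obtain k t r where t: "t \<in> polys R" "r \<in> polys R" "r \<in> polys Q"
            "smult (lead_coeff p ^ k) q = t * p + r"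
            using poly_ideal_reduce[OF R QR Z p(1) dp p(3) q] by metis
          have qR: "q \<in> polys R" using q by (auto simp: Z_def)
          have "smult (\<psi> l ^ k) (map_poly \<psi> q) = map_poly \<psi> (smult (l ^ k) q)"
            using qR lR subalgebraD(8)[OF R lR] by (simp add: mp \<psi>D)
          also have "\<dots> = map_poly \<psi> t * map_poly \<psi> p"
            using t pR pc mpQ[OF t(3,2)] by (simp add: mp l_def)
          finally have "\<psi> l ^ k * poly (map_poly \<psi> q) s = 0" using s by (metis mult_zero_right poly_mult poly_smult)
          then show ?thesis using al' by simp
        qed
        from ext[OF \<psi> root nz(1)] nz(2)
        have "poly (pderiv (map_poly \<psi> p)) s \<noteq> 0 \<and> (\<exists>\<psi>'. extends R (adjoin R x) Q b \<psi> \<psi>' \<and> \<psi>' x = s)"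
          by blast }
      then show ?thesis using deg by blast
    qed
    show ?thesis
    \<comment> \<open>The factor \<open>l\<close> preserves the degree of \<open>p\<close> under
      \<open>\<psi>\<close>, and the factor \<open>a\<close> keeps the left side of Bezout's
      identity nonzero.\<close>
    proof (rule that[of "a * l"])
      show "a * l \<in> R" using a(1) lR by (rule subalgebraD(5)[OF R])
      show "a * l \<notin> Q" using primeD[OF PR a(1) lR] a(2) p(2) by (auto simp: l_def)
      fix \<psi> assume \<psi>: "character_mod R Q \<psi>" "\<psi> (a * l) \<noteq> 0"
      note m = main[OF \<psi>]
      obtain s where "poly (map_poly \<psi> p) s = 0"
        using alg_closed_imp_poly_has_root[of "map_poly \<psi> p"] m dp by auto
      then show "\<exists>\<psi>'. extends R (adjoin R x) Q b \<psi> \<psi>'" using m by blast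
      assume nf: "\<not> fractional R Q x"
      have "degree p \<noteq> 1"
      proof
        assume "degree p = 1"
        then have "poly p x = coeff p 0 + coeff p 1 * x" by (simp add: poly_altdef)
        then have "coeff p 1 * x - (- coeff p 0) \<in> Q" using px by (simp add: add.commute)
        moreover have "coeff p 1 \<in> R" "- coeff p 0 \<in> R" "coeff p 1 \<notin> Q"
          using polysD[OF pR] subalgebraD(6)[OF R] p(2) \<open>degree p = 1\<close> by auto
        ultimately show False using nf unfolding fractional_def by blast
      qed
      then have "degree (map_poly \<psi> p) \<ge> 2" using m dp by simp
      then obtain s t where "poly (map_poly \<psi> p) s = 0" "poly (map_poly \<psi> p) t = 0" "s \<noteq> t"
        using two_roots m by metis
      then show "\<exists>\<psi>1 \<psi>2. extends R (adjoin R x) Q b \<psi> \<psi>1 \<and> extends R (adjoin R x) Q b \<psi> \<psi>2 \<and> \<psi>1 x \<noteq> \<psi>2 x"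
        using m by metis
    qed
  qed
qed

section \<open>Chains of adjunctions and the Nullstellensatz\<close>

fun adjoin_list :: "'r set \<Rightarrow> 'r list \<Rightarrow> 'r set" where
  "adjoin_list R [] = R"
| "adjoin_list R (x # xs) = adjoin_list (adjoin R x) xs"

lemma adjoin_list_subalgebra: "subalgebra R \<Longrightarrow> subalgebra (adjoin_list R xs)"
  by (induction xs arbitrary: R) (auto simp: subalgebra_adjoin)

lemma adjoin_list_subset: "subalgebra R \<Longrightarrow> R \<subseteq> adjoin_list R xs"
proof (induction xs arbitrary: R)
  case (Cons x xs)
  then show ?case using adjoin_subset[of R x] subalgebra_adjoin[of R x] by fastforce
qed auto

lemma adjoin_list_mem: "subalgebra R \<Longrightarrow> x \<in> set xs \<Longrightarrow> x \<in> adjoin_list R xs"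
proof (induction xs arbitrary: R)
  case (Cons y xs)
  then show ?case
    using adjoin_self[of R x] subalgebra_adjoin[of R y] adjoin_list_subset[of "adjoin R y" xs] by auto
qed auto

lemma adjoin_list_minimal: "subalgebra T \<Longrightarrow> R \<subseteq> T \<Longrightarrow> set xs \<subseteq> T \<Longrightarrow> adjoin_list R xs \<subseteq> T"
  by (induction xs arbitrary: R) (auto simp: adjoin_minimal)

text \<open>The condition on \<open>b\<close> is pulled down the chain: the induction hypothesis
  turns it into a condition on some \<open>c\<close> in \<open>adjoin R x\<close>, and
  \<open>extension_step\<close> turns that into one on \<open>a\<close> in \<open>R\<close>.\<close>

lemma extension_list:
  assumes "subalgebra R" "prime_of (adjoin_list R xs) Q" "b \<in> adjoin_list R xs" "b \<notin> Q"
  obtains a where "a \<in> R" "a \<notin> Q"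
    "\<And>\<psi>. character_mod R Q \<psi> \<Longrightarrow> \<psi> a \<noteq> 0 \<Longrightarrow> \<exists>\<psi>'. extends R (adjoin_list R xs) Q b \<psi> \<psi>'"
proof -
  have "\<exists>a\<in>R. a \<notin> Q \<and> (\<forall>\<psi>. character_mod R Q \<psi> \<longrightarrow> \<psi> a \<noteq> 0 \<longrightarrow> (\<exists>\<psi>'. extends R (adjoin_list R xs) Q b \<psi> \<psi>'))"
    using assms
  proof (induction xs arbitrary: R)
    case Nil
    then show ?case by (auto simp: extends_def)
  next
    case (Cons x xs)
    have S: "subalgebra (adjoin R x)" using Cons.prems subalgebra_adjoin by blast
    obtain c where c: "c \<in> adjoin R x" "c \<notin> Q" "\<And>\<psi>. character_mod (adjoin R x) Q \<psi> \<Longrightarrow> \<psi> c \<noteq> 0 \<Longrightarrow>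
        \<exists>\<psi>'. extends (adjoin R x) (adjoin_list R (x # xs)) Q b \<psi> \<psi>'"
      using Cons.IH[OF S] Cons.prems by auto
    have "prime_of (adjoin R x) Q" using Cons.prems(2) adjoin_list_subset[OF S, of xs] prime_of_subset by auto
    from extension_step[OF Cons.prems(1) this c(1,2)] obtain a where a: "a \<in> R" "a \<notin> Q"
      "\<And>\<psi>. character_mod R Q \<psi> \<Longrightarrow> \<psi> a \<noteq> 0 \<Longrightarrow> \<exists>\<psi>'. extends R (adjoin R x) Q c \<psi> \<psi>'" by metis
    show ?case
    proof (intro bexI[of _ a] conjI allI impI)
      fix \<psi> assume "character_mod R Q \<psi>" "\<psi> a \<noteq> 0"
      from a(3)[OF this] obtain \<psi>1 where 1: "extends R (adjoin R x) Q c \<psi> \<psi>1" by blast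
      then have "\<exists>\<psi>2. extends (adjoin R x) (adjoin_list R (x # xs)) Q b \<psi>1 \<psi>2"
        by (intro c(3)) (auto simp: extends_def)
      then obtain \<psi>2 where "extends (adjoin R x) (adjoin_list R (x # xs)) Q b \<psi>1 \<psi>2" by blast
      then show "\<exists>\<psi>'. extends R (adjoin_list R (x # xs)) Q b \<psi> \<psi>'"
        using 1 adjoin_subset[OF Cons.prems(1), of x] unfolding extends_def by (metis subsetD)
    qed (use a in auto)
  qed
  then show ?thesis using that by blast
qed

text \<open>Zorn's lemma gives a maximal proper ideal; together with any element outside it
  generates the unit ideal, and primeness follows.\<close>

lemma exists_maximal_ideal:
  assumes S: "subalgebra S" and J: "ideal_of S J" "J \<subseteq> S" "1 \<notin> J"
  obtains M where "prime_of S M" "J \<subseteq> M"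
proof -
  define \<A> where "\<A> = {I. ideal_of S I \<and> J \<subseteq> I \<and> I \<subseteq> S \<and> 1 \<notin> I}"
  have "\<exists>M\<in>\<A>. \<forall>X\<in>\<A>. M \<subseteq> X \<longrightarrow> X = M"
  proof (rule subset_Zorn_nonempty)
    show "\<A> \<noteq> {}" using J by (auto simp: \<A>_def)
    fix C assume C: "C \<noteq> {}" "subset.chain \<A> C"
    have CA: "I \<in> \<A>" if "I \<in> C" for I using C that by (auto simp: subset.chain_def)
    have "a + b \<in> \<Union>C" if ab: "a \<in> \<Union>C" "b \<in> \<Union>C" for a b
    proof -
      obtain I I' where I: "I \<in> C" "a \<in> I" "I' \<in> C" "b \<in> I'" using ab by blast
      have "I \<subseteq> I' \<or> I' \<subseteq> I" using C(2) I by (auto simp: subset_chain_def)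
      then show ?thesis
      proof
        assume "I \<subseteq> I'"
        then have "a + b \<in> I'" using CA[OF I(3)] I by (auto simp: \<A>_def ideal_of_def)
        then show ?thesis using I by blast
      next
        assume "I' \<subseteq> I"
        then have "a + b \<in> I" using CA[OF I(1)] I by (auto simp: \<A>_def ideal_of_def)
        then show ?thesis using I by blast
      qed
    qed
    moreover have "0 \<in> \<Union>C" using C(1) CA by (fastforce simp: \<A>_def ideal_of_def)
    moreover have "a * b \<in> \<Union>C" if "a \<in> S" "b \<in> \<Union>C" for a b
      using that CA by (fastforce simp: \<A>_def ideal_of_def)
    ultimately have "ideal_of S (\<Union>C)" by (auto simp: ideal_of_def simp del: Union_iff)
    then show "\<Union>C \<in> \<A>" using CA C(1) by (fastforce simp: \<A>_def)
  qed
  then obtain M where M: "M \<in> \<A>" "\<And>X. X \<in> \<A> \<Longrightarrow> M \<subseteq> X \<Longrightarrow> X = M" by blast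
  have MI: "ideal_of S M" "J \<subseteq> M" "M \<subseteq> S" "1 \<notin> M" using M(1) by (auto simp: \<A>_def)
  note SD = subalgebraD[OF S] and MD = ideal_ofD[OF MI(1) S]
  have comaximal: "\<exists>m\<in>M. \<exists>s\<in>S. 1 = m + s * a" if a: "a \<in> S" "a \<notin> M" for a
  proof (rule ccontr)
    assume no: "\<not> (\<exists>m\<in>M. \<exists>s\<in>S. 1 = m + s * a)"
    define X where "X = {m + s * a |m s. m \<in> M \<and> s \<in> S}"
    have "ideal_of S X" unfolding ideal_of_def
    proof (intro conjI ballI)
      show "0 \<in> X" unfolding X_def using MD(1) SD(2) by (intro CollectI exI[of _ 0]) auto
      fix b c assume c: "c \<in> X"
      then obtain m s where ms: "m \<in> M" "s \<in> S" "c = m + s * a" by (auto simp: X_def)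
      { assume "b \<in> X"
        then obtain m' s' where "m' \<in> M" "s' \<in> S" "b = m' + s' * a" by (auto simp: X_def)
        then show "b + c \<in> X" unfolding X_def using ms MD(2) SD(4)
          by (intro CollectI exI[of _ "m' + m"] exI[of _ "s' + s"]) (auto simp: algebra_simps) }
      { assume "b \<in> S"
        then show "b * c \<in> X" unfolding X_def using ms MD(3) SD(5)
          by (intro CollectI exI[of _ "b * m"] exI[of _ "b * s"]) (auto simp: algebra_simps) }
    qed
    moreover have MX: "M \<subseteq> X"
    proof
      fix m assume "m \<in> M"
      then show "m \<in> X" unfolding X_def using SD(2) by (intro CollectI exI[of _ m] exI[of _ 0]) auto
    qed
    moreover have "X \<subseteq> S" using MI(3) SD(4,5) a(1) by (auto simp: X_def)
    moreover have "1 \<notin> X" using no by (auto simp: X_def)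
    ultimately have "X = M" using M(2) MI(2) by (auto simp: \<A>_def)
    moreover have "a \<in> X" unfolding X_def using MD(1) SD(3) by (intro CollectI exI[of _ 0] exI[of _ 1]) auto
    ultimately show False using a by simp
  qed
  have "prime_of S M" unfolding prime_of_def
  proof (intro conjI ballI impI)
    fix a b assume ab: "a \<in> S" "b \<in> S" "a * b \<in> M"
    show "a \<in> M \<or> b \<in> M"
    proof (rule disjCI)
      assume "b \<notin> M"
      then obtain m s where ms: "m \<in> M" "s \<in> S" "1 = m + s * b" using comaximal ab by blast
      have "a = m * a + s * (a * b)" using arg_cong[OF ms(3), of "\<lambda>t. a * t"] by (simp add: algebra_simps)
      moreover have "m * a + s * (a * b) \<in> M" using MD(2-4) ms ab by blast
      ultimately show "a \<in> M" by simp
    qed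
  qed (use MI in auto)
  then show ?thesis using that MI by blast
qed

lemma subalgebra_range: "subalgebra (range \<iota>)"
  unfolding subalgebra_def by (auto simp: \<iota>_add[symmetric] \<iota>_mult[symmetric])

lemma \<iota>_injective:
  assumes "(1 :: 'r) \<noteq> 0" "\<iota> a = \<iota> b"
  shows "a = b"
proof (rule ccontr)
  assume "a \<noteq> b"
  then have "1 = \<iota> (inverse (a - b)) * \<iota> (a + - b)" by (simp add: \<iota>_mult[symmetric])
  also have "\<iota> (a + - b) = 0" using assms(2) by (simp only: \<iota>_add \<iota>_minus) simp
  finally show False using assms(1) by simp
qed

text \<open>This is \<open>extension_list\<close> over the constants, with a maximal ideal
  containing \<open>J\<close> as \<open>Q\<close> and \<open>1\<close> as the element to be kept
  nonzero. The condition on the base is that a constant outside \<open>Q\<close> be nonzero, and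
  that is automatic.\<close>

lemma weak_Nullstellensatz:
  assumes J: "ideal_of (adjoin_list (range \<iota>) xs) J" "J \<subseteq> adjoin_list (range \<iota>) xs" "1 \<notin> J"
  obtains \<psi> where "character (adjoin_list (range \<iota>) xs) \<psi>" "\<And>a. a \<in> J \<Longrightarrow> \<psi> a = 0"
proof -
  let ?S = "adjoin_list (range \<iota>) xs"
  have S: "subalgebra ?S" using adjoin_list_subalgebra[OF subalgebra_range] .
  obtain M where M: "prime_of ?S M" "J \<subseteq> M" using exists_maximal_ideal[OF S J] .
  have MI: "ideal_of ?S M" "1 \<notin> M" using M(1) by (auto simp: prime_of_def)
  have ne: "(1 :: 'r) \<noteq> 0" using MI by (auto simp: ideal_of_def)
  define \<psi>0 where "\<psi>0 = inv_into UNIV \<iota>"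
  have inj: "inj \<iota>" using \<iota>_injective[OF ne] by (auto simp: inj_def)
  have \<psi>0: "\<psi>0 (\<iota> c) = c" for c by (simp add: \<psi>0_def inj)
  have unit: "c = 0" if "\<iota> c \<in> M" for c
  proof (rule ccontr)
    assume "c \<noteq> 0"
    then have "1 = \<iota> (inverse c) * \<iota> c" by (simp add: \<iota>_mult[symmetric])
    also have "\<dots> \<in> M" using ideal_ofD(3)[OF MI(1) S] subalgebraD(1)[OF S] that by blast
    finally show False using MI by simp
  qed
  have "character_mod (range \<iota>) M \<psi>0"
    unfolding character_mod_def character_def
    using unit by (auto simp: \<psi>0 \<iota>_add[symmetric] \<iota>_mult[symmetric])
  moreover obtain a where a: "a \<in> range \<iota>" "a \<notin> M"
    "\<And>\<psi>. character_mod (range \<iota>) M \<psi> \<Longrightarrow> \<psi> a \<noteq> 0 \<Longrightarrow> \<exists>\<psi>'. extends (range \<iota>) ?S M 1 \<psi> \<psi>'"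
    using extension_list[OF subalgebra_range M(1) subalgebraD(3)[OF S] MI(2)] by blast
  moreover have "\<psi>0 a \<noteq> 0" using a \<psi>0 ideal_ofD(1)[OF MI(1) S] by auto
  ultimately obtain \<psi> where \<psi>: "extends (range \<iota>) ?S M 1 \<psi>0 \<psi>" by blast
  show ?thesis
    by (rule that[of \<psi>]) (use \<psi> J M in \<open>auto simp: extends_def character_mod_def\<close>)
qed

end

section \<open>Polynomials and linear substitutions\<close>

abbreviation "lookup \<equiv> Poly_Mapping.lookup"
abbreviation "keys \<equiv> Poly_Mapping.keys"
abbreviation "single \<equiv> Poly_Mapping.single"

section \<open>Monomials, degrees and evaluation\<close>

definition monomial_value :: "('x \<Rightarrow> 'r::comm_semiring_1) \<Rightarrow> ('x \<Rightarrow>\<^sub>0 nat) \<Rightarrow> 'r" where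
  "monomial_value v \<alpha> = (\<Prod>i\<in>keys \<alpha>. v i ^ lookup \<alpha> i)"

lemma monomial_value_superset:
  "finite A \<Longrightarrow> keys \<alpha> \<subseteq> A \<Longrightarrow> monomial_value v \<alpha> = (\<Prod>i\<in>A. v i ^ lookup \<alpha> i)"
  unfolding monomial_value_def by (intro prod.mono_neutral_left) (auto simp: in_keys_iff)

lemma monomial_value_add: "monomial_value v (\<alpha> + \<beta>) = monomial_value v \<alpha> * monomial_value v \<beta>"
  using keys_add[of \<alpha> \<beta>]
  by (simp add: monomial_value_superset[of "keys \<alpha> \<union> keys \<beta>"] lookup_add power_add prod.distrib)

lemma monomial_value_0 [simp]: "monomial_value v 0 = 1"
  by (simp add: monomial_value_def)

lemma monomial_value_single [simp]: "monomial_value v (single i n) = v i ^ n"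
  by (simp add: monomial_value_def)

lemma expdeg_superset: "finite A \<Longrightarrow> keys \<alpha> \<subseteq> A \<Longrightarrow> expdeg \<alpha> = (\<Sum>i\<in>A. lookup \<alpha> i)"
  unfolding expdeg_def by (intro sum.mono_neutral_left) (auto simp: in_keys_iff)

lemma expdeg_add: "expdeg (\<alpha> + \<beta>) = expdeg \<alpha> + expdeg \<beta>"
  using keys_add[of \<alpha> \<beta>]
  by (simp add: expdeg_superset[of "keys \<alpha> \<union> keys \<beta>"] lookup_add sum.distrib)

lemma expdeg_0 [simp]: "expdeg 0 = 0"
  by (simp add: expdeg_def)

lemma expdeg_single [simp]: "expdeg (single i n) = n"
  by (simp add: expdeg_def)

definition semiring_hom :: "('a::comm_semiring_1 \<Rightarrow> 'b::comm_semiring_1) \<Rightarrow> bool" where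
  "semiring_hom h \<longleftrightarrow> h 0 = 0 \<and> h 1 = 1 \<and> (\<forall>a b. h (a + b) = h a + h b \<and> h (a * b) = h a * h b)"

lemma semiring_homD:
  assumes "semiring_hom h"
  shows "h 0 = 0" "h 1 = 1" "h (a + b) = h a + h b" "h (a * b) = h a * h b" "h (a ^ n) = h a ^ n"
    "h (sum u I) = (\<Sum>i\<in>I. h (u i))" "h (prod u I) = (\<Prod>i\<in>I. h (u i))" "h (of_nat n) = of_nat n"
proof -
  show 1: "h 0 = 0" "h 1 = 1" "h (a + b) = h a + h b" "h (a * b) = h a * h b" for a b
    using assms by (auto simp: semiring_hom_def)
  show "h (a ^ n) = h a ^ n" by (induction n) (auto simp: 1)
  show "h (of_nat n) = of_nat n" by (induction n) (auto simp: 1)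
  show "h (sum u I) = (\<Sum>i\<in>I. h (u i))" "h (prod u I) = (\<Prod>i\<in>I. h (u i))"
    by (induction I rule: infinite_finite_induct) (auto simp: 1)
qed

lemma eval_poly_superset:
  assumes "h 0 = 0" "finite A" "keys P \<subseteq> A"
  shows "eval_poly h v P = (\<Sum>\<alpha>\<in>A. h (lookup P \<alpha>) * monomial_value v \<alpha>)"
  unfolding eval_poly_def monomial_value_def[symmetric]
  using assms by (intro sum.mono_neutral_left) (auto simp: in_keys_iff)

lemma eval_poly_single:
  assumes "h 0 = 0"
  shows "eval_poly h v (single \<alpha> c) = h c * monomial_value v \<alpha>"
  using assms by (subst eval_poly_superset[of h "{\<alpha>}"]) auto

lemma eval_poly_0 [simp]: "eval_poly h v 0 = 0"
  by (simp add: eval_poly_def)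

lemma eval_poly_add:
  assumes "semiring_hom h"
  shows "eval_poly h v (P + Q) = eval_poly h v P + eval_poly h v Q"
  using keys_add[of P Q] semiring_homD[OF assms]
  by (simp add: eval_poly_superset[of h "keys P \<union> keys Q"] lookup_add sum.distrib distrib_right)

lemma eval_poly_sum:
  assumes "semiring_hom h"
  shows "eval_poly h v (sum u I) = (\<Sum>i\<in>I. eval_poly h v (u i))"
  by (induction I rule: infinite_finite_induct) (auto simp: eval_poly_add[OF assms])

lemma poly_mapping_sum_single: "P = (\<Sum>\<alpha>\<in>keys P. single \<alpha> (lookup P \<alpha>))"
  by (rule poly_mapping_eqI)
     (auto simp: lookup_sum lookup_single when_def in_keys_iff sum.delta' intro: sym)

lemma sum_single_superset:
  assumes "finite A" "keys P \<subseteq> A"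
  shows "P = (\<Sum>\<alpha>\<in>A. single \<alpha> (lookup P \<alpha>))"
  by (subst poly_mapping_sum_single, intro sum.mono_neutral_left) (use assms in \<open>auto simp: in_keys_iff\<close>)

lemma eval_poly_mult:
  assumes "semiring_hom h"
  shows "eval_poly h v (P * Q) = eval_poly h v P * eval_poly h v Q"
proof -
  note hD = semiring_homD[OF assms]
  have "P * Q = (\<Sum>\<alpha>\<in>keys P. \<Sum>\<beta>\<in>keys Q. single \<alpha> (lookup P \<alpha>) * single \<beta> (lookup Q \<beta>))"
    by (simp only: sum_product[symmetric] poly_mapping_sum_single[symmetric])
  then have "eval_poly h v (P * Q) = (\<Sum>\<alpha>\<in>keys P. \<Sum>\<beta>\<in>keys Q.
      (h (lookup P \<alpha>) * monomial_value v \<alpha>) * (h (lookup Q \<beta>) * monomial_value v \<beta>))"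
    by (simp only: mult_single eval_poly_sum[OF assms] eval_poly_single[of h v, OF hD(1)] hD(4) monomial_value_add mult_ac)
  then show ?thesis
    by (simp only: eval_poly_def monomial_value_def[symmetric] sum_product)
qed

lemma eval_poly_const:
  assumes "semiring_hom h"
  shows "eval_poly h v (const c) = h c"
  using semiring_homD[OF assms] by (simp add: const_def eval_poly_single)

lemma eval_poly_var:
  assumes "semiring_hom h"
  shows "eval_poly h v (var i) = v i"
  using semiring_homD[OF assms] by (simp add: var_def eval_poly_single)

lemma semiring_hom_eval_poly:
  assumes "semiring_hom h"
  shows "semiring_hom (eval_poly h v)"
  using eval_poly_const[OF assms, of v 1] semiring_homD[OF assms]
  by (simp add: semiring_hom_def eval_poly_add[OF assms] eval_poly_mult[OF assms] const_def)

lemma eval_poly_hom: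
  assumes "semiring_hom \<phi>"
  shows "\<phi> (eval_poly h v P) = eval_poly (\<lambda>c. \<phi> (h c)) (\<lambda>i. \<phi> (v i)) P"
  by (simp add: eval_poly_def semiring_homD[OF assms])

lemma semiring_hom_const: "semiring_hom (const :: 'k::comm_semiring_1 \<Rightarrow> ('x, 'k) mpoly)"
  by (auto simp: semiring_hom_def const_def single_add mult_single)

lemma semiring_hom_id: "semiring_hom (\<lambda>c. c)"
  by (auto simp: semiring_hom_def)

lemma const_monomial_value: "const (c :: 'a::comm_semiring_1) * monomial_value var \<alpha> = single \<alpha> c"
proof -
  have "monomial_value var \<alpha> = single \<alpha> (1 :: 'a)"
  proof -
    have *: "(\<Prod>i\<in>A. var i ^ n i) = single (\<Sum>i\<in>A. single i (n i)) (1 :: 'a)" for A :: "'b set" and n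
    proof (induction A rule: infinite_finite_induct)
      case (insert i A)
      have "var i ^ m = single (single i m) (1 :: 'a)" for m
        by (induction m) (auto simp: var_def mult_single single_add[symmetric])
      then show ?case using insert by (simp add: mult_single)
    qed auto
    show ?thesis unfolding monomial_value_def * by (simp add: poly_mapping_sum_single[symmetric])
  qed
  then show ?thesis by (simp add: const_def mult_single)
qed

lemma eval_poly_const_var: "eval_poly const var P = P"
  by (simp add: eval_poly_def monomial_value_def[symmetric] const_monomial_value poly_mapping_sum_single[symmetric])

section \<open>Homogeneous polynomials and their parts\<close>

lemma homogeneous_0 [simp]: "homogeneous d 0"
  by (simp add: homogeneous_def)

lemma homogeneous_1 [simp]: "homogeneous 0 1"
  by (simp add: homogeneous_def)

lemma homogeneous_add: "homogeneous d P \<Longrightarrow> homogeneous d Q \<Longrightarrow> homogeneous d (P + Q)"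
  using keys_add[of P Q] by (auto simp: homogeneous_def)

lemma homogeneous_sum: "(\<And>i. i \<in> I \<Longrightarrow> homogeneous d (u i)) \<Longrightarrow> homogeneous d (sum u I)"
  by (induction I rule: infinite_finite_induct) (auto simp: homogeneous_add)

lemma homogeneous_mult: "homogeneous d P \<Longrightarrow> homogeneous e Q \<Longrightarrow> homogeneous (d + e) (P * Q)"
  using keys_mult[of P Q] by (fastforce simp: homogeneous_def expdeg_add)

lemma homogeneous_const [simp]: "homogeneous 0 (const c)"
  by (auto simp: homogeneous_def const_def)

lemma homogeneous_var [simp]: "homogeneous 1 (var i)"
  by (auto simp: homogeneous_def var_def)

definition homogeneous_part :: "nat \<Rightarrow> ('x, 'k::comm_monoid_add) mpoly \<Rightarrow> ('x, 'k) mpoly" where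
  "homogeneous_part d P = (\<Sum>\<alpha>\<in>{\<alpha>\<in>keys P. expdeg \<alpha> = d}. single \<alpha> (lookup P \<alpha>))"

lemma homogeneous_homogeneous_part: "homogeneous d (homogeneous_part d P)"
  unfolding homogeneous_part_def by (rule homogeneous_sum) (auto simp: homogeneous_def)

lemma sum_homogeneous_part:
  assumes "\<And>\<alpha>. \<alpha> \<in> keys P \<Longrightarrow> expdeg \<alpha> < n"
  shows "P = (\<Sum>d<n. homogeneous_part d P)"
proof -
  have "(\<Sum>d<n. homogeneous_part d P) = (\<Sum>\<alpha>\<in>keys P. single \<alpha> (lookup P \<alpha>))"
    unfolding homogeneous_part_def by (rule sum.group) (use assms in auto)
  then show ?thesis by (simp add: poly_mapping_sum_single[symmetric])
qed

text \<open>A right action: \<open>substitute h F\<close> is \<open>F \<circ> h\<close>.\<close>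

definition substitute :: "'k::comm_semiring_1^3^3 \<Rightarrow> (3, 'k) mpoly \<Rightarrow> (3, 'k) mpoly" where
  "substitute h = eval_poly const (\<lambda>i. \<Sum>j\<in>UNIV. const (h $ i $ j) * var j)"

lemma act_eq_substitute: "act g = substitute (matrix_inv g)"
  by (simp add: act_def substitute_def)

lemma semiring_hom_substitute: "semiring_hom (substitute h)"
  unfolding substitute_def by (rule semiring_hom_eval_poly[OF semiring_hom_const])

lemma substitute_const [simp]: "substitute h (const c) = const c"
  unfolding substitute_def by (rule eval_poly_const[OF semiring_hom_const])

lemma substitute_var [simp]: "substitute h (var i) = (\<Sum>j\<in>UNIV. const (h $ i $ j) * var j)"
  unfolding substitute_def by (rule eval_poly_var[OF semiring_hom_const])

lemma substitute_substitute: "substitute g (substitute h F) = substitute (h ** g) F"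
proof -
  have "substitute g (substitute h F) =
     eval_poly const (\<lambda>i. \<Sum>j\<in>UNIV. const (h $ i $ j) * (\<Sum>k\<in>UNIV. const (g $ j $ k) * var k)) F"
    unfolding substitute_def[of h] eval_poly_hom[OF semiring_hom_substitute]
    by (simp add: semiring_homD[OF semiring_hom_substitute])
  also have "(\<lambda>i. \<Sum>j\<in>UNIV. const (h $ i $ j) * (\<Sum>k\<in>UNIV. const (g $ j $ k) * var k)) =
      (\<lambda>i. \<Sum>k\<in>UNIV. const ((h ** g) $ i $ k) * var k)"
  proof
    fix i
    have "(\<Sum>j\<in>UNIV. const (h $ i $ j) * (\<Sum>k\<in>UNIV. const (g $ j $ k) * var k)) =
       (\<Sum>j\<in>UNIV. \<Sum>k\<in>UNIV. const (h $ i $ j * g $ j $ k) * (var k :: (3, 'a) mpoly))"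
      by (simp add: sum_distrib_left mult.assoc semiring_homD[OF semiring_hom_const])
    also have "\<dots> = (\<Sum>k\<in>UNIV. const ((h ** g) $ i $ k) * var k)"
      by (subst sum.swap) (simp add: matrix_matrix_mult_def semiring_homD[OF semiring_hom_const] sum_distrib_right)
    finally show "(\<Sum>j\<in>UNIV. const (h $ i $ j) * (\<Sum>k\<in>UNIV. const (g $ j $ k) * var k)) =
       (\<Sum>k\<in>UNIV. const ((h ** g) $ i $ k) * (var k :: (3, 'a) mpoly))" .
  qed
  finally show ?thesis by (simp add: substitute_def)
qed

lemma substitute_id [simp]: "substitute (mat 1) F = F"
proof -
  have "(\<Sum>j\<in>UNIV. const ((mat 1 :: 'a^3^3) $ i $ j) * var j) = (var i :: (3, 'a) mpoly)" for i
  proof -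
    have "(\<Sum>j\<in>UNIV. const ((mat 1 :: 'a^3^3) $ i $ j) * var j) = (\<Sum>j\<in>UNIV. if i = j then var j else (0 :: (3, 'a) mpoly))"
      by (intro sum.cong) (auto simp: mat_def semiring_homD[OF semiring_hom_const])
    then show ?thesis by simp
  qed
  then show ?thesis by (simp add: substitute_def eval_poly_const_var)
qed

lemma finite_expdeg: "finite {\<alpha> :: 'x::finite \<Rightarrow>\<^sub>0 nat. expdeg \<alpha> = d}"
proof -
  have "lookup ` {\<alpha> :: 'x \<Rightarrow>\<^sub>0 nat. expdeg \<alpha> = d} \<subseteq> (UNIV \<rightarrow>\<^sub>E {..d})"
  proof -
    have "lookup \<alpha> i \<le> expdeg \<alpha>" for \<alpha> :: "'x \<Rightarrow>\<^sub>0 nat" and i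
      by (subst expdeg_superset[of UNIV]) (auto intro: member_le_sum)
    then show ?thesis by auto
  qed
  moreover have "finite ((UNIV :: 'x set) \<rightarrow>\<^sub>E {..d})" by (intro finite_PiE) auto
  ultimately have "finite (lookup ` {\<alpha> :: 'x \<Rightarrow>\<^sub>0 nat. expdeg \<alpha> = d})" by (rule finite_subset)
  then show ?thesis by (rule finite_imageD) (simp add: inj_on_def lookup_inject)
qed

text \<open>
  Instantiated below with a constant family (a ring of functions), with the forms in the entries of a
  matrix, and with the forms in the coefficients of a quartic.
\<close>

locale graded_functions =
  fixes T :: "nat \<Rightarrow> ('p \<Rightarrow> 'k::comm_semiring_1) set"
  assumes constants: "(\<lambda>_. c) \<in> T 0"
    and zero: "(\<lambda>_. 0) \<in> T n"
    and add: "u \<in> T n \<Longrightarrow> w \<in> T n \<Longrightarrow> (\<lambda>p. u p + w p) \<in> T n"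
    and mult: "u \<in> T m \<Longrightarrow> w \<in> T n \<Longrightarrow> (\<lambda>p. u p * w p) \<in> T (m + n)"
begin

lemma scale: "u \<in> T n \<Longrightarrow> (\<lambda>p. c * u p) \<in> T n"
  using mult[OF constants] by fastforce

lemma sum: "(\<And>i. i \<in> I \<Longrightarrow> u i \<in> T n) \<Longrightarrow> (\<lambda>p. \<Sum>i\<in>I. u i p) \<in> T n"
  by (induction I rule: infinite_finite_induct) (auto simp: zero add)

lemma power: "u \<in> T n \<Longrightarrow> (\<lambda>p. u p ^ m) \<in> T (m * n)"
  by (induction m) (auto simp: constants mult)

lemma prod: "finite I \<Longrightarrow> (\<And>i. i \<in> I \<Longrightarrow> u i \<in> T (n i)) \<Longrightarrow> (\<lambda>p. \<Prod>i\<in>I. u i p) \<in> T (\<Sum>i\<in>I. n i)"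
  by (induction I rule: finite_induct) (auto simp: constants mult)

lemma eval_homogeneous:
  assumes "homogeneous e q" "\<And>i. u i \<in> T d"
  shows "(\<lambda>p. eval_poly (\<lambda>c. c) (\<lambda>i. u i p) q) \<in> T (e * d)"
  unfolding eval_poly_def
proof (intro sum scale)
  fix \<alpha> assume "\<alpha> \<in> keys q"
  then have "(\<Sum>i\<in>keys \<alpha>. lookup \<alpha> i * d) = e * d"
    using assms(1) by (simp add: homogeneous_def expdeg_def sum_distrib_right[symmetric])
  moreover have "(\<lambda>p. \<Prod>i\<in>keys \<alpha>. u i p ^ lookup \<alpha> i) \<in> T (\<Sum>i\<in>keys \<alpha>. lookup \<alpha> i * d)"
    by (intro prod power assms) auto
  ultimately show "(\<lambda>p. \<Prod>i\<in>keys \<alpha>. u i p ^ lookup \<alpha> i) \<in> T (e * d)" by simp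
qed

text \<open>A polynomial depending on a parameter, with coefficients in \<open>T n\<close> as
  functions of it. The common finite support turns a coefficient of a product into one fixed finite
  sum.\<close>

definition coeffs_in :: "nat \<Rightarrow> ('p \<Rightarrow> ('x, 'k) mpoly) \<Rightarrow> bool" where
  "coeffs_in n u \<longleftrightarrow> (\<exists>A. finite A \<and> (\<forall>p. keys (u p) \<subseteq> A)) \<and> (\<forall>\<alpha>. (\<lambda>p. lookup (u p) \<alpha>) \<in> T n)"

lemma coeffs_in_0: "coeffs_in n (\<lambda>_. 0)"
  by (auto simp: coeffs_in_def zero intro: exI[of _ "{}"])

lemma coeffs_in_add:
  assumes "coeffs_in n u" "coeffs_in n w"
  shows "coeffs_in n (\<lambda>p. u p + w p)"
proof -
  obtain A B where "finite A" "\<forall>p. keys (u p) \<subseteq> A" "finite B" "\<forall>p. keys (w p) \<subseteq> B"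
    using assms by (auto simp: coeffs_in_def)
  then have "finite (A \<union> B) \<and> (\<forall>p. keys (u p + w p) \<subseteq> A \<union> B)"
    using keys_add by (metis Un_mono finite_Un order_trans)
  then show ?thesis using assms unfolding coeffs_in_def by (auto simp: lookup_add add)
qed

lemma coeffs_in_sum: "(\<And>i. i \<in> I \<Longrightarrow> coeffs_in n (u i)) \<Longrightarrow> coeffs_in n (\<lambda>p. \<Sum>i\<in>I. u i p)"
  by (induction I rule: infinite_finite_induct) (auto simp: coeffs_in_0 coeffs_in_add)

lemma coeffs_in_mult:
  assumes "coeffs_in m u" "coeffs_in n w"
  shows "coeffs_in (m + n) (\<lambda>p. u p * w p)"
proof -
  obtain A B where AB: "finite A" "\<And>p. keys (u p) \<subseteq> A" "finite B" "\<And>p. keys (w p) \<subseteq> B"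
    using assms by (auto simp: coeffs_in_def)
  have fin: "finite {a + b |a b. a \<in> A \<and> b \<in> B}"
    using AB by (intro finite_image_set2) auto
  have "keys (u p * w p) \<subseteq> {a + b |a b. a \<in> A \<and> b \<in> B}" for p
    using keys_mult[of "u p" "w p"] AB(2)[of p] AB(4)[of p] by blast
  moreover have "(\<lambda>p. lookup (u p * w p) \<gamma>) \<in> T (m + n)" for \<gamma>
  proof -
    have "lookup (u p * w p) \<gamma> = (\<Sum>\<alpha>\<in>A. \<Sum>\<beta>\<in>B. (if \<alpha> + \<beta> = \<gamma> then 1 else 0) * (lookup (u p) \<alpha> * lookup (w p) \<beta>))" for p
    proof -
      have "u p * w p = (\<Sum>\<alpha>\<in>A. \<Sum>\<beta>\<in>B. single \<alpha> (lookup (u p) \<alpha>) * single \<beta> (lookup (w p) \<beta>))"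
        by (simp only: sum_product[symmetric] sum_single_superset[OF AB(1,2), symmetric]
            sum_single_superset[OF AB(3,4), symmetric])
      then show ?thesis
        by (auto simp: lookup_sum mult_single lookup_single when_def intro!: sum.cong)
    qed
    moreover have "(\<lambda>p. \<Sum>\<alpha>\<in>A. \<Sum>\<beta>\<in>B. (if \<alpha> + \<beta> = \<gamma> then 1 else 0) * (lookup (u p) \<alpha> * lookup (w p) \<beta>)) \<in> T (m + n)"
      using assms by (intro sum scale mult) (auto simp: coeffs_in_def)
    ultimately show ?thesis by presburger
  qed
  ultimately show ?thesis using fin by (auto simp: coeffs_in_def)
qed

lemma coeffs_in_const: "u \<in> T n \<Longrightarrow> coeffs_in n (\<lambda>p. const (u p) :: ('x, 'k) mpoly)"
  unfolding coeffs_in_def const_def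
proof (intro conjI exI[of _ "{0}"] allI)
  fix \<alpha> :: "'x \<Rightarrow>\<^sub>0 nat"
  assume "u \<in> T n"
  then show "(\<lambda>p. lookup (single 0 (u p)) \<alpha>) \<in> T n"
    by (cases "\<alpha> = 0") (auto simp: lookup_single_not_eq zero)
qed auto

lemma coeffs_in_fixed: "coeffs_in 0 (\<lambda>_. P)"
  by (auto simp: coeffs_in_def constants intro!: exI[of _ "keys P"])

lemma coeffs_in_power: "coeffs_in n u \<Longrightarrow> coeffs_in (m * n) (\<lambda>p. u p ^ m)"
proof (induction m)
  case 0
  show ?case using coeffs_in_fixed[of 1] by simp
next
  case (Suc m)
  then show ?case using coeffs_in_mult[of n u "m * n" "\<lambda>p. u p ^ m"] by simp
qed

lemma coeffs_in_prod: "finite I \<Longrightarrow> (\<And>i. i \<in> I \<Longrightarrow> coeffs_in (n i) (u i)) \<Longrightarrow> coeffs_in (\<Sum>i\<in>I. n i) (\<lambda>p. \<Prod>i\<in>I. u i p)"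
proof (induction I rule: finite_induct)
  case empty
  show ?case using coeffs_in_fixed[of 1] by simp
qed (auto simp: coeffs_in_mult)

text \<open>Each variable is replaced by a linear form with coefficients of degree 1 in the
  parameter, so a form of degree \<open>d\<close> acquires coefficients of degree
  \<open>d\<close>.\<close>

lemma substitute_coeff:
  assumes "homogeneous d F" "\<And>i j. (\<lambda>p. M p $ i $ j) \<in> T 1"
  shows "(\<lambda>p. lookup (substitute (M p) F) \<beta>) \<in> T d"
proof -
  have lin: "coeffs_in 1 (\<lambda>p. \<Sum>j\<in>UNIV. const (M p $ i $ j) * var j)" for i
    using coeffs_in_mult[OF coeffs_in_const[OF assms(2)] coeffs_in_fixed] by (intro coeffs_in_sum) auto
  have "coeffs_in d (\<lambda>p. substitute (M p) F)"
    unfolding substitute_def eval_poly_def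
  proof (intro coeffs_in_sum)
    fix \<alpha> assume "\<alpha> \<in> keys F"
    then have e: "(\<Sum>i\<in>keys \<alpha>. lookup \<alpha> i * 1) = d" using assms(1) by (simp add: homogeneous_def expdeg_def)
    have "coeffs_in (\<Sum>i\<in>keys \<alpha>. lookup \<alpha> i * 1)
       (\<lambda>p. \<Prod>i\<in>keys \<alpha>. (\<Sum>j\<in>UNIV. const (M p $ i $ j) * var j) ^ lookup \<alpha> i)"
      by (intro coeffs_in_prod coeffs_in_power lin) auto
    from coeffs_in_mult[OF coeffs_in_fixed[of "const (lookup F \<alpha>)"] this, unfolded e]
    show "coeffs_in d (\<lambda>p. const (lookup F \<alpha>) *
          (\<Prod>i\<in>keys \<alpha>. (\<Sum>j\<in>UNIV. const (M p $ i $ j) * var j) ^ lookup \<alpha> i))" by simp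
  qed
  then show ?thesis by (auto simp: coeffs_in_def)
qed

end

lemma homogeneous_substitute:
  assumes "homogeneous d F"
  shows "homogeneous d (substitute h F)"
  unfolding substitute_def eval_poly_def
proof (intro homogeneous_sum)
  fix \<alpha> assume "\<alpha> \<in> keys F"
  then have e: "(\<Sum>i\<in>keys \<alpha>. lookup \<alpha> i) = d" using assms(1) by (simp add: homogeneous_def expdeg_def)
  have l: "homogeneous 1 (\<Sum>j\<in>UNIV. const (h $ i $ j) * var j)" for i
    using homogeneous_mult[OF homogeneous_const homogeneous_var] by (intro homogeneous_sum) auto
  have p: "homogeneous n ((\<Sum>j\<in>UNIV. const (h $ i $ j) * var j) ^ n)" for i n
  proof (induction n)
    case 0
    show ?case by simp
  next
    case (Suc n)
    then show ?case using homogeneous_mult[OF l Suc] by simp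
  qed
  have "homogeneous (\<Sum>i\<in>A. lookup \<alpha> i) (\<Prod>i\<in>A. (\<Sum>j\<in>UNIV. const (h $ i $ j) * var j) ^ lookup \<alpha> i)" if "finite A" for A
    using that
  proof (induction A rule: finite_induct)
    case empty
    show ?case by simp
  next
    case (insert i A)
    then show ?case using homogeneous_mult[OF p insert.IH] by simp
  qed
  from homogeneous_mult[OF homogeneous_const this[OF finite_keys, of \<alpha>]]
  show "homogeneous d (const (lookup F \<alpha>) * (\<Prod>i\<in>keys \<alpha>. (\<Sum>j\<in>UNIV. const (h $ i $ j) * var j) ^ lookup \<alpha> i))"
    unfolding e by simp
qed

section \<open>Polynomial functions on closed free orbits\<close>

interpretation fn: algebra_map "(\<lambda>c _. c) :: 'k::{alg_closed_field, field_char_0} \<Rightarrow> ('k^3^3 \<Rightarrow> 'k)"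
  by standard (auto simp: fun_eq_iff)

definition coord :: "3 \<Rightarrow> 3 \<Rightarrow> 'k^3^3 \<Rightarrow> 'k" where
  "coord i j = (\<lambda>h. h $ i $ j)"

text \<open>In the index type the numeral \<open>3\<close> equals \<open>0\<close>, so all nine
  entries occur.\<close>

definition coords :: "('k^3^3 \<Rightarrow> 'k) list" where
  "coords = [coord i j. i \<leftarrow> [1, 2, 3], j \<leftarrow> [1, 2, 3]]"

definition matrix_polys :: "('k::{alg_closed_field, field_char_0}^3^3 \<Rightarrow> 'k) set" where
  "matrix_polys = fn.adjoin_list (range (\<lambda>c _. c)) coords"

text \<open>Congruence modulo this set is equality on SL3. It contains arbitrary functions, not only
  polynomial ones, as \<open>ideal_of\<close> permits.\<close>

definition SL3_ideal :: "('k::field^3^3 \<Rightarrow> 'k) set" where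
  "SL3_ideal = {u. \<forall>g\<in>SL3. u g = 0}"

lemma set_coords: "set coords = {coord i j |i j. True}"
  unfolding coords_def
proof -
  have "set [coord i j. i \<leftarrow> [1, 2, 3], j \<leftarrow> [1, 2, 3]] = (\<Union>i\<in>{1, 2, 3}. \<Union>j\<in>{1, 2, 3}. {coord i j})" by auto
  then show "set [coord i j. i \<leftarrow> [1, 2, 3], j \<leftarrow> [1, 2, 3]] = {coord i j |i j. True}"
    unfolding UNIV_3[symmetric] by blast
qed

lemma coord_in_coords: "coord i j \<in> set coords"
  unfolding set_coords by blast

lemma subalgebra_matrix_polys: "fn.subalgebra matrix_polys"
  unfolding matrix_polys_def by (intro fn.adjoin_list_subalgebra fn.subalgebra_range)

lemma coord_matrix_polys: "coord i j \<in> matrix_polys"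
  unfolding matrix_polys_def by (intro fn.adjoin_list_mem fn.subalgebra_range) (auto simp: set_coords)

lemma set_coords_subset: "set coords \<subseteq> matrix_polys"
  unfolding set_coords using coord_matrix_polys by blast

lemma matrix_polys_minimal:
  assumes "fn.subalgebra T" "\<And>i j. coord i j \<in> T"
  shows "matrix_polys \<subseteq> T"
  unfolding matrix_polys_def
  by (intro fn.adjoin_list_minimal assms) (use assms in \<open>auto simp: set_coords fn.subalgebra_def\<close>)

lemma matrix_inv_inverse:
  assumes "invertible (h :: 'a::semiring_1^'n^'n)"
  shows "h ** matrix_inv h = mat 1" "matrix_inv h ** h = mat 1"
proof -
  have "h ** matrix_inv h = mat 1 \<and> matrix_inv h ** h = mat 1"
    unfolding matrix_inv_def using assms unfolding invertible_def by (rule someI_ex)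
  then show "h ** matrix_inv h = mat 1" "matrix_inv h ** h = mat 1" by auto
qed

lemma matrix_inv_eqI:
  assumes "h ** k = mat 1" "k ** h = mat 1"
  shows "matrix_inv (h :: 'a::semiring_1^'n^'n) = k"
proof -
  have "invertible h" using assms by (auto simp: invertible_def)
  have "matrix_inv h = matrix_inv h ** (h ** k)" using assms by simp
  also have "\<dots> = (matrix_inv h ** h) ** k" by (rule matrix_mul_assoc)
  finally show ?thesis using matrix_inv_inverse(2)[OF \<open>invertible h\<close>] by simp
qed

lemma matrix_inv_SL3:
  assumes "h \<in> SL3"
  shows "matrix_inv h \<in> SL3" "matrix_inv (matrix_inv h) = h" "h ** matrix_inv h = mat 1" "matrix_inv h ** h = mat 1"
proof -
  have inv: "invertible h" using assms by (simp add: SL3_def invertible_det_nz)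
  then show 1: "h ** matrix_inv h = mat 1" "matrix_inv h ** h = mat 1"
    by (auto simp: matrix_inv_inverse)
  have "det h * det (matrix_inv h) = 1" using arg_cong[OF 1(1), of det] by (simp add: det_mul)
  then show "matrix_inv h \<in> SL3" using assms by (simp add: SL3_def)
  show "matrix_inv (matrix_inv h) = h" using 1 by (intro matrix_inv_eqI)
qed

lemma SL3_mult: "g \<in> SL3 \<Longrightarrow> h \<in> SL3 \<Longrightarrow> g ** h \<in> SL3"
  by (simp add: SL3_def det_mul)

lemma mat_1_SL3: "mat 1 \<in> SL3"
  by (simp add: SL3_def)

text \<open>Two points of \<open>SL3\<close> lie on a rational curve: rescale a row of the line joining them.\<close>

lemma prime_SL3_ideal: "fn.prime_of matrix_polys (SL3_ideal :: ('k::{alg_closed_field, field_char_0}^3^3 \<Rightarrow> 'k) set)"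
  unfolding fn.prime_of_def
proof (intro conjI ballI impI)
  show "fn.ideal_of matrix_polys SL3_ideal" by (auto simp: fn.ideal_of_def SL3_ideal_def)
  show "1 \<notin> (SL3_ideal :: ('k^3^3 \<Rightarrow> 'k) set)" using mat_1_SL3 by (auto simp: SL3_ideal_def)
  fix u v :: "'k^3^3 \<Rightarrow> 'k"
  assume u: "u \<in> matrix_polys" and v: "v \<in> matrix_polys" and uv: "u * v \<in> SL3_ideal"
  show "u \<in> SL3_ideal \<or> v \<in> SL3_ideal"
  proof (rule ccontr)
    assume "\<not> ?thesis"
    then obtain g h where g: "g \<in> SL3" "u g \<noteq> 0" and h: "h \<in> SL3" "v h \<noteq> 0"
      by (auto simp: SL3_ideal_def)
    define line where "line = (\<lambda>t. \<chi> i j. g $ i $ j + t * (h $ i $ j - g $ i $ j))"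
    define L where "L = (\<lambda>i j. [:g $ i $ j, h $ i $ j - g $ i $ j:])"
    define D where "D = L 1 1 * L 2 2 * L 3 3 + L 1 2 * L 2 3 * L 3 1 + L 1 3 * L 2 1 * L 3 2
      - L 1 1 * L 2 3 * L 3 2 - L 1 2 * L 2 1 * L 3 3 - L 1 3 * L 2 2 * L 3 1"
    define curve where "curve = (\<lambda>t. \<chi> i j. (if i = 1 then inverse (poly D t) else 1) * line t $ i $ j)"
    have L: "poly (L i j) t = line t $ i $ j" for i j t
      by (simp add: L_def line_def)
    have D: "poly D t = det (line t)" for t
      by (simp add: D_def det_3 L)
    have line01: "line 0 = g" "line 1 = h" by (auto simp: line_def vec_eq_iff)
    have D01: "poly D 0 = 1" "poly D 1 = 1" using g h by (auto simp: D line01 SL3_def)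
    have curve01: "curve 0 = g" "curve 1 = h" by (auto simp: curve_def D01 line01 vec_eq_iff)
    have curve: "curve t \<in> SL3" if "poly D t \<noteq> 0" for t
    proof -
      have "det (curve t) = inverse (poly D t) * det (line t)"
        unfolding curve_def det_3 by (simp add: algebra_simps)
      then show ?thesis using that D by (simp add: SL3_def)
    qed
    \<comment> \<open>The functions that become rational in \<open>t\<close> along the curve, with a
      power of \<open>D\<close> as denominator.\<close>
    define T where "T = {w. \<exists>k p. \<forall>t. poly D t \<noteq> 0 \<longrightarrow> w (curve t) * poly D t ^ k = poly p t}"
    have "fn.subalgebra T" unfolding fn.subalgebra_def
    proof (intro conjI ballI)
      show "range (\<lambda>c _. c) \<subseteq> T"
      proof clarsimp
        fix c show "(\<lambda>_. c) \<in> T" unfolding T_def by (intro CollectI exI[of _ 0] exI[of _ "[:c:]"]) auto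
      qed
      fix a b assume "a \<in> T" "b \<in> T"
      then obtain k p m q where
        kp: "\<And>t. poly D t \<noteq> 0 \<Longrightarrow> a (curve t) * poly D t ^ k = poly p t" and
        mq: "\<And>t. poly D t \<noteq> 0 \<Longrightarrow> b (curve t) * poly D t ^ m = poly q t" by (auto simp: T_def)
      show "a + b \<in> T" unfolding T_def
      proof (intro CollectI exI[of _ "k + m"] exI[of _ "p * D ^ m + q * D ^ k"] allI impI)
        fix t assume "poly D t \<noteq> 0"
        from kp[OF this] mq[OF this] have "poly (p * D ^ m + q * D ^ k) t =
          (a (curve t) * poly D t ^ k) * poly D t ^ m + (b (curve t) * poly D t ^ m) * poly D t ^ k" by simp
        then show "(a + b) (curve t) * poly D t ^ (k + m) = poly (p * D ^ m + q * D ^ k) t"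
          by (simp add: power_add algebra_simps)
      qed
      show "a * b \<in> T" unfolding T_def
      proof (intro CollectI exI[of _ "k + m"] exI[of _ "p * q"] allI impI)
        fix t assume "poly D t \<noteq> 0"
        from kp[OF this] mq[OF this] have "poly (p * q) t =
          (a (curve t) * poly D t ^ k) * (b (curve t) * poly D t ^ m)" by simp
        then show "(a * b) (curve t) * poly D t ^ (k + m) = poly (p * q) t"
          by (simp add: power_add algebra_simps)
      qed
    qed
    moreover have "coord i j \<in> T" for i j unfolding T_def
    proof (intro CollectI exI[of _ "1::nat"] exI[of _ "(if i = 1 then 1 else D) * L i j"] allI impI)
      fix t assume "poly D t \<noteq> 0"
      then show "coord i j (curve t) * poly D t ^ 1 = poly ((if i = 1 then 1 else D) * L i j) t"
        by (simp add: coord_def curve_def L)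
    qed
    ultimately have "matrix_polys \<subseteq> T" by (rule matrix_polys_minimal)
    then obtain k p m q where
        kp: "\<And>t. poly D t \<noteq> 0 \<Longrightarrow> u (curve t) * poly D t ^ k = poly p t" and
        mq: "\<And>t. poly D t \<noteq> 0 \<Longrightarrow> v (curve t) * poly D t ^ m = poly q t"
      using subsetD[OF _ u, of T] subsetD[OF _ v, of T] unfolding T_def mem_Collect_eq by metis
    have "p \<noteq> 0" using kp[of 0] g D01 curve01 by auto
    moreover have "q \<noteq> 0" using mq[of 1] h D01 curve01 by auto
    moreover have "D \<noteq> 0" using D01 by auto
    ultimately have "p * q * D \<noteq> 0" by simp
    \<comment> \<open>The field is infinite, so a nonzero polynomial has a point where it does not
      vanish.\<close>
    then obtain t where t: "poly (p * q * D) t \<noteq> 0" by (metis poly_all_0_iff_0)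
    then have "u (curve t) * v (curve t) \<noteq> 0" using kp[of t] mq[of t] by auto
    then show False using uv curve[of t] t by (auto simp: SL3_ideal_def)
  qed
qed

text \<open>A list, so that the coefficients can be adjoined one after another.\<close>

definition exps4 :: "(3 \<Rightarrow>\<^sub>0 nat) list" where
  "exps4 = (SOME xs. set xs = {\<alpha>. expdeg \<alpha> = 4})"

lemma set_exps4: "set exps4 = {\<alpha>. expdeg \<alpha> = 4}"
  unfolding exps4_def by (rule someI_ex) (use finite_list[OF finite_expdeg] in blast)

lemma Sym_pow_keys: "F \<in> Sym_pow 4 \<Longrightarrow> keys F \<subseteq> set exps4"
  by (auto simp: Sym_pow_def homogeneous_def set_exps4)

text \<open>Serves twice: it keeps translates of coefficient functions in \<open>orbit_ring\<close>,
  and it shows that \<open>reynolds\<close> depends polynomially on the coefficients of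
  \<open>F\<close>.\<close>

lemma substitute_linear:
  assumes "F \<in> Sym_pow 4"
  shows "lookup (substitute h F) \<beta> = (\<Sum>\<alpha>\<in>set exps4. lookup (substitute h (single \<alpha> 1)) \<beta> * lookup F \<alpha>)"
proof -
  have single: "single \<alpha> c = const c * single \<alpha> 1" for \<alpha> :: "3 \<Rightarrow>\<^sub>0 nat" and c :: 'a
    by (simp add: const_def mult_single)
  have cm: "lookup (const c * P) \<beta> = c * lookup P \<beta>" for c :: 'a and P :: "(3, 'a) mpoly"
  proof -
    have "const c * P = (\<Sum>\<alpha>\<in>keys P. const c * single \<alpha> (lookup P \<alpha>))"
      by (simp only: sum_distrib_left[symmetric] poly_mapping_sum_single[symmetric])
    also have "\<dots> = (\<Sum>\<alpha>\<in>keys P. single \<alpha> (c * lookup P \<alpha>))" by (simp add: const_def mult_single)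
    finally show ?thesis
      by (simp add: lookup_sum lookup_single when_def in_keys_iff)
  qed
  have "substitute h F = (\<Sum>\<alpha>\<in>set exps4. const (lookup F \<alpha>) * substitute h (single \<alpha> 1))"
    by (subst sum_single_superset[OF _ Sym_pow_keys[OF assms]], simp, subst single)
       (simp add: semiring_homD[OF semiring_hom_substitute])
  then show ?thesis by (simp add: lookup_sum cm mult.commute)
qed

lemma graded_constant: "fn.subalgebra A \<Longrightarrow> graded_functions (\<lambda>_. A)"
  using fn.subalgebraD[of A] by (intro graded_functions.intro) (simp_all add: plus_fun_def times_fun_def)

lemma matrix_polys_det: "(\<lambda>h. det h) \<in> matrix_polys"
proof -
  have "(\<lambda>h. det h) = coord 1 1 * coord 2 2 * coord 3 3 + coord 1 2 * coord 2 3 * coord 3 1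
     + coord 1 3 * coord 2 1 * coord 3 2 - coord 1 1 * coord 2 3 * coord 3 2
     - coord 1 2 * coord 2 1 * coord 3 3 - coord 1 3 * coord 2 2 * (coord 3 1 :: 'a^3^3 \<Rightarrow> 'a)"
    by (rule ext) (simp add: det_3 coord_def)
  also have "\<dots> \<in> matrix_polys"
    by (intro fn.subalgebraD[OF subalgebra_matrix_polys] coord_matrix_polys)
  finally show ?thesis .
qed

text \<open>The images of the coordinates form a matrix \<open>g\<close>, evaluation at
  \<open>g\<close> agrees with \<open>\<psi>\<close> on the generators, and \<open>det h - 1\<close>
  being killed forces \<open>g\<close> into SL3.\<close>

lemma character_point:
  assumes \<psi>: "fn.character_mod matrix_polys SL3_ideal \<psi>"
  obtains g where "g \<in> SL3" "\<And>u. u \<in> matrix_polys \<Longrightarrow> \<psi> u = u g"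
proof -
  note SP = subalgebra_matrix_polys
  have ch: "fn.character matrix_polys \<psi>" using \<psi> by (simp add: fn.character_mod_def)
  define g where "g = (\<chi> i j. \<psi> (coord i j))"
  let ?T = "{u \<in> matrix_polys. \<psi> u = u g}"
  have "matrix_polys \<subseteq> ?T"
  proof (rule matrix_polys_minimal)
    show "fn.subalgebra ?T"
      using fn.subalgebraD[OF SP] fn.characterD[OF ch SP] by (auto simp: fn.subalgebra_def)
    show "coord i j \<in> ?T" for i j using coord_matrix_polys by (auto simp: g_def) (simp add: coord_def)
  qed
  then have eq: "\<psi> u = u g" if "u \<in> matrix_polys" for u using that by blast
  have d: "(\<lambda>h. det h) - 1 \<in> SL3_ideal \<inter> matrix_polys"
    using fn.subalgebraD(7)[OF SP matrix_polys_det fn.subalgebraD(3)[OF SP]] by (auto simp: SL3_ideal_def SL3_def)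
  then have "\<psi> ((\<lambda>h. det h) - 1) = 0" using \<psi> unfolding fn.character_mod_def by blast
  then have "det g - 1 = 0" using eq[OF IntD2[OF d]] by simp
  then show ?thesis using that[of g] eq by (simp add: SL3_def)
qed

section \<open>The ring of functions on the orbit\<close>

locale closed_free_orbit =
  fixes f :: "(3, 'k::{alg_closed_field, field_char_0}) mpoly"
  assumes f4: "f \<in> Sym_pow 4"
    and closed_orbit: "Zariski_closed_quartics (SL3_orbit f)"
    and free: "g \<in> SL3 \<Longrightarrow> h \<in> SL3 \<Longrightarrow> substitute g f = substitute h f \<Longrightarrow> g = h"
begin

definition orbit_coeff :: "(3 \<Rightarrow>\<^sub>0 nat) \<Rightarrow> 'k^3^3 \<Rightarrow> 'k" where
  "orbit_coeff \<alpha> = (\<lambda>h. lookup (substitute h f) \<alpha>)"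

text \<open>The ring \<open>A\<close> of the overview, presented with finitely many generators as
  \<open>weak_Nullstellensatz\<close> requires.\<close>

definition orbit_ring :: "('k^3^3 \<Rightarrow> 'k) set" where
  "orbit_ring = fn.adjoin_list (range (\<lambda>c _. c)) (map orbit_coeff exps4)"

lemma substitute_Sym: "substitute h f \<in> Sym_pow 4"
  using f4 homogeneous_substitute by (auto simp: Sym_pow_def)

lemma orbit_coeff_0: "\<alpha> \<notin> set exps4 \<Longrightarrow> orbit_coeff \<alpha> = (\<lambda>_. 0)"
proof
  fix h assume "\<alpha> \<notin> set exps4"
  then have "\<alpha> \<notin> keys (substitute h f)" using Sym_pow_keys[OF substitute_Sym] by blast
  then show "orbit_coeff \<alpha> h = 0" by (simp add: orbit_coeff_def in_keys_iff)
qed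

lemma subalgebra_orbit_ring: "fn.subalgebra orbit_ring"
  unfolding orbit_ring_def by (intro fn.adjoin_list_subalgebra fn.subalgebra_range)

lemma orbit_coeff_mem: "orbit_coeff \<alpha> \<in> orbit_ring"
proof (cases "\<alpha> \<in> set exps4")
  case True
  then show ?thesis unfolding orbit_ring_def
    by (intro fn.adjoin_list_mem fn.subalgebra_range) auto
qed (use orbit_coeff_0 fn.subalgebraD(1)[OF subalgebra_orbit_ring, of 0] in simp)

lemma orbit_ring_minimal:
  assumes "fn.subalgebra T" "\<And>\<alpha>. orbit_coeff \<alpha> \<in> T"
  shows "orbit_ring \<subseteq> T"
  unfolding orbit_ring_def
  by (intro fn.adjoin_list_minimal assms) (use assms in \<open>auto simp: fn.subalgebra_def\<close>)

lemma orbit_ring_subset: "orbit_ring \<subseteq> matrix_polys"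
proof (rule orbit_ring_minimal[OF subalgebra_matrix_polys])
  interpret graded_functions "\<lambda>_. matrix_polys :: ('k^3^3 \<Rightarrow> 'k) set"
    by (rule graded_constant[OF subalgebra_matrix_polys])
  show "orbit_coeff \<alpha> \<in> matrix_polys" for \<alpha>
    unfolding orbit_coeff_def
    by (rule substitute_coeff[of 4]) (use f4 coord_matrix_polys in \<open>auto simp: Sym_pow_def coord_def\<close>)
qed

lemma eval_mem: "(\<lambda>h. eval_at P (substitute h f)) \<in> orbit_ring"
proof -
  interpret graded_functions "\<lambda>_. orbit_ring" by (rule graded_constant[OF subalgebra_orbit_ring])
  have "(\<lambda>h. lookup P \<alpha> * (\<Prod>i\<in>keys \<alpha>. orbit_coeff i h ^ lookup \<alpha> i)) \<in> orbit_ring" for \<alpha>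
    by (intro scale prod power orbit_coeff_mem) auto
  from sum[OF this] show ?thesis unfolding eval_at_def eval_poly_def orbit_coeff_def .
qed

text \<open>The images of the generators are the coefficients of a form \<open>F\<close>, and a
  character is determined by its values on generators: it is evaluation at \<open>F\<close>.\<close>

lemma eval_character:
  assumes ch: "fn.character orbit_ring \<psi>" and F: "\<And>\<alpha>. \<psi> (orbit_coeff \<alpha>) = lookup F \<alpha>"
  shows "\<psi> (\<lambda>h. eval_at P (substitute h f)) = eval_at P F"
proof -
  note S = subalgebra_orbit_ring
  have pw: "(\<lambda>h. u h ^ n) = u ^ n" for u :: "'k^3^3 \<Rightarrow> 'k" and n by (induction n) (auto simp: fun_eq_iff)
  have "(\<lambda>h. eval_at P (substitute h f)) = (\<Sum>\<alpha>\<in>keys P. (\<lambda>_. lookup P \<alpha>) * (\<Prod>i\<in>keys \<alpha>. orbit_coeff i ^ lookup \<alpha> i))"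
  proof
    have s: "(\<Sum>i\<in>I. u i) h = (\<Sum>i\<in>I. u i h)" for I :: "'i set" and u :: "'i \<Rightarrow> 'k^3^3 \<Rightarrow> 'k" and h
      by (induction I rule: infinite_finite_induct) auto
    have p: "(\<Prod>i\<in>I. u i) h = (\<Prod>i\<in>I. u i h)" for I :: "'i set" and u :: "'i \<Rightarrow> 'k^3^3 \<Rightarrow> 'k" and h
      by (induction I rule: infinite_finite_induct) auto
    fix h show "eval_at P (substitute h f) = (\<Sum>\<alpha>\<in>keys P. (\<lambda>_. lookup P \<alpha>) * (\<Prod>i\<in>keys \<alpha>. orbit_coeff i ^ lookup \<alpha> i)) h"
      by (simp add: s p eval_at_def eval_poly_def pw[symmetric]) (simp add: orbit_coeff_def)
  qed
  moreover have "(\<Prod>i\<in>keys \<alpha>. orbit_coeff i ^ lookup \<alpha> i) \<in> orbit_ring" for \<alpha>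
    by (intro fn.subalgebra_prod[OF S] fn.subalgebraD(8)[OF S] orbit_coeff_mem)
  ultimately show ?thesis
    using fn.subalgebraD(1,5,8)[OF S] orbit_coeff_mem
    by (simp add: fn.character_sum[OF ch S] fn.character_prod[OF ch S] fn.characterD[OF ch S] F eval_at_def eval_poly_def)
qed

lemma orbit_iff: "F \<in> SL3_orbit f \<longleftrightarrow> (\<exists>h\<in>SL3. F = substitute h f)"
proof
  assume "F \<in> SL3_orbit f"
  then obtain g where "g \<in> SL3" "F = substitute (matrix_inv g) f" by (auto simp: SL3_orbit_def act_eq_substitute)
  then show "\<exists>h\<in>SL3. F = substitute h f" using matrix_inv_SL3(1) by blast
next
  assume "\<exists>h\<in>SL3. F = substitute h f"
  then obtain h where h: "h \<in> SL3" "F = substitute h f" by blast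
  then have "F = act (matrix_inv h) f" by (simp add: act_eq_substitute matrix_inv_SL3(2))
  then show "F \<in> SL3_orbit f" using matrix_inv_SL3(1)[OF h(1)] by (auto simp: SL3_orbit_def)
qed

lemma coord_fractional: "fn.fractional orbit_ring SL3_ideal (coord i j)"
proof (rule ccontr)
  assume nf: "\<not> ?thesis"
  let ?A1 = "fn.adjoin orbit_ring (coord i j)"
  \<comment> \<open>This is \<open>matrix_polys\<close>, presented as generated over
    \<open>orbit_ring\<close> with the entry in question adjoined first.\<close>
  let ?B = "fn.adjoin_list ?A1 coords"
  note S = subalgebra_orbit_ring
  note S1 = fn.subalgebra_adjoin[OF S, of "coord i j"]
  have "matrix_polys \<subseteq> ?B"
    by (intro matrix_polys_minimal fn.adjoin_list_subalgebra[OF S1] fn.adjoin_list_mem[OF S1] coord_in_coords)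
  moreover have A1: "?A1 \<subseteq> matrix_polys"
    by (intro fn.adjoin_minimal orbit_ring_subset subalgebra_matrix_polys coord_matrix_polys)
  then have "?B \<subseteq> matrix_polys"
    by (intro fn.adjoin_list_minimal subalgebra_matrix_polys set_coords_subset)
  ultimately have B: "?B = matrix_polys" by blast
  have prB: "fn.prime_of ?B SL3_ideal" unfolding B by (rule prime_SL3_ideal)
  have one: "1 \<in> ?B" "1 \<notin> SL3_ideal"
    using fn.subalgebraD(3)[OF subalgebra_matrix_polys] mat_1_SL3 unfolding B by (auto simp: SL3_ideal_def)
  \<comment> \<open>The conditions are chosen from the top down: \<open>c\<close> guarantees an
    extension to all matrix polynomials, and \<open>a\<close> below guarantees two extensions on
    which \<open>c\<close> stays nonzero.\<close>
  obtain c where c: "c \<in> ?A1" "c \<notin> SL3_ideal"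
    "\<And>\<psi>. fn.character_mod ?A1 SL3_ideal \<psi> \<Longrightarrow> \<psi> c \<noteq> 0 \<Longrightarrow> \<exists>\<psi>'. fn.extends ?A1 ?B SL3_ideal 1 \<psi> \<psi>'"
    by (rule fn.extension_list[OF S1 prB one]) (rule that; blast)
  have pr1: "fn.prime_of ?A1 SL3_ideal" using fn.prime_of_subset[OF prime_SL3_ideal A1] .
  obtain a where a: "a \<in> orbit_ring" "a \<notin> SL3_ideal"
    "\<And>\<psi>. fn.character_mod orbit_ring SL3_ideal \<psi> \<Longrightarrow> \<psi> a \<noteq> 0 \<Longrightarrow>
      \<exists>\<psi>1 \<psi>2. fn.extends orbit_ring ?A1 SL3_ideal c \<psi> \<psi>1 \<and> fn.extends orbit_ring ?A1 SL3_ideal c \<psi> \<psi>2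
        \<and> \<psi>1 (coord i j) \<noteq> \<psi>2 (coord i j)"
    by (rule fn.extension_step[OF S pr1 c(1,2)]) (use nf in blast)
  obtain g0 where g0: "g0 \<in> SL3" "a g0 \<noteq> 0" using a(2) by (auto simp: SL3_ideal_def)
  have "fn.character_mod orbit_ring SL3_ideal (\<lambda>u. u g0)"
    using g0 by (auto simp: fn.character_mod_def fn.character_def SL3_ideal_def)
  from a(3)[OF this g0(2)] obtain \<psi>1 \<psi>2 where
    \<psi>: "fn.extends orbit_ring ?A1 SL3_ideal c (\<lambda>u. u g0) \<psi>1"
       "fn.extends orbit_ring ?A1 SL3_ideal c (\<lambda>u. u g0) \<psi>2"
    "\<psi>1 (coord i j) \<noteq> \<psi>2 (coord i j)" by blast
  have point: "\<exists>g\<in>SL3. substitute g f = substitute g0 f \<and> \<psi>' (coord i j) = g $ i $ j"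
    if \<psi>': "fn.extends orbit_ring ?A1 SL3_ideal c (\<lambda>u. u g0) \<psi>'" for \<psi>'
  proof -
    obtain \<phi> where \<phi>: "fn.extends ?A1 ?B SL3_ideal 1 \<psi>' \<phi>"
      using c(3)[of \<psi>'] \<psi>' by (auto simp: fn.extends_def)
    then obtain g where g: "g \<in> SL3" "\<And>u. u \<in> matrix_polys \<Longrightarrow> \<phi> u = u g"
      using character_point[of \<phi>] by (auto simp: fn.extends_def B)
    have "lookup (substitute g f) \<alpha> = lookup (substitute g0 f) \<alpha>" for \<alpha>
    proof -
      have m: "orbit_coeff \<alpha> \<in> orbit_ring" by (rule orbit_coeff_mem)
      then have "orbit_coeff \<alpha> \<in> ?A1" using fn.adjoin_subset[OF S] by blast
      then have "orbit_coeff \<alpha> g = \<psi>' (orbit_coeff \<alpha>)"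
        using g(2)[of "orbit_coeff \<alpha>"] orbit_ring_subset m \<phi> by (auto simp: fn.extends_def)
      also have "\<dots> = orbit_coeff \<alpha> g0" using \<psi>' m by (auto simp: fn.extends_def)
      finally show ?thesis by (simp add: orbit_coeff_def)
    qed
    then have "substitute g f = substitute g0 f" by (rule poly_mapping_eqI)
    moreover have "coord i j \<in> ?A1" using fn.adjoin_self[OF S] .
    then have "\<psi>' (coord i j) = coord i j g"
      using g(2)[OF coord_matrix_polys] \<phi> by (auto simp: fn.extends_def)
    ultimately show ?thesis using g(1) by (auto simp: coord_def)
  qed
  from point[OF \<psi>(1)] point[OF \<psi>(2)] \<psi>(3) free show False by metis
qed

section \<open>Translation and common denominators of the matrix entries\<close>

definition translate :: "'k^3^3 \<Rightarrow> ('k^3^3 \<Rightarrow> 'k) \<Rightarrow> 'k^3^3 \<Rightarrow> 'k" where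
  "translate k u = (\<lambda>h. u (h ** k))"

text \<open>\<open>f \<circ> (h ** k)\<close> is \<open>(f \<circ> h) \<circ> k\<close>, whose
  coefficients are linear in those of \<open>f \<circ> h\<close>.\<close>

lemma translate_orbit_ring: "u \<in> orbit_ring \<Longrightarrow> translate k u \<in> orbit_ring"
proof -
  note S = subalgebra_orbit_ring
  have "orbit_ring \<subseteq> {u. translate k u \<in> orbit_ring}"
  proof (rule orbit_ring_minimal)
    have "translate k (u + v) = translate k u + translate k v" "translate k (u * v) = translate k u * translate k v"
      "translate k (\<lambda>_. c) = (\<lambda>_. c)" for u v c by (auto simp: translate_def fun_eq_iff)
    then show "fn.subalgebra {u. translate k u \<in> orbit_ring}"
      using fn.subalgebraD[OF S] by (auto simp: fn.subalgebra_def)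
    fix \<alpha>
    have "translate k (orbit_coeff \<alpha>) = (\<lambda>h. \<Sum>\<beta>\<in>set exps4. lookup (substitute k (single \<beta> 1)) \<alpha> * orbit_coeff \<beta> h)"
      unfolding translate_def orbit_coeff_def substitute_substitute[symmetric]
      using substitute_linear[OF substitute_Sym] by blast
    also have "\<dots> \<in> orbit_ring"
    proof -
      interpret graded_functions "\<lambda>_. orbit_ring" by (rule graded_constant[OF subalgebra_orbit_ring])
      show ?thesis by (intro sum scale orbit_coeff_mem)
    qed
    finally show "orbit_coeff \<alpha> \<in> {u. translate k u \<in> orbit_ring}" by simp
  qed
  then show "u \<in> orbit_ring \<Longrightarrow> translate k u \<in> orbit_ring" by blast
qed

text \<open>
  A nonzero ideal of functions on a closed orbit which is stable under translation has no zero on the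
  orbit, hence contains \<open>1\<close> by the Nullstellensatz.
\<close>

definition denominators :: "('k^3^3 \<Rightarrow> 'k) set" where
  "denominators = {b \<in> orbit_ring. \<forall>i j. \<exists>m\<in>orbit_ring. b * coord i j - m \<in> SL3_ideal}"

lemma ideal_denominators: "fn.ideal_of orbit_ring denominators"
  unfolding fn.ideal_of_def
proof (intro conjI ballI)
  note SD = fn.subalgebraD[OF subalgebra_orbit_ring]
  have "(0 :: 'k^3^3 \<Rightarrow> 'k) * coord i j - 0 \<in> SL3_ideal" for i j by (auto simp: SL3_ideal_def)
  then show "0 \<in> denominators" using SD(2) unfolding denominators_def by blast
  fix a b assume b: "b \<in> denominators"
  show "a + b \<in> denominators" if a: "a \<in> denominators"
  proof -
    have "\<exists>m\<in>orbit_ring. (a + b) * coord i j - m \<in> SL3_ideal" for i j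
    proof -
      obtain m n where "m \<in> orbit_ring" "a * coord i j - m \<in> SL3_ideal" "n \<in> orbit_ring" "b * coord i j - n \<in> SL3_ideal"
        using a b by (fastforce simp: denominators_def)
      then show ?thesis using SD(4) by (intro bexI[of _ "m + n"]) (auto simp: SL3_ideal_def distrib_right)
    qed
    then show ?thesis using a b SD(4) by (auto simp: denominators_def)
  qed
  show "a * b \<in> denominators" if a: "a \<in> orbit_ring"
  proof -
    have "\<exists>m\<in>orbit_ring. (a * b) * coord i j - m \<in> SL3_ideal" for i j
    proof -
      obtain n where "n \<in> orbit_ring" "b * coord i j - n \<in> SL3_ideal"
        using b by (fastforce simp: denominators_def)
      then show ?thesis using SD(5) a by (intro bexI[of _ "a * n"]) (auto simp: SL3_ideal_def mult.assoc)
    qed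
    then show ?thesis using a b SD(5) by (auto simp: denominators_def)
  qed
qed

text \<open>Row \<open>i\<close> of \<open>h\<close> is row \<open>i\<close> of
  \<open>h ** k\<close> times the constant matrix \<open>matrix_inv k\<close>, so the numerators for
  \<open>translate k b\<close> are linear combinations of the translated numerators for
  \<open>b\<close>.\<close>

lemma translate_denominators:
  assumes k: "k \<in> SL3" and b: "b \<in> denominators"
  shows "translate k b \<in> denominators"
proof -
  let ?k' = "matrix_inv k"
  interpret graded_functions "\<lambda>_. orbit_ring" by (rule graded_constant[OF subalgebra_orbit_ring])
  have "\<exists>m\<in>orbit_ring. translate k b * coord i j - m \<in> SL3_ideal" for i j
  proof -
    have "\<forall>l. \<exists>m. m \<in> orbit_ring \<and> b * coord i l - m \<in> SL3_ideal" using b by (auto simp: denominators_def)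
    then obtain m where m: "\<And>l. m l \<in> orbit_ring" "\<And>l. b * coord i l - m l \<in> SL3_ideal" by metis
    define n where "n = (\<lambda>h. \<Sum>l\<in>UNIV. ?k' $ l $ j * translate k (m l) h)"
    have "n \<in> orbit_ring" unfolding n_def using m translate_orbit_ring by (intro sum scale) auto
    moreover have "translate k b * coord i j - n \<in> SL3_ideal"
    proof -
      have "b (h ** k) * h $ i $ j = n h" if h: "h \<in> SL3" for h
      proof -
        have "h $ i $ j = ((h ** k) ** ?k') $ i $ j"
          using matrix_inv_SL3(3)[OF k] by (simp add: matrix_mul_assoc[symmetric])
        also have "\<dots> = (\<Sum>l\<in>UNIV. (h ** k) $ i $ l * ?k' $ l $ j)"
          by (simp only: matrix_matrix_mult_def[of "h ** k" ?k'] vec_lambda_beta)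
        finally have "b (h ** k) * h $ i $ j = (\<Sum>l\<in>UNIV. ?k' $ l $ j * (b (h ** k) * coord i l (h ** k)))"
          by (simp add: sum_distrib_left coord_def mult_ac)
        also have "\<dots> = n h"
          using m(2) SL3_mult[OF h k] by (simp add: n_def translate_def SL3_ideal_def)
        finally show ?thesis .
      qed
      then show ?thesis by (auto simp: SL3_ideal_def translate_def coord_def)
    qed
    ultimately show ?thesis by blast
  qed
  then show ?thesis using b translate_orbit_ring by (auto simp: denominators_def)
qed

text \<open>The product of one denominator for each of the nine entries serves them all, and it does
  not vanish identically on SL3 because \<open>SL3_ideal\<close> is prime.\<close>

lemma nonzero_denominator: "\<exists>b\<in>denominators. b \<notin> SL3_ideal"
proof -
  note S = subalgebra_orbit_ring
  have pr: "fn.prime_of orbit_ring SL3_ideal"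
    using fn.prime_of_subset[OF prime_SL3_ideal orbit_ring_subset] .
  have "\<forall>p. \<exists>l m. l \<in> orbit_ring \<and> m \<in> orbit_ring \<and> l \<notin> SL3_ideal \<and> l * coord (fst p) (snd p) - m \<in> SL3_ideal"
    using coord_fractional unfolding fn.fractional_def by blast
  then obtain l m where lm: "\<And>p. l p \<in> orbit_ring" "\<And>p. m p \<in> orbit_ring" "\<And>p. l p \<notin> SL3_ideal"
    "\<And>p. l p * coord (fst p) (snd p) - m p \<in> SL3_ideal" by metis
  define b where "b = (\<Prod>p\<in>UNIV. l p)"
  have nz: "(\<Prod>p\<in>I. l p) \<notin> SL3_ideal" if "finite I" for I
    using that
  proof (induction I rule: finite_induct)
    case empty
    then show ?case using pr by (auto simp: fn.prime_of_def)
  next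
    case (insert p I)
    have "l p * prod l I \<notin> SL3_ideal"
      using fn.primeD[OF pr lm(1)[of p] fn.subalgebra_prod[OF S, of I l, OF lm(1)]] lm(3) insert.IH by blast
    then show ?case using insert.hyps by (simp only: prod.insert not_False_eq_True)
  qed
  have "\<exists>n\<in>orbit_ring. b * coord i j - n \<in> SL3_ideal" for i j
  proof -
    define r where "r = (\<Prod>p\<in>UNIV - {(i, j)}. l p)"
    have "b = l (i, j) * r" unfolding b_def r_def by (rule prod.remove) auto
    then have "b * coord i j - r * m (i, j) = r * (l (i, j) * coord i j - m (i, j))" by (simp add: algebra_simps)
    also have "\<dots> \<in> SL3_ideal" using lm(4)[of "(i, j)"] by (auto simp: SL3_ideal_def)
    finally have "b * coord i j - r * m (i, j) \<in> SL3_ideal" .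
    moreover have "r * m (i, j) \<in> orbit_ring"
      unfolding r_def by (intro fn.subalgebraD(5)[OF S] fn.subalgebra_prod[OF S] lm)
    ultimately show ?thesis by blast
  qed
  moreover have "b \<in> orbit_ring" unfolding b_def by (intro fn.subalgebra_prod[OF S] lm)
  ultimately show ?thesis using nz[of UNIV] by (auto simp: denominators_def b_def)
qed

lemma one_denominator: "1 \<in> denominators"
proof (rule ccontr)
  assume "1 \<notin> denominators"
  note S = subalgebra_orbit_ring
  obtain \<psi> where ch: "fn.character orbit_ring \<psi>" and kill: "\<And>a. a \<in> denominators \<Longrightarrow> \<psi> a = 0"
  proof (rule fn.weak_Nullstellensatz[of "map orbit_coeff exps4" denominators, folded orbit_ring_def])
    show "fn.ideal_of orbit_ring denominators" by (rule ideal_denominators)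
    show "denominators \<subseteq> orbit_ring" by (auto simp: denominators_def)
    show "1 \<notin> denominators" by fact
    fix \<psi> assume "fn.character orbit_ring \<psi>" "\<And>a. a \<in> denominators \<Longrightarrow> \<psi> a = 0"
    then show thesis by (rule that)
  qed
  \<comment> \<open>The quartic at which \<open>\<psi>\<close> evaluates; it is not yet known to lie
    on the orbit.\<close>
  define F where "F = (\<Sum>\<alpha>\<in>set exps4. single \<alpha> (\<psi> (orbit_coeff \<alpha>)))"
  have F: "\<psi> (orbit_coeff \<alpha>) = lookup F \<alpha>" for \<alpha>
    using orbit_coeff_0[of \<alpha>] fn.characterD(1)[OF ch S, of 0]
    by (cases "\<alpha> \<in> set exps4") (auto simp: F_def lookup_sum lookup_single when_def)
  have F4: "F \<in> Sym_pow 4"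
    unfolding F_def Sym_pow_def by (intro CollectI homogeneous_sum) (auto simp: set_exps4 homogeneous_def)
  obtain T where T: "SL3_orbit f = {F \<in> Sym_pow 4. \<forall>P\<in>T. eval_at P F = 0}"
    using closed_orbit by (auto simp: Zariski_closed_quartics_def)
  have "eval_at P F = 0" if P: "P \<in> T" for P
  proof -
    let ?u = "\<lambda>h. eval_at P (substitute h f)"
    have "?u h = 0" if "h \<in> SL3" for h
    proof -
      have "substitute h f \<in> SL3_orbit f" using that by (auto simp: orbit_iff)
      then show ?thesis using T P by auto
    qed
    \<comment> \<open>A function that vanishes on SL3 is a denominator, with numerators 0. So
      \<open>\<psi>\<close> kills the equations of the orbit, and \<open>F\<close> satisfies
      them.\<close>
    then have "?u * coord i j - 0 \<in> SL3_ideal" for i j by (simp add: SL3_ideal_def)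
    then have "?u \<in> denominators" using eval_mem fn.subalgebraD(2)[OF S] unfolding denominators_def by blast
    from kill[OF this] eval_character[OF ch F, of P] show ?thesis by (simp only:)
  qed
  then have "F \<in> SL3_orbit f" using F4 T by auto
  then obtain h0 where h0: "h0 \<in> SL3" "F = substitute h0 f" by (auto simp: orbit_iff)
  let ?T = "{u \<in> orbit_ring. \<psi> u = u h0}"
  have "orbit_ring \<subseteq> ?T"
  proof (rule orbit_ring_minimal)
    show "fn.subalgebra ?T"
      using fn.subalgebraD[OF S] fn.characterD[OF ch S] by (auto simp: fn.subalgebra_def)
    show "orbit_coeff \<alpha> \<in> ?T" for \<alpha> using orbit_coeff_mem F[of \<alpha>] h0 by (simp add: orbit_coeff_def)
  qed
  then have eq: "\<psi> u = u h0" if "u \<in> orbit_ring" for u using that by blast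
  obtain b h1 where b: "b \<in> denominators" "h1 \<in> SL3" "b h1 \<noteq> 0"
    using nonzero_denominator by (auto simp: SL3_ideal_def)
  \<comment> \<open>Translation by \<open>?k\<close> moves \<open>h0\<close> to \<open>h1\<close>,
    where \<open>b\<close> does not vanish.\<close>
  let ?k = "matrix_inv h0 ** h1"
  have "translate ?k b \<in> denominators"
    using translate_denominators[OF SL3_mult[OF matrix_inv_SL3(1)[OF h0(1)] b(2)] b(1)] .
  moreover from this have "translate ?k b \<in> orbit_ring" by (simp add: denominators_def)
  ultimately have "translate ?k b h0 = 0" using kill eq by metis
  moreover have "translate ?k b h0 = b h1"
    using matrix_inv_SL3(3)[OF h0(1)] by (simp add: translate_def matrix_mul_assoc)
  ultimately show False using b by simp
qed

text \<open>With \<open>1\<close> as a common denominator, each entry agrees on SL3 with an element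
  of \<open>orbit_ring\<close>, and the elements of that ring are polynomials in the coefficients of
  \<open>f \<circ> h\<close>.\<close>

lemma matrix_poly_on_orbit:
  assumes "u \<in> matrix_polys"
  obtains P where "\<And>h. h \<in> SL3 \<Longrightarrow> u h = eval_at P (substitute h f)"
proof -
  note SD = fn.subalgebraD[OF subalgebra_orbit_ring]
  let ?T = "{u. \<exists>m\<in>orbit_ring. u - m \<in> SL3_ideal}"
  have "matrix_polys \<subseteq> ?T"
  proof (rule matrix_polys_minimal)
    show "fn.subalgebra ?T" unfolding fn.subalgebra_def
    proof (intro conjI ballI)
      have "(\<lambda>_. c) \<in> ?T" for c
        using SD(1)[of c] by (intro CollectI bexI[of _ "\<lambda>_. c"]) (auto simp: SL3_ideal_def)
      then show "range (\<lambda>c _. c) \<subseteq> ?T" by blast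
      fix a b assume "a \<in> ?T" "b \<in> ?T"
      then obtain m n where mn: "m \<in> orbit_ring" "n \<in> orbit_ring" "a - m \<in> SL3_ideal" "b - n \<in> SL3_ideal"
        by blast
      show "a + b \<in> ?T" using mn SD(4) by (intro CollectI bexI[of _ "m + n"]) (auto simp: SL3_ideal_def)
      show "a * b \<in> ?T" using mn SD(5) by (intro CollectI bexI[of _ "m * n"]) (auto simp: SL3_ideal_def)
    qed
    show "coord i j \<in> ?T" for i j
      using one_denominator unfolding denominators_def mem_Collect_eq mult_1 by blast
  qed
  then obtain m where m: "m \<in> orbit_ring" "u - m \<in> SL3_ideal" using assms by blast
  have h: "semiring_hom (\<lambda>c :: 'k. c)" by (rule semiring_hom_id)
  let ?U = "{u. \<exists>P. \<forall>h. u h = eval_at P (substitute h f)}"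
  have "orbit_ring \<subseteq> ?U"
  proof (rule orbit_ring_minimal)
    show "fn.subalgebra ?U" unfolding fn.subalgebra_def
    proof (intro conjI ballI)
      have "(\<lambda>_. c) \<in> ?U" for c by (intro CollectI exI[of _ "const c"]) (auto simp: eval_at_def eval_poly_const[OF h])
      then show "range (\<lambda>c _. c) \<subseteq> ?U" by blast
      fix a b assume "a \<in> ?U" "b \<in> ?U"
      then obtain P R where PR: "\<And>h. a h = eval_at P (substitute h f)" "\<And>h. b h = eval_at R (substitute h f)" by blast
      show "a + b \<in> ?U" by (intro CollectI exI[of _ "P + R"]) (auto simp: PR eval_at_def eval_poly_add[OF h])
      show "a * b \<in> ?U" by (intro CollectI exI[of _ "P * R"]) (auto simp: PR eval_at_def eval_poly_mult[OF h])
    qed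
    show "orbit_coeff \<alpha> \<in> ?U" for \<alpha>
      by (intro CollectI exI[of _ "var \<alpha>"]) (auto simp: eval_at_def eval_poly_var[OF h] orbit_coeff_def)
  qed
  then obtain P where "\<And>h. m h = eval_at P (substitute h f)" using m by blast
  then have "u h = eval_at P (substitute h f)" if "h \<in> SL3" for h
    using m(2) that by (auto simp: SL3_ideal_def)
  then show ?thesis by (rule that)
qed

end

section \<open>Cayley's operator\<close>

text \<open>The Levi-Civita symbol: sums over permutations become sums over all maps, and these can
  be distributed over products.\<close>

definition eps :: "(3 \<Rightarrow> 3) \<Rightarrow> 'a::comm_ring_1" where
  "eps \<tau> = (if \<tau> permutes UNIV then of_int (sign \<tau>) else 0)"

lemma sum_eps: "(\<Sum>\<tau>\<in>UNIV. eps \<tau> * u \<tau>) = (\<Sum>\<tau> | \<tau> permutes UNIV. of_int (sign \<tau>) * u \<tau>)"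
  by (rule sum.mono_neutral_cong_right) (auto simp: eps_def)

text \<open>Selecting the rows by \<open>\<sigma>\<close> is left multiplication by a matrix
  \<open>E\<close> with determinant \<open>eps \<sigma>\<close>.\<close>

lemma eps_rows: "(\<Sum>\<tau>\<in>UNIV. eps \<tau> * (\<Prod>r\<in>UNIV. h $ \<sigma> r $ \<tau> r)) = eps \<sigma> * det (h :: 'a::comm_ring_1^3^3)"
proof -
  define E :: "'a^3^3" where "E = (\<chi> r j. if \<sigma> r = j then 1 else 0)"
  have dE: "det E = eps \<sigma>"
  proof -
    have "det E = (\<Sum>\<tau>\<in>UNIV. eps \<tau> * (\<Prod>r\<in>UNIV. if \<sigma> r = \<tau> r then 1 else 0))"
      by (simp add: det_def sum_eps E_def)
    also have "\<dots> = (\<Sum>\<tau>\<in>UNIV. if \<tau> = \<sigma> then eps \<tau> else 0)"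
    proof (intro sum.cong refl)
      fix \<tau> :: "3 \<Rightarrow> 3"
      show "eps \<tau> * (\<Prod>r\<in>UNIV. if \<sigma> r = \<tau> r then 1 else 0) = (if \<tau> = \<sigma> then eps \<tau> else (0 :: 'a))"
      proof (cases "\<tau> = \<sigma>")
        case False
        then obtain r where "\<sigma> r \<noteq> \<tau> r" by (metis ext)
        then have "(\<Prod>r\<in>UNIV. if \<sigma> r = \<tau> r then 1 else 0) = (0 :: 'a)" by (intro prod_zero) auto
        then show ?thesis using False by simp
      qed simp
    qed
    finally show ?thesis by simp
  qed
  have "(\<Sum>\<tau>\<in>UNIV. eps \<tau> * (\<Prod>r\<in>UNIV. h $ \<sigma> r $ \<tau> r)) = det (\<chi> r j. h $ \<sigma> r $ j)"
    by (simp add: det_def sum_eps)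
  also have "(\<chi> r j. h $ \<sigma> r $ j) = E ** h"
    by (simp add: vec_eq_iff matrix_matrix_mult_def E_def if_distrib[of "\<lambda>c. c * _"] cong: if_cong)
  finally show ?thesis by (simp add: det_mul dE)
qed

section \<open>Tensor powers of the Levi-Civita symbol\<close>

text \<open>The \<open>3 * N\<close> positions of a tensor in \<open>N\<close> blocks of three, one
  block for each factor \<open>\<Omega>\<close>.\<close>

definition slots :: "nat \<Rightarrow> (nat \<times> 3) set" where
  "slots N = {..<N} \<times> UNIV"

text \<open>Extensional maps, so that there are finitely many and their values on the slots
  determine them.\<close>

definition indices :: "nat \<Rightarrow> (nat \<times> 3 \<Rightarrow> 3) set" where
  "indices N = (slots N \<rightarrow>\<^sub>E UNIV)"

text \<open>A component of the tensor power of the Levi-Civita symbol.\<close>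

definition weight :: "nat \<Rightarrow> (nat \<times> 3 \<Rightarrow> 3) \<Rightarrow> 'a::comm_ring_1" where
  "weight N m = (\<Prod>b<N. eps (\<lambda>r. m (b, r)))"

lemma finite_slots [simp]: "finite (slots N)"
  by (simp add: slots_def)

lemma card_slots: "card (slots N) = 3 * N"
  by (simp add: slots_def)

lemma finite_indices [simp]: "finite (indices N)"
  unfolding indices_def by (intro finite_PiE) auto

lemma prod_slots: "(\<Prod>k\<in>slots N. u k) = (\<Prod>b<N. \<Prod>r\<in>UNIV. u (b, r))"
  by (simp add: slots_def prod.cartesian_product)

lemma sum_indices:
  "(\<Sum>m\<in>indices N. \<Prod>b<N. G b (\<lambda>r. m (b, r))) = (\<Prod>b<N. \<Sum>\<tau>\<in>UNIV. G b \<tau> :: 'a::comm_semiring_1)"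
proof -
  have "(\<Prod>b<N. \<Sum>\<tau>\<in>UNIV. G b \<tau>) = (\<Sum>g\<in>{..<N} \<rightarrow>\<^sub>E UNIV. \<Prod>b<N. G b (g b))"
    by (rule prod_sum_PiE) auto
  also have "\<dots> = (\<Sum>m\<in>indices N. \<Prod>b<N. G b (\<lambda>r. m (b, r)))"
  proof (rule sum.reindex_bij_witness[where i = "\<lambda>m. \<lambda>b\<in>{..<N}. \<lambda>r. m (b, r)" and j = "\<lambda>g. \<lambda>k\<in>slots N. g (fst k) (snd k)"])
    fix g :: "nat \<Rightarrow> 3 \<Rightarrow> 3" assume g: "g \<in> {..<N} \<rightarrow>\<^sub>E UNIV"
    show "(\<lambda>b\<in>{..<N}. \<lambda>r. (\<lambda>k\<in>slots N. g (fst k) (snd k)) (b, r)) = g"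
      using g by (auto simp: slots_def restrict_def PiE_def extensional_def fun_eq_iff)
    show "(\<lambda>k\<in>slots N. g (fst k) (snd k)) \<in> indices N" by (auto simp: indices_def)
    show "(\<Prod>b<N. G b (\<lambda>r. (\<lambda>k\<in>slots N. g (fst k) (snd k)) (b, r))) = (\<Prod>b<N. G b (g b))"
      by (intro prod.cong) (auto simp: slots_def)
  next
    fix m assume m: "m \<in> indices N"
    show "(\<lambda>k\<in>slots N. (\<lambda>b\<in>{..<N}. \<lambda>r. m (b, r)) (fst k) (snd k)) = m"
      using m by (auto simp: slots_def restrict_def PiE_def extensional_def fun_eq_iff indices_def)
  qed auto
  finally show ?thesis by simp
qed

text \<open>Invariance of this tensor under SL3: the sum factors into blocks, and each block is
  evaluated by \<open>eps_rows\<close>.\<close>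

lemma weight_rows:
  assumes "det h = 1"
  shows "(\<Sum>m\<in>indices N. (\<Prod>k\<in>slots N. h $ s k $ m k) * weight N m) = weight N s"
proof -
  have "(\<Sum>m\<in>indices N. (\<Prod>k\<in>slots N. h $ s k $ m k) * weight N m)
    = (\<Sum>m\<in>indices N. \<Prod>b<N. eps (\<lambda>r. m (b, r)) * (\<Prod>r\<in>UNIV. h $ s (b, r) $ m (b, r)))"
    by (simp add: prod_slots weight_def prod.distrib mult.commute)
  also have "\<dots> = (\<Prod>b<N. \<Sum>\<tau>\<in>UNIV. eps \<tau> * (\<Prod>r\<in>UNIV. h $ s (b, r) $ \<tau> r))"
    by (rule sum_indices[of "\<lambda>b \<tau>. eps \<tau> * (\<Prod>r\<in>UNIV. h $ s (b, r) $ \<tau> r)"])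
  also have "\<dots> = weight N s" by (simp add: eps_rows assms weight_def)
  finally show ?thesis .
qed

lemma indices_permute:
  assumes "\<pi> permutes slots N" "m \<in> indices N"
  shows "m \<circ> \<pi> \<in> indices N"
  using assms permutes_not_in[OF assms(1)]
  by (auto simp: indices_def PiE_def extensional_def)

lemma sum_indices_permute:
  assumes "\<pi> permutes slots N"
  shows "(\<Sum>m\<in>indices N. u (m \<circ> \<pi>)) = (\<Sum>m\<in>indices N. u m)"
  by (rule sum.reindex_bij_witness[where i = "\<lambda>m. m \<circ> inv_into UNIV \<pi>" and j = "\<lambda>m. m \<circ> \<pi>"])
     (auto simp: indices_permute permutes_inv assms o_assoc[symmetric] permutes_inv_o[OF assms])

section \<open>Polarization, and the operator on monomials\<close>

definition index_monomial :: "('x \<Rightarrow> 3) \<Rightarrow> ('x \<Rightarrow> 3) \<Rightarrow> 'x set \<Rightarrow> 'a::comm_ring_1^3^3 \<Rightarrow> 'a" where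
  "index_monomial s t K z = (\<Prod>k\<in>K. z $ s k $ t k)"

definition elementary :: "3 \<Rightarrow> 3 \<Rightarrow> 'a::comm_ring_1^3^3" where
  "elementary i j = (\<chi> x y. if x = i \<and> y = j then 1 else 0)"

text \<open>For a form \<open>G\<close> of degree \<open>card K\<close> this is the iterated partial
  derivative in the entries \<open>(i k, j k)\<close>, obtained by inclusion and exclusion. Only
  values of \<open>G\<close> occur, so polynomial dependence on a further parameter is
  preserved.\<close>

definition polarization :: "('x \<Rightarrow> 3) \<Rightarrow> ('x \<Rightarrow> 3) \<Rightarrow> 'x set \<Rightarrow> ('a::comm_ring_1^3^3 \<Rightarrow> 'a) \<Rightarrow> 'a" where
  "polarization i j K G = (\<Sum>X\<in>Pow K. (-1) ^ card X * G (\<Sum>k\<in>K - X. elementary (i k) (j k)))"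

text \<open>Ryser's formula for the permanent: the products are expanded over maps
  \<open>\<tau>\<close> from \<open>K\<close> to \<open>K\<close>, and the alternating sum over
  \<open>X\<close> kills every map that is not onto.\<close>

lemma inclusion_exclusion_permutes:
  fixes a :: "'x \<Rightarrow> 'x \<Rightarrow> 'a::comm_ring_1"
  assumes K: "finite K"
  shows "(\<Sum>X\<in>Pow K. (-1) ^ card X * (\<Prod>k\<in>K. \<Sum>l\<in>K - X. a k l)) = (\<Sum>\<pi> | \<pi> permutes K. \<Prod>k\<in>K. a (\<pi> k) k)"
proof -
  let ?P = "\<lambda>\<tau>. \<Prod>k\<in>K. a k (\<tau> k)"
  have "(\<Sum>X\<in>Pow K. (-1) ^ card X * (\<Prod>k\<in>K. \<Sum>l\<in>K - X. a k l))
    = (\<Sum>X\<in>Pow K. \<Sum>\<tau>\<in>K \<rightarrow>\<^sub>E K. (-1) ^ card X * (\<Prod>x\<in>X. if x \<in> \<tau> ` K then 0 else 1) * ?P \<tau>)"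
  proof (intro sum.cong refl)
    fix X assume X: "X \<in> Pow K"
    then have fX: "finite X" using K finite_subset by auto
    have "(\<Prod>k\<in>K. \<Sum>l\<in>K - X. a k l) = (\<Sum>\<tau>\<in>K \<rightarrow>\<^sub>E (K - X). ?P \<tau>)"
      by (rule prod_sum_PiE) (use K in auto)
    also have "\<dots> = (\<Sum>\<tau>\<in>K \<rightarrow>\<^sub>E K. (\<Prod>x\<in>X. if x \<in> \<tau> ` K then 0 else 1) * ?P \<tau>)"
    proof (rule sum.mono_neutral_cong_left)
      show "finite (K \<rightarrow>\<^sub>E K)" using K by (intro finite_PiE) auto
      show "K \<rightarrow>\<^sub>E (K - X) \<subseteq> K \<rightarrow>\<^sub>E K" by (auto simp: PiE_def)
      show "\<forall>\<tau>\<in>(K \<rightarrow>\<^sub>E K) - (K \<rightarrow>\<^sub>E (K - X)). (\<Prod>x\<in>X. if x \<in> \<tau> ` K then 0 else 1) * ?P \<tau> = 0"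
      proof
        fix \<tau> assume "\<tau> \<in> (K \<rightarrow>\<^sub>E K) - (K \<rightarrow>\<^sub>E (K - X))"
        then obtain k where "k \<in> K" "\<tau> k \<in> X" by (auto simp: PiE_def Pi_def)
        then have "(\<Prod>x\<in>X. if x \<in> \<tau> ` K then 0 else 1) = (0 :: 'a)"
          using fX by (intro prod_zero) auto
        then show "(\<Prod>x\<in>X. if x \<in> \<tau> ` K then 0 else 1) * ?P \<tau> = 0" by simp
      qed
      fix \<tau> assume "\<tau> \<in> K \<rightarrow>\<^sub>E (K - X)"
      then have "(\<Prod>x\<in>X. if x \<in> \<tau> ` K then 0 else 1) = (1 :: 'a)" by (intro prod.neutral) auto
      then show "?P \<tau> = (\<Prod>x\<in>X. if x \<in> \<tau> ` K then 0 else 1) * ?P \<tau>" by simp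
    qed
    finally show "(-1) ^ card X * (\<Prod>k\<in>K. \<Sum>l\<in>K - X. a k l)
      = (\<Sum>\<tau>\<in>K \<rightarrow>\<^sub>E K. (-1) ^ card X * (\<Prod>x\<in>X. if x \<in> \<tau> ` K then 0 else 1) * ?P \<tau>)"
      by (simp add: sum_distrib_left mult.assoc)
  qed
  also have "\<dots> = (\<Sum>\<tau>\<in>K \<rightarrow>\<^sub>E K. (\<Sum>X\<in>Pow K. (-1) ^ card X * (\<Prod>x\<in>X. if x \<in> \<tau> ` K then 0 else 1)) * ?P \<tau>)"
    by (subst sum.swap) (simp add: sum_distrib_right)
  also have "\<dots> = (\<Sum>\<tau>\<in>K \<rightarrow>\<^sub>E K. if \<tau> ` K = K then ?P \<tau> else 0)"
  proof (intro sum.cong refl)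
    fix \<tau> assume \<tau>: "\<tau> \<in> K \<rightarrow>\<^sub>E K"
    have "(\<Sum>X\<in>Pow K. (-1) ^ card X * (\<Prod>x\<in>X. if x \<in> \<tau> ` K then 0 else 1))
      = (\<Prod>x\<in>K. 1 - (if x \<in> \<tau> ` K then 0 else (1 :: 'a)))"
      using prod_diff_conv_sum[OF K, of "\<lambda>_. 1 :: 'a" "\<lambda>x. if x \<in> \<tau> ` K then 0 else 1"] by simp
    also have "\<dots> = (if \<tau> ` K = K then 1 else 0)"
    proof (cases "\<tau> ` K = K")
      case True
      then show ?thesis by (simp cong: prod.cong)
    next
      case False
      then obtain x where "x \<in> K" "x \<notin> \<tau> ` K" using \<tau> by auto
      then have "(\<Prod>x\<in>K. 1 - (if x \<in> \<tau> ` K then 0 else (1 :: 'a))) = 0" using K by (intro prod_zero) auto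
      then show ?thesis using False by simp
    qed
    finally show "(\<Sum>X\<in>Pow K. (-1) ^ card X * (\<Prod>x\<in>X. if x \<in> \<tau> ` K then 0 else 1)) * ?P \<tau>
      = (if \<tau> ` K = K then ?P \<tau> else 0)" by simp
  qed
  also have "\<dots> = (\<Sum>\<tau> | \<tau> \<in> K \<rightarrow>\<^sub>E K \<and> \<tau> ` K = K. ?P \<tau>)"
    by (rule sum.inter_filter[symmetric]) (use K in \<open>auto intro!: finite_PiE\<close>)
  also have "\<dots> = (\<Sum>\<pi> | \<pi> permutes K. ?P \<pi>)"
  proof (rule sum.reindex_bij_witness[where i = "\<lambda>\<pi>. restrict \<pi> K" and j = "\<lambda>\<tau> x. if x \<in> K then \<tau> x else x"])
    fix \<tau> assume \<tau>: "\<tau> \<in> {\<tau> \<in> K \<rightarrow>\<^sub>E K. \<tau> ` K = K}"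
    show "restrict (\<lambda>x. if x \<in> K then \<tau> x else x) K = \<tau>" using \<tau>
      by (auto simp: restrict_def PiE_def extensional_def fun_eq_iff)
    have "bij_betw \<tau> K K" using \<tau> K by (auto simp: bij_betw_def intro: eq_card_imp_inj_on)
    then have "bij_betw (\<lambda>x. if x \<in> K then \<tau> x else x) K K" by (simp cong: bij_betw_cong)
    then show "(\<lambda>x. if x \<in> K then \<tau> x else x) \<in> {\<pi>. \<pi> permutes K}" by (auto intro: bij_imp_permutes)
    show "(\<Prod>k\<in>K. a k (if k \<in> K then \<tau> k else k)) = ?P \<tau>" by (intro prod.cong) auto
  next
    fix \<pi> assume "\<pi> \<in> {\<pi>. \<pi> permutes K}"
    then have \<pi>: "\<pi> permutes K" by simp
    show "(\<lambda>x. if x \<in> K then restrict \<pi> K x else x) = \<pi>" using permutes_not_in[OF \<pi>] by (auto simp: fun_eq_iff)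
    have "restrict \<pi> K ` K = \<pi> ` K" by auto
    then show "restrict \<pi> K \<in> {\<tau> \<in> K \<rightarrow>\<^sub>E K. \<tau> ` K = K}" using permutes_image[OF \<pi>] by auto
  qed
  also have "\<dots> = (\<Sum>\<pi> | \<pi> permutes K. \<Prod>k\<in>K. a (\<pi> k) k)"
  proof (subst sum_permutations_inverse, intro sum.cong refl)
    fix \<pi> assume "\<pi> \<in> {\<pi>. \<pi> permutes K}"
    then have \<pi>: "\<pi> permutes K" by simp
    show "(\<Prod>k\<in>K. a k (inv_into UNIV \<pi> k)) = (\<Prod>k\<in>K. a (\<pi> k) k)"
      by (subst prod.permute[OF \<pi>]) (simp add: o_def permutes_inverses[OF \<pi>])
  qed
  finally show ?thesis .
qed

text \<open>The product rule: each permutation matches the derivatives with the factors of the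
  monomial.\<close>

lemma polarization_monomial:
  assumes "finite K"
  shows "polarization i j K (index_monomial s t K :: 'a::comm_ring_1^3^3 \<Rightarrow> 'a)
    = (\<Sum>\<pi> | \<pi> permutes K. if \<forall>k\<in>K. i k = s (\<pi> k) \<and> j k = t (\<pi> k) then 1 else 0)"
proof -
  have "polarization i j K (index_monomial s t K :: 'a^3^3 \<Rightarrow> 'a)
    = (\<Sum>X\<in>Pow K. (-1) ^ card X * (\<Prod>k\<in>K. \<Sum>l\<in>K - X. if s k = i l \<and> t k = j l then 1 else 0))"
    unfolding polarization_def index_monomial_def by (simp add: elementary_def)
  also have "\<dots> = (\<Sum>\<pi> | \<pi> permutes K. \<Prod>k\<in>K. if s (\<pi> k) = i k \<and> t (\<pi> k) = j k then 1 else 0)"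
    by (rule inclusion_exclusion_permutes[OF assms])
  also have "\<dots> = (\<Sum>\<pi> | \<pi> permutes K. if \<forall>k\<in>K. i k = s (\<pi> k) \<and> j k = t (\<pi> k) then 1 else 0)"
  proof (intro sum.cong refl)
    fix \<pi>
    show "(\<Prod>k\<in>K. if s (\<pi> k) = i k \<and> t (\<pi> k) = j k then 1 else 0)
       = (if \<forall>k\<in>K. i k = s (\<pi> k) \<and> j k = t (\<pi> k) then 1 else (0 :: 'a))"
    proof (cases "\<forall>k\<in>K. i k = s (\<pi> k) \<and> j k = t (\<pi> k)")
      case False
      then obtain k where "k \<in> K" "\<not> (s (\<pi> k) = i k \<and> t (\<pi> k) = j k)" by auto
      then have "(\<Prod>k\<in>K. if s (\<pi> k) = i k \<and> t (\<pi> k) = j k then 1 else 0) = (0 :: 'a)"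
        using assms by (intro prod_zero bexI[of _ k]) auto
      then show ?thesis using False by simp
    qed (simp cong: prod.cong)
  qed
  finally show ?thesis .
qed

text \<open>Up to a factor, Cayley's operator \<open>\<Omega>\<^sup>N\<close>, written as a combination of evaluations.\<close>

definition cayley :: "nat \<Rightarrow> ('a::comm_ring_1^3^3 \<Rightarrow> 'a) \<Rightarrow> 'a" where
  "cayley N G = (\<Sum>i\<in>indices N. \<Sum>j\<in>indices N. weight N i * weight N j * polarization i j (slots N) G)"

lemma polarization_linear:
  "polarization i j K (\<lambda>z. G z + H z) = polarization i j K G + polarization i j K H"
  "polarization i j K (\<lambda>z. c * G z) = c * polarization i j K G"
  by (simp_all add: polarization_def sum.distrib distrib_left sum_distrib_left mult_ac)

lemma cayley_add: "cayley N (\<lambda>z. G z + H z) = cayley N G + cayley N H"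
  by (simp add: cayley_def polarization_linear sum.distrib distrib_left)

lemma cayley_scale: "cayley N (\<lambda>z. c * G z) = c * cayley N G"
  by (simp add: cayley_def polarization_linear sum_distrib_left mult_ac)

lemma cayley_0: "cayley N (\<lambda>_. 0) = 0"
  using cayley_scale[of N 0 "\<lambda>_. 0"] by simp

lemma cayley_sum: "cayley N (\<lambda>z. \<Sum>i\<in>I. G i z) = (\<Sum>i\<in>I. cayley N (G i))"
  by (induction I rule: infinite_finite_induct) (auto simp: cayley_0 cayley_add)

lemma cayley_monomial:
  assumes "s \<in> indices N" "t \<in> indices N"
  shows "cayley N (index_monomial s t (slots N) :: 'a::comm_ring_1^3^3 \<Rightarrow> 'a)
    = (\<Sum>\<pi> | \<pi> permutes slots N. weight N (s \<circ> \<pi>) * weight N (t \<circ> \<pi>))"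
proof -
  have "cayley N (index_monomial s t (slots N) :: 'a^3^3 \<Rightarrow> 'a) =
    (\<Sum>i\<in>indices N. \<Sum>j\<in>indices N. \<Sum>\<pi> | \<pi> permutes slots N.
      if i = s \<circ> \<pi> \<and> j = t \<circ> \<pi> then weight N i * weight N j else 0)"
    unfolding cayley_def polarization_monomial[OF finite_slots] sum_distrib_left
  proof (intro sum.cong refl)
    fix i j \<pi> assume i: "i \<in> indices N" and j: "j \<in> indices N" and "\<pi> \<in> {\<pi>. \<pi> permutes slots N}"
    then have \<pi>: "\<pi> permutes slots N" by simp
    have ext: "a = b \<longleftrightarrow> (\<forall>k\<in>slots N. a k = b k)" if "a \<in> indices N" "b \<in> indices N" for a b
      using PiE_ext[of a "slots N" "\<lambda>_. UNIV" b] that unfolding indices_def by blast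
    have "(\<forall>k\<in>slots N. i k = s (\<pi> k) \<and> j k = t (\<pi> k)) \<longleftrightarrow> i = s \<circ> \<pi> \<and> j = t \<circ> \<pi>"
      using ext[OF i indices_permute[OF \<pi> assms(1)]] ext[OF j indices_permute[OF \<pi> assms(2)]] by auto
    then show "weight N i * weight N j * (if \<forall>k\<in>slots N. i k = s (\<pi> k) \<and> j k = t (\<pi> k) then 1 else 0)
      = (if i = s \<circ> \<pi> \<and> j = t \<circ> \<pi> then weight N i * weight N j else (0 :: 'a))" by simp
  qed
  also have "\<dots> = (\<Sum>\<pi> | \<pi> permutes slots N. \<Sum>i\<in>indices N. \<Sum>j\<in>indices N.
      if i = s \<circ> \<pi> \<and> j = t \<circ> \<pi> then weight N i * weight N j else 0)"
    by (subst sum.swap, subst (2) sum.swap, subst sum.swap)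
       (rule sum.cong[OF refl sum.swap])
  also have "\<dots> = (\<Sum>\<pi> | \<pi> permutes slots N. weight N (s \<circ> \<pi>) * weight N (t \<circ> \<pi>))"
  proof (intro sum.cong refl)
    fix \<pi> assume "\<pi> \<in> {\<pi>. \<pi> permutes slots N}"
    then have \<pi>: "\<pi> permutes slots N" by simp
    have "(\<Sum>i\<in>indices N. \<Sum>j\<in>indices N. if i = s \<circ> \<pi> \<and> j = t \<circ> \<pi> then weight N i * weight N j else 0)
      = (\<Sum>i\<in>indices N. if i = s \<circ> \<pi> then (\<Sum>j\<in>indices N. if j = t \<circ> \<pi> then weight N i * weight N j else 0) else (0 :: 'a))"
      by (intro sum.cong refl) auto
    also have "\<dots> = weight N (s \<circ> \<pi>) * weight N (t \<circ> \<pi>)"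
      using indices_permute[OF \<pi>] assms by (simp add: sum.delta)
    finally show "(\<Sum>i\<in>indices N. \<Sum>j\<in>indices N. if i = s \<circ> \<pi> \<and> j = t \<circ> \<pi> then weight N i * weight N j else (0 :: 'a))
      = weight N (s \<circ> \<pi>) * weight N (t \<circ> \<pi>)" .
  qed
  finally show ?thesis .
qed

text \<open>Expanding the entries of \<open>h ** z\<close> replaces the row indices \<open>s\<close>
  by all \<open>m\<close>, with products of entries of \<open>h\<close> as coefficients; once the
  slots are permuted in both, \<open>weight_rows\<close> absorbs them.\<close>

lemma cayley_monomial_translate:
  assumes s: "s \<in> indices N" and t: "t \<in> indices N" and h: "det h = 1"
  shows "cayley N (\<lambda>z. index_monomial s t (slots N) (h ** z)) = cayley N (index_monomial s t (slots N) :: 'a::comm_ring_1^3^3 \<Rightarrow> 'a)"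
proof -
  have "index_monomial s t (slots N) (h ** z) =
    (\<Sum>m\<in>indices N. (\<Prod>k\<in>slots N. h $ s k $ m k) * index_monomial m t (slots N) z)" for z :: "'a^3^3"
  proof -
    have "index_monomial s t (slots N) (h ** z) = (\<Prod>k\<in>slots N. \<Sum>l\<in>UNIV. h $ s k $ l * z $ l $ t k)"
      by (simp add: index_monomial_def matrix_matrix_mult_def)
    also have "\<dots> = (\<Sum>m\<in>indices N. \<Prod>k\<in>slots N. h $ s k $ m k * z $ m k $ t k)"
      unfolding indices_def by (rule prod_sum_PiE) auto
    finally show ?thesis by (simp add: prod.distrib index_monomial_def)
  qed
  then have "cayley N (\<lambda>z. index_monomial s t (slots N) (h ** z)) =
    (\<Sum>m\<in>indices N. (\<Prod>k\<in>slots N. h $ s k $ m k) * cayley N (index_monomial m t (slots N)))"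
    by (simp add: cayley_sum cayley_scale)
  also have "\<dots> = (\<Sum>m\<in>indices N. \<Sum>\<pi> | \<pi> permutes slots N.
      (\<Prod>k\<in>slots N. h $ s k $ m k) * (weight N (m \<circ> \<pi>) * weight N (t \<circ> \<pi>)))"
    by (intro sum.cong refl) (simp add: cayley_monomial t sum_distrib_left)
  also have "\<dots> = (\<Sum>\<pi> | \<pi> permutes slots N. (\<Sum>m\<in>indices N.
      (\<Prod>k\<in>slots N. h $ s k $ m k) * weight N (m \<circ> \<pi>)) * weight N (t \<circ> \<pi>))"
    by (subst sum.swap) (simp add: sum_distrib_right mult.assoc)
  also have "\<dots> = (\<Sum>\<pi> | \<pi> permutes slots N. weight N (s \<circ> \<pi>) * weight N (t \<circ> \<pi>))"
  proof (intro sum.cong refl)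
    fix \<pi> assume "\<pi> \<in> {\<pi>. \<pi> permutes slots N}"
    then have \<pi>: "\<pi> permutes slots N" by simp
    have "(\<Sum>m\<in>indices N. (\<Prod>k\<in>slots N. h $ s k $ m k) * weight N (m \<circ> \<pi>)) =
      (\<Sum>m\<in>indices N. (\<Prod>k\<in>slots N. h $ (s \<circ> \<pi>) k $ (m \<circ> \<pi>) k) * weight N (m \<circ> \<pi>))"
      by (subst prod.permute[OF \<pi>]) (simp add: o_def)
    also have "\<dots> = weight N (s \<circ> \<pi>)"
      using sum_indices_permute[OF \<pi>, of "\<lambda>m. (\<Prod>k\<in>slots N. h $ (s \<circ> \<pi>) k $ m k) * weight N m"]
        weight_rows[OF h, where s = "s \<circ> \<pi>"] by simp
    finally show "(\<Sum>m\<in>indices N. (\<Prod>k\<in>slots N. h $ s k $ m k) * weight N (m \<circ> \<pi>)) * weight N (t \<circ> \<pi>)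
      = weight N (s \<circ> \<pi>) * weight N (t \<circ> \<pi>)" by simp
  qed
  also have "\<dots> = cayley N (index_monomial s t (slots N))" by (rule cayley_monomial[OF s t, symmetric])
  finally show ?thesis .
qed


lemma of_int_eps: "of_int (eps \<tau>) = eps \<tau>"
  by (simp add: eps_def)

lemma of_int_weight: "of_int (weight N m) = weight N m"
  by (simp add: weight_def of_int_eps)

text \<open>The number 6 of permutations of the rows, which arises because
  \<open>det_power_expansion\<close> sums over permutations of both rows and columns.\<close>

definition eps_norm :: "'a::comm_ring_1" where
  "eps_norm = (\<Sum>\<tau>\<in>UNIV. eps \<tau> * eps \<tau>)"

lemma eps_id: "eps (\<lambda>r. r) = 1"
  using permutes_id[of UNIV] sign_id by (simp add: eps_def id_def)

lemma det_power_expansion: "(eps_norm * det z) ^ N =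
  (\<Sum>s\<in>indices N. \<Sum>t\<in>indices N. weight N s * weight N t * index_monomial s t (slots N) z)"
proof -
  let ?row = "\<lambda>\<sigma>. \<Sum>\<tau>\<in>UNIV. eps \<tau> * (\<Prod>r\<in>UNIV. z $ \<sigma> r $ \<tau> r)"
  have "(eps_norm * det z) ^ N = (\<Prod>b<N. \<Sum>\<sigma>\<in>UNIV. eps \<sigma> * ?row \<sigma>)"
    unfolding eps_rows by (simp add: eps_norm_def sum_distrib_right mult.assoc)
  also have "\<dots> = (\<Sum>s\<in>indices N. \<Prod>b<N. eps (\<lambda>r. s (b, r)) * ?row (\<lambda>r. s (b, r)))"
    by (rule sum_indices[symmetric, of "\<lambda>b \<sigma>. eps \<sigma> * ?row \<sigma>"])
  also have "\<dots> = (\<Sum>s\<in>indices N. weight N s * (\<Prod>b<N. ?row (\<lambda>r. s (b, r))))"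
    by (simp add: prod.distrib weight_def)
  also have "\<dots> = (\<Sum>s\<in>indices N. weight N s * (\<Sum>t\<in>indices N. weight N t * index_monomial s t (slots N) z))"
  proof (intro sum.cong refl arg_cong2[where f = "(*)"])
    fix s
    have "(\<Prod>b<N. ?row (\<lambda>r. s (b, r))) =
      (\<Sum>t\<in>indices N. \<Prod>b<N. eps (\<lambda>r. t (b, r)) * (\<Prod>r\<in>UNIV. z $ s (b, r) $ t (b, r)))"
      by (rule sum_indices[symmetric, of "\<lambda>b \<tau>. eps \<tau> * (\<Prod>r\<in>UNIV. z $ s (b, r) $ \<tau> r)"])
    then show "(\<Prod>b<N. ?row (\<lambda>r. s (b, r))) = (\<Sum>t\<in>indices N. weight N t * index_monomial s t (slots N) z)"
      by (simp add: prod.distrib weight_def index_monomial_def prod_slots)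
  qed
  finally show ?thesis by (simp add: sum_distrib_left mult.assoc)
qed

text \<open>Expanding both determinants makes \<open>cayley N (det ^ N)\<close> a sum of squares of integers.\<close>

lemma cayley_det_power: "cayley N (\<lambda>z. det z ^ N) \<noteq> (0 :: 'a::field_char_0)"
proof
  assume 0: "cayley N (\<lambda>z. det z ^ N) = (0 :: 'a)"
  let ?M = "indices N" and ?\<Pi> = "{\<pi>. \<pi> permutes slots N}"
  have "0 = eps_norm ^ N * cayley N (\<lambda>z. det z ^ N :: 'a)" using 0 by simp
  also have "\<dots> = cayley N (\<lambda>z. (eps_norm * det z) ^ N)"
    unfolding power_mult_distrib cayley_scale ..
  also have "\<dots> = (\<Sum>s\<in>?M. \<Sum>t\<in>?M. weight N s * weight N t * cayley N (index_monomial s t (slots N)))"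
    unfolding det_power_expansion by (simp add: cayley_sum cayley_scale)
  also have "\<dots> = (\<Sum>s\<in>?M. \<Sum>t\<in>?M. \<Sum>\<pi>\<in>?\<Pi>. (weight N s * weight N (s \<circ> \<pi>)) * (weight N t * weight N (t \<circ> \<pi>)))"
    by (intro sum.cong refl) (simp add: cayley_monomial sum_distrib_left mult_ac)
  also have "\<dots> = (\<Sum>\<pi>\<in>?\<Pi>. (\<Sum>s\<in>?M. weight N s * weight N (s \<circ> \<pi>)) * (\<Sum>t\<in>?M. weight N t * weight N (t \<circ> \<pi>)))"
    unfolding sum_product
    by (subst sum.swap, subst (2) sum.swap, subst sum.swap) (rule sum.cong[OF refl sum.swap])
  also have "\<dots> = of_int (\<Sum>\<pi>\<in>?\<Pi>. (\<Sum>s\<in>?M. weight N s * weight N (s \<circ> \<pi>))\<^sup>2)"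
    by (simp add: of_int_weight power2_eq_square)
  \<comment> \<open>Characteristic 0 brings the equation down to the integers, where squares are
    nonnegative.\<close>
  finally have "(0 :: int) = (\<Sum>\<pi>\<in>?\<Pi>. (\<Sum>s\<in>?M. weight N s * weight N (s \<circ> \<pi>))\<^sup>2)"
    by (simp only: of_int_0_eq_iff)
  then have "(\<Sum>\<pi>\<in>?\<Pi>. (\<Sum>s\<in>?M. weight N s * weight N (s \<circ> \<pi>))\<^sup>2) = (0 :: int)" by (rule sym)
  moreover have "finite ?\<Pi>" by (rule finite_permutations) simp
  \<comment> \<open>The term of the identity permutation is the square of a sum of squares of
    weights.\<close>
  moreover have "id \<in> ?\<Pi>" by (simp add: permutes_id)
  ultimately have "(\<Sum>s\<in>?M. weight N s * weight N (s \<circ> id))\<^sup>2 = (0 :: int)"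
    using sum_nonneg_eq_0_iff[of ?\<Pi> "\<lambda>\<pi>. (\<Sum>s\<in>?M. weight N s * weight N (s \<circ> \<pi>))\<^sup>2 :: int",
      OF _ zero_le_power2] by blast
  then have sq: "(\<Sum>s\<in>?M. (weight N s)\<^sup>2) = (0 :: int)" by (simp add: power2_eq_square)
  \<comment> \<open>Every block of this index is the identity map, of sign 1.\<close>
  define s where "s = restrict snd (slots N)"
  have "s \<in> ?M" by (simp add: s_def indices_def)
  then have "(weight N s)\<^sup>2 = (0 :: int)"
    using sum_nonneg_eq_0_iff[of ?M "\<lambda>s. (weight N s)\<^sup>2 :: int"] sq by simp
  then have "weight N s = (0 :: int)" by simp
  moreover have "weight N s = (\<Prod>b<N. eps (\<lambda>r. r) :: int)"
    unfolding weight_def by (intro prod.cong refl arg_cong[where f = eps] ext) (auto simp: s_def slots_def)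
  ultimately show False by (simp add: eps_id)
qed

section \<open>Forms in the entries of a matrix\<close>

text \<open>Forms are taken as functions, since \<open>cayley\<close> sees only values; splitting
  off one entry at a time matches the removal of one slot in
  \<open>matrix_form_span\<close>.\<close>

inductive matrix_form :: "nat \<Rightarrow> ('a::comm_ring_1^3^3 \<Rightarrow> 'a) \<Rightarrow> bool" where
  const: "matrix_form 0 (\<lambda>_. c)"
| zero: "matrix_form n (\<lambda>_. 0)"
| add: "matrix_form n G \<Longrightarrow> matrix_form n H \<Longrightarrow> matrix_form n (\<lambda>z. G z + H z)"
| coord: "matrix_form n G \<Longrightarrow> matrix_form (Suc n) (\<lambda>z. z $ i $ j * G z)"

lemma matrix_form_scale: "matrix_form n G \<Longrightarrow> matrix_form n (\<lambda>z. c * G z)"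
proof (induction rule: matrix_form.induct)
  case (const d)
  show ?case by (rule matrix_form.const)
next
  case (zero n)
  show ?case using matrix_form.zero by simp
next
  case (add n G H)
  then show ?case using matrix_form.add[of n "\<lambda>z. c * G z" "\<lambda>z. c * H z"] by (simp add: distrib_left)
next
  case (coord n G i j)
  then show ?case using matrix_form.coord[of n "\<lambda>z. c * G z" i j] by (simp add: mult.left_commute)
qed

lemma matrix_form_mult: "matrix_form m G \<Longrightarrow> matrix_form n H \<Longrightarrow> matrix_form (m + n) (\<lambda>z. G z * H z)"
proof (induction rule: matrix_form.induct)
  case (const d)
  then show ?case using matrix_form_scale by simp
next
  case (zero m)
  show ?case using matrix_form.zero by simp
next
  case (add m G G')
  then show ?case using matrix_form.add[of "m + n" "\<lambda>z. G z * H z" "\<lambda>z. G' z * H z"] by (simp add: distrib_right)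
next
  case (coord m G i j)
  then show ?case using matrix_form.coord[of "m + n" "\<lambda>z. G z * H z" i j] by (simp add: mult.assoc)
qed

lemma graded_matrix_form: "graded_functions (\<lambda>n. {G :: 'a::comm_ring_1^3^3 \<Rightarrow> 'a. matrix_form n G})"
  by unfold_locales (auto intro: matrix_form.intros matrix_form_mult)

lemma matrix_form_nth: "matrix_form 1 (\<lambda>z. z $ i $ j)"
  using matrix_form.coord[OF matrix_form.const[of 1]] by simp

lemma matrix_form_homogeneous: "matrix_form n G \<Longrightarrow> G (\<chi> i j. c * z $ i $ j) = c ^ n * G z"
  by (induction rule: matrix_form.induct) (auto simp: distrib_left mult_ac)

text \<open>\<open>X\<close> stands for a property closed under linear combinations. For a product
  with an entry, one slot is removed from \<open>K\<close> and the induction hypothesis is applied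
  to the set of forms whose product with this entry lies in \<open>X\<close>; this is why
  \<open>K\<close> and \<open>X\<close> have to vary.\<close>

lemma matrix_form_span:
  fixes K :: "'x set" and G :: "'a::comm_ring_1^3^3 \<Rightarrow> 'a"
  assumes "matrix_form n G" "finite K" "card K = n"
    and "\<And>s t. index_monomial s t K \<in> X" "\<And>G H. G \<in> X \<Longrightarrow> H \<in> X \<Longrightarrow> (\<lambda>z. G z + H z) \<in> X"
    "\<And>c G. G \<in> X \<Longrightarrow> (\<lambda>z. c * G z) \<in> X"
  shows "G \<in> X"
  using assms
proof (induction arbitrary: K X rule: matrix_form.induct)
  case (const c)
  then have "K = {}" by simp
  then have "(\<lambda>_. 1) \<in> X" using const(3)[of undefined undefined] by (simp add: index_monomial_def[abs_def])
  then show ?case using const(5)[of "\<lambda>_. 1" c] by simp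
next
  case (zero n)
  then show ?case using zero(5)[of "index_monomial undefined undefined K" 0] by simp
next
  case (add n G H)
  show ?case
    by (rule add.prems(4)[OF add.IH(1)[OF add.prems] add.IH(2)[OF add.prems]])
next
  case (coord n G i j)
  from coord.prems(2) obtain k K' where K: "K = insert k K'" "k \<notin> K'" "card K' = n"
    by (metis card_Suc_eq)
  then have fin: "finite K'" using coord.prems(1) by simp
  have "G \<in> {G. (\<lambda>z. z $ i $ j * G z) \<in> X}"
  proof (rule coord.IH[OF fin K(3)])
    fix s t
    have "(\<lambda>z :: 'a^3^3. z $ i $ j * index_monomial s t K' z) = index_monomial (s(k := i)) (t(k := j)) K"
    proof
      fix z :: "'a^3^3"
      have "(\<Prod>l\<in>K'. z $ (s(k := i)) l $ (t(k := j)) l) = (\<Prod>l\<in>K'. z $ s l $ t l)"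
        using K(2) by (intro prod.cong) auto
      then show "z $ i $ j * index_monomial s t K' z = index_monomial (s(k := i)) (t(k := j)) K z"
        using fin K by (simp add: index_monomial_def)
    qed
    then show "index_monomial s t K' \<in> {G. (\<lambda>z. z $ i $ j * G z) \<in> X}" using coord.prems(3) by simp
  next
    fix G H assume "G \<in> {G. (\<lambda>z. z $ i $ j * G z) \<in> X}" "H \<in> {G. (\<lambda>z. z $ i $ j * G z) \<in> X}"
    then show "(\<lambda>z. G z + H z) \<in> {G. (\<lambda>z. z $ i $ j * G z) \<in> X}"
      using coord.prems(4)[of "\<lambda>z. z $ i $ j * G z" "\<lambda>z. z $ i $ j * H z"] by (simp add: distrib_left)
  next
    fix c G assume "G \<in> {G. (\<lambda>z. z $ i $ j * G z) \<in> X}"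
    then show "(\<lambda>z. c * G z) \<in> {G. (\<lambda>z. z $ i $ j * G z) \<in> X}"
      using coord.prems(5)[of "\<lambda>z. z $ i $ j * G z" c] by (simp add: mult.left_commute)
  qed
  then show ?case by simp
qed

lemma cayley_translate:
  assumes "matrix_form (3 * N) G" "det h = 1"
  shows "cayley N (\<lambda>z. G (h ** z)) = cayley N G"
proof -
  have "G \<in> {G. cayley N (\<lambda>z. G (h ** z)) = cayley N G}"
  proof (rule matrix_form_span[OF assms(1) finite_slots card_slots])
    fix s t :: "nat \<times> 3 \<Rightarrow> 3"
    \<comment> \<open>Restricting the indices makes them extensional without changing the
      monomial.\<close>
    have eq: "index_monomial s t (slots N) = index_monomial (restrict s (slots N)) (restrict t (slots N)) (slots N)"
      by (auto simp: index_monomial_def intro!: ext prod.cong)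
    show "index_monomial s t (slots N) \<in> {G. cayley N (\<lambda>z. G (h ** z)) = cayley N G}"
      unfolding eq by (simp add: cayley_monomial_translate[OF _ _ assms(2)] indices_def)
  qed (auto simp: cayley_add cayley_scale)
  then show ?thesis by simp
qed

section \<open>Existence of independent contravariants\<close>

lemma graded_det:
  fixes M :: "'p \<Rightarrow> 'a::comm_ring_1^3^3"
  assumes "graded_functions T" "\<And>i j. (\<lambda>p. M p $ i $ j) \<in> T d"
  shows "(\<lambda>p. det (M p)) \<in> T (3 * d)"
proof -
  interpret graded_functions T by fact
  have "(\<lambda>p. \<Prod>i\<in>UNIV. M p $ i $ \<pi> i) \<in> T (\<Sum>i\<in>(UNIV :: 3 set). d)" for \<pi>
    by (intro prod assms(2)) auto
  then show ?thesis unfolding det_def by (intro sum scale) simp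
qed

lemma graded_eval_substitute:
  assumes "graded_functions T" "\<And>i j. (\<lambda>p. M p $ i $ j) \<in> T 1" "F \<in> Sym_pow 4" "homogeneous d q"
  shows "(\<lambda>p. eval_at q (substitute (M p) F)) \<in> T (d * 4)"
proof -
  interpret graded_functions T by fact
  show ?thesis unfolding eval_at_def
    using assms by (intro eval_homogeneous substitute_coeff) (auto simp: Sym_pow_def)
qed

text \<open>Cayley's operator in \<open>z\<close> on \<open>det z ^ k\<close> times the vector
  \<open>z q(F \<circ> z)\<close>: an algebraic substitute for averaging \<open>q\<close> over the
  group. The exponent \<open>k\<close> serves to adjust the degree in \<open>z\<close> to
  \<open>3 * N\<close>.\<close>

definition reynolds :: "nat \<Rightarrow> nat \<Rightarrow> (3 \<Rightarrow> (3 \<Rightarrow>\<^sub>0 nat, 'k) mpoly) \<Rightarrow> (3, 'k::comm_ring_1) mpoly \<Rightarrow> 'k^3" where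
  "reynolds N k q F = (\<chi> i. cayley N (\<lambda>z. det z ^ k * (\<Sum>l\<in>UNIV. z $ i $ l * eval_at (q l) (substitute z F))))"

lemma matrix_form_integrand:
  assumes "\<And>l. homogeneous d (q l)" "F \<in> Sym_pow 4"
  shows "matrix_form (4 * d + 1) (\<lambda>z. \<Sum>l\<in>UNIV. z $ i $ l * eval_at (q l) (substitute z F))"
proof -
  interpret graded_functions "\<lambda>n. {G. matrix_form n G}" by (rule graded_matrix_form)
  have "(\<lambda>z. z $ i $ l * eval_at (q l) (substitute z F)) \<in> {G. matrix_form (1 + d * 4) G}" for l
    by (intro mult graded_eval_substitute[OF graded_matrix_form, where M = "\<lambda>z. z"]) (auto simp: matrix_form_nth[unfolded One_nat_def] assms)
  from sum[OF this] show ?thesis by (simp add: mult.commute)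
qed

lemma matrix_form_det_power: "matrix_form (3 * k) (\<lambda>z. det z ^ k :: 'a::comm_ring_1)"
proof -
  interpret graded_functions "\<lambda>n. {G :: 'a^3^3 \<Rightarrow> 'a. matrix_form n G}" by (rule graded_matrix_form)
  have "(\<lambda>z. det z) \<in> {G :: 'a^3^3 \<Rightarrow> 'a. matrix_form (3 * 1) G}"
    by (intro graded_det[OF graded_matrix_form, where M = "\<lambda>z. z"]) (auto simp: matrix_form_nth[unfolded One_nat_def])
  from power[OF this, of k] show ?thesis by (simp add: mult.commute)
qed

lemma graded_form_values:
  "graded_functions (\<lambda>d. {u :: (3, 'k::comm_semiring_1) mpoly \<Rightarrow> 'k. \<exists>P. homogeneous d P \<and> (\<forall>F\<in>Sym_pow 4. u F = eval_at P F)})"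
proof
  have h: "semiring_hom (\<lambda>c :: 'k. c)" by (rule semiring_hom_id)
  show "(\<lambda>_. c) \<in> {u. \<exists>P. homogeneous 0 P \<and> (\<forall>F\<in>Sym_pow 4. u F = eval_at P F)}" for c :: 'k
    by (intro CollectI exI[of _ "const c"]) (auto simp: eval_at_def eval_poly_const[OF h])
  show "(\<lambda>_. 0) \<in> {u :: (3, 'k) mpoly \<Rightarrow> 'k. \<exists>P. homogeneous n P \<and> (\<forall>F\<in>Sym_pow 4. u F = eval_at P F)}" for n
    by (intro CollectI exI[of _ 0]) (auto simp: eval_at_def)
  fix u w :: "(3, 'k) mpoly \<Rightarrow> 'k" and m n
  assume "w \<in> {u. \<exists>P. homogeneous n P \<and> (\<forall>F\<in>Sym_pow 4. u F = eval_at P F)}"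
  then obtain R where R: "homogeneous n R" "\<forall>F\<in>Sym_pow 4. w F = eval_at R F" by blast
  { assume "u \<in> {u. \<exists>P. homogeneous n P \<and> (\<forall>F\<in>Sym_pow 4. u F = eval_at P F)}"
    then obtain P where P: "homogeneous n P" "\<forall>F\<in>Sym_pow 4. u F = eval_at P F" by blast
    show "(\<lambda>p. u p + w p) \<in> {u. \<exists>P. homogeneous n P \<and> (\<forall>F\<in>Sym_pow 4. u F = eval_at P F)}"
      by (intro CollectI exI[of _ "P + R"]) (use P R in \<open>auto simp: eval_at_def eval_poly_add[OF h] homogeneous_add\<close>) }
  { assume "u \<in> {u. \<exists>P. homogeneous m P \<and> (\<forall>F\<in>Sym_pow 4. u F = eval_at P F)}"
    then obtain P where P: "homogeneous m P" "\<forall>F\<in>Sym_pow 4. u F = eval_at P F" by blast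
    show "(\<lambda>p. u p * w p) \<in> {u. \<exists>P. homogeneous (m + n) P \<and> (\<forall>F\<in>Sym_pow 4. u F = eval_at P F)}"
      by (intro CollectI exI[of _ "P * R"]) (use P R in \<open>auto simp: eval_at_def eval_poly_mult[OF h] homogeneous_mult\<close>) }
qed

text \<open>Only values at fixed matrices \<open>z\<close> enter; each is of degree \<open>d\<close>
  in \<open>F\<close>, because the coefficients of \<open>F \<circ> z\<close> are linear in those of
  \<open>F\<close>.\<close>

lemma homogeneous_map_reynolds:
  assumes "\<And>l. homogeneous d (q l)"
  shows "homogeneous_map (reynolds N k q :: (3, 'k::field) mpoly \<Rightarrow> 'k^3)"
proof -
  define T where "T = (\<lambda>d. {u :: (3, 'k) mpoly \<Rightarrow> 'k. \<exists>P. homogeneous d P \<and> (\<forall>F\<in>Sym_pow 4. u F = eval_at P F)})"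
  interpret graded_functions T unfolding T_def by (rule graded_form_values)
  have h: "semiring_hom (\<lambda>c :: 'k. c)" by (rule semiring_hom_id)
  have lin: "(\<lambda>F. lookup (substitute z F) \<beta>) \<in> T 1" for z \<beta>
  proof -
    let ?P = "\<Sum>\<alpha>\<in>set exps4. const (lookup (substitute z (single \<alpha> 1)) \<beta>) * var \<alpha>"
    have "homogeneous 1 ?P" using homogeneous_mult[OF homogeneous_const homogeneous_var] by (intro homogeneous_sum) auto
    moreover have "lookup (substitute z F) \<beta> = eval_at ?P F" if "F \<in> Sym_pow 4" for F
      unfolding substitute_linear[OF that] eval_at_def
      by (simp add: eval_poly_sum[OF h] eval_poly_mult[OF h] eval_poly_const[OF h] eval_poly_var[OF h])
    ultimately show ?thesis unfolding T_def by blast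
  qed
  have ev: "(\<lambda>F. eval_at (q l) (substitute z F)) \<in> T d" for z l
    using eval_homogeneous[OF assms lin] unfolding eval_at_def by simp
  have "(\<lambda>F. reynolds N k q F $ i) \<in> T d" for i
    unfolding reynolds_def cayley_def polarization_def vec_lambda_beta
    by (intro sum scale ev)
  then have "\<exists>P. homogeneous d P \<and> (\<forall>F\<in>Sym_pow 4. reynolds N k q F $ i = eval_at P F)" for i
    unfolding T_def by blast
  then obtain P where "\<And>i. homogeneous d (P i) \<and> (\<forall>F\<in>Sym_pow 4. reynolds N k q F $ i = eval_at (P i) F)" by metis
  then show ?thesis unfolding homogeneous_map_def by blast
qed

text \<open>With \<open>h\<close> the inverse of \<open>g\<close>, the vector
  \<open>z q((act g F) \<circ> z)\<close> equals \<open>g\<close> applied to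
  \<open>(h z) q(F \<circ> (h z))\<close>. The constant matrix \<open>g\<close> comes out by
  linearity, and \<open>cayley_translate\<close> removes the factor \<open>h\<close>, since
  \<open>deg\<close> puts the integrand in degree \<open>3 * N\<close>.\<close>

lemma contravariant_reynolds:
  fixes q :: "3 \<Rightarrow> (3 \<Rightarrow>\<^sub>0 nat, 'k::field) mpoly"
  assumes q: "\<And>l. homogeneous d (q l)" and deg: "3 * k + (4 * d + 1) = 3 * N"
  shows "contravariant (reynolds N k q)"
  unfolding contravariant_def
proof (intro conjI ballI)
  show "homogeneous_map (reynolds N k q)" by (rule homogeneous_map_reynolds[OF q])
  fix g :: "'k^3^3" and F :: "(3, 'k) mpoly"
  assume g: "g \<in> SL3" and F: "F \<in> Sym_pow 4"
  let ?h = "matrix_inv g"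
  let ?S = "\<lambda>i z. \<Sum>l\<in>UNIV. z $ i $ l * eval_at (q l) (substitute z F)"
  have dh: "det ?h = 1" using matrix_inv_SL3(1)[OF g] by (simp add: SL3_def)
  have G: "matrix_form (3 * N) (\<lambda>z. det z ^ k * ?S i z)" for i
    using matrix_form_mult[OF matrix_form_det_power matrix_form_integrand[OF q F], of k] unfolding deg .
  have "det z ^ k * (\<Sum>l\<in>UNIV. z $ i $ l * eval_at (q l) (substitute z (substitute ?h F)))
    = (\<Sum>m\<in>UNIV. g $ i $ m * (det (?h ** z) ^ k * ?S m (?h ** z)))" for i and z :: "'k^3^3"
  proof -
    have "z = g ** (?h ** z)" using matrix_inv_SL3(3)[OF g] by (simp add: matrix_mul_assoc)
    then have "z $ i $ l = (g ** (?h ** z)) $ i $ l" for l by (rule arg_cong)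
    then have "z $ i $ l = (\<Sum>m\<in>UNIV. g $ i $ m * (?h ** z) $ m $ l)" for l
      by (simp only: matrix_matrix_mult_def[of g "?h ** z"] vec_lambda_beta)
    then have "(\<Sum>l\<in>UNIV. z $ i $ l * eval_at (q l) (substitute (?h ** z) F))
      = (\<Sum>l\<in>UNIV. \<Sum>m\<in>UNIV. g $ i $ m * ((?h ** z) $ m $ l * eval_at (q l) (substitute (?h ** z) F)))"
      by (simp add: sum_distrib_right mult.assoc)
    also have "\<dots> = (\<Sum>m\<in>UNIV. g $ i $ m * ?S m (?h ** z))"
      by (subst sum.swap) (simp add: sum_distrib_left)
    finally show ?thesis
      by (simp add: substitute_substitute det_mul dh sum_distrib_left mult.left_commute)
  qed
  then have "reynolds N k q (act g F) $ i = (\<Sum>m\<in>UNIV. g $ i $ m * cayley N (\<lambda>z. det (?h ** z) ^ k * ?S m (?h ** z)))" for i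
    unfolding reynolds_def act_eq_substitute by (simp add: cayley_sum cayley_scale)
  also have "(\<Sum>m\<in>UNIV. g $ i $ m * cayley N (\<lambda>z. det (?h ** z) ^ k * ?S m (?h ** z)))
    = (g *v reynolds N k q F) $ i" for i
    using cayley_translate[OF G dh] by (simp add: matrix_vector_mult_def reynolds_def)
  finally show "reynolds N k q (act g F) = g *v reynolds N k q F" by (simp add: vec_eq_iff)
qed

section \<open>Cube roots of unity and the span of the contravariants\<close>

lemma cube_root_unity:
  obtains \<omega> :: "'k::{alg_closed_field, field_char_0}" where "\<omega> ^ 3 = 1" "1 + \<omega> + \<omega> ^ 2 = 0"
proof -
  obtain \<omega> :: 'k where "poly [:1, 1, 1:] \<omega> = 0" using alg_closed_imp_poly_has_root[of "[:1, 1, 1:] :: 'k poly"] by auto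
  then have *: "1 + \<omega> + \<omega> ^ 2 = 0" by (simp add: power2_eq_square algebra_simps)
  have "\<omega> ^ 3 - 1 = (\<omega> - 1) * (1 + \<omega> + \<omega> ^ 2)" by (simp add: power2_eq_square power3_eq_cube algebra_simps)
  then show ?thesis using that * by simp
qed

text \<open>Summing over the cube roots of unity selects the exponents divisible by 3.\<close>

lemma cube_root_filter:
  assumes "\<omega> ^ 3 = 1" "1 + \<omega> + \<omega> ^ 2 = (0 :: 'k::field)"
  shows "1 + \<omega> ^ e + (\<omega> ^ 2) ^ e = (if 3 dvd e then 3 else 0)"
proof -
  define m r where "m = e div 3" and "r = e mod 3"
  have e: "e = 3 * m + r" by (simp add: m_def r_def)
  have 1: "\<omega> ^ e = \<omega> ^ r" "(\<omega> ^ 2) ^ e = (\<omega> ^ 2) ^ r"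
  proof -
    have "(\<omega> ^ 2) ^ 3 = (\<omega> ^ 3) ^ 2" by (simp add: power_mult[symmetric])
    then show "\<omega> ^ e = \<omega> ^ r" "(\<omega> ^ 2) ^ e = (\<omega> ^ 2) ^ r"
      using assms(1) by (simp_all only: e power_add power_mult[of _ 3 m] power_one mult_1)
  qed
  have d: "3 dvd e \<longleftrightarrow> r = 0" by (auto simp: r_def)
  have "r = 0 \<or> r = 1 \<or> r = 2" unfolding r_def by linarith
  moreover have "(\<omega> ^ 2) ^ 2 = \<omega>"
  proof -
    have "(\<omega> ^ 2) ^ 2 = \<omega> ^ 3 * \<omega>" by (simp add: power2_eq_square power3_eq_cube)
    then show ?thesis using assms by simp
  qed
  ultimately show ?thesis using assms(2) unfolding 1 d by (auto simp: add_ac)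
qed

context closed_free_orbit
begin

text \<open>By Cramer's rule, the entries of the inverse are determinants on SL3, hence matrix
  polynomials.\<close>

lemma inverse_entry_on_orbit:
  obtains P where "\<And>h. h \<in> SL3 \<Longrightarrow> matrix_inv h $ i $ j = eval_at P (substitute h f)"
proof -
  let ?M = "\<lambda>h :: 'k^3^3. \<chi> a b. if b = i then (if a = j then 1 else 0) else h $ a $ b"
  have "(\<lambda>h. ?M h $ a $ b) \<in> matrix_polys" for a b
    using coord_matrix_polys[of a b] fn.subalgebraD(2,3)[OF subalgebra_matrix_polys]
    by (cases "b = i"; cases "a = j") (auto simp: coord_def)
  then have m: "(\<lambda>h. det (?M h)) \<in> matrix_polys"
    by (rule graded_det[OF graded_constant[OF subalgebra_matrix_polys]])
  obtain P where P: "\<And>h. h \<in> SL3 \<Longrightarrow> det (?M h) = eval_at P (substitute h f)"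
    by (rule matrix_poly_on_orbit[OF m]) (rule that; blast)
  have "matrix_inv h $ i $ j = det (?M h)" if h: "h \<in> SL3" for h
  proof -
    have "h *v (matrix_inv h *v axis j 1) = axis j 1"
      using matrix_inv_SL3(3)[OF h] by (simp add: matrix_vector_mul_assoc)
    moreover have "det h \<noteq> 0" using h by (simp add: SL3_def)
    ultimately have "matrix_inv h *v axis j 1 = (\<chi> k. det (\<chi> a b. if b = k then axis j 1 $ a else h $ a $ b) / det h)"
      using cramer by blast
    then have "(matrix_inv h *v axis j 1) $ i = det (\<chi> a b. if b = i then axis j 1 $ a else h $ a $ b) / det h"
      by (simp only: vec_lambda_beta)
    also have "\<dots> = det (?M h)" using h by (simp add: SL3_def axis_def[of j] cong: if_cong)
    finally have "(matrix_inv h *v axis j 1) $ i = det (?M h)" .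
    moreover have "(matrix_inv h *v axis j 1) $ i = matrix_inv h $ i $ j"
      by (simp add: matrix_vector_mult_def axis_def if_distrib[of "\<lambda>c. _ * c"] cong: if_cong)
    ultimately show ?thesis by simp
  qed
  then show ?thesis using that[of P] P by simp
qed

text \<open>The polynomials \<open>P\<close> give column \<open>j\<close> of the inverse, so
  \<open>z P(f \<circ> z)\<close> is the basis vector for \<open>z\<close> in SL3. Made homogeneous
  in \<open>z\<close> by powers of \<open>det z\<close>, this becomes an identity on all matrices;
  Cayley's operator turns one side into values of contravariants and the other into a nonzero
  multiple of the basis vector.\<close>

lemma axis_in_span: "axis j 1 \<in> vec.span {p f |p. contravariant p}"
proof -
  have "\<forall>i. \<exists>P. \<forall>h\<in>SL3. matrix_inv h $ i $ j = eval_at P (substitute h f)"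
    using inverse_entry_on_orbit by metis
  then obtain P where P: "\<And>i h. h \<in> SL3 \<Longrightarrow> matrix_inv h $ i $ j = eval_at (P i) (substitute h f)" by metis
  obtain D where D: "\<And>i \<alpha>. \<alpha> \<in> keys (P i) \<Longrightarrow> expdeg \<alpha> < D"
  proof -
    have "finite (\<Union>i. expdeg ` keys (P i))" by auto
    then obtain D where "\<forall>d\<in>(\<Union>i. expdeg ` keys (P i)). d < D" using finite_nat_set_iff_bounded by blast
    then show thesis using that[of D] by blast
  qed
  define q where "q = (\<lambda>d l. homogeneous_part d (P l))"
  have q: "homogeneous d (q d l)" for d l by (simp add: q_def homogeneous_homogeneous_part)
  define S where "S = (\<lambda>d i z. \<Sum>l\<in>UNIV. z $ i $ l * eval_at (q d l) (substitute z f))"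
  have S_scale: "S d i (\<chi> a b. u * z $ a $ b) = u ^ (4 * d + 1) * S d i z" for d i u z
    unfolding S_def by (rule matrix_form_homogeneous[OF matrix_form_integrand[OF q f4]])
  have S_SL3: "(\<Sum>d<D. S d i z) = (if i = j then 1 else 0)" if z: "z \<in> SL3" for i z
  proof -
    have "(\<Sum>d<D. S d i z) = (\<Sum>l\<in>UNIV. z $ i $ l * (\<Sum>d<D. eval_at (q d l) (substitute z f)))"
      unfolding S_def by (subst sum.swap) (simp add: sum_distrib_left)
    also have "\<dots> = (\<Sum>l\<in>UNIV. z $ i $ l * matrix_inv z $ l $ j)"
    proof (intro sum.cong refl arg_cong2[where f = "(*)"])
      fix l
      have "eval_at (P l) (substitute z f) = eval_at (\<Sum>d<D. q d l) (substitute z f)"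
        using sum_homogeneous_part[of "P l" D, OF D] by (simp add: q_def)
      then show "(\<Sum>d<D. eval_at (q d l) (substitute z f)) = matrix_inv z $ l $ j"
        using P[OF z] by (simp add: eval_at_def eval_poly_sum[OF semiring_hom_id])
    qed
    also have "\<dots> = (z ** matrix_inv z) $ i $ j" by (simp add: matrix_matrix_mult_def)
    also have "\<dots> = (if i = j then 1 else 0)" using matrix_inv_SL3(3)[OF z] by (simp add: mat_def)
    finally show ?thesis .
  qed
  \<comment> \<open>Larger than every \<open>p d\<close>, and strictly so, in order that both sides
    of \<open>main\<close> vanish where \<open>det z = 0\<close>.\<close>
  define N where "N = 4 * D + 1"
  define p where "p = (\<lambda>d :: nat. (4 * d + 1) div 3)"
  \<comment> \<open>The parts whose degree \<open>4 * d + 1\<close> in \<open>z\<close> is that of a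
    power of \<open>det z\<close>.\<close>
  define Ds where "Ds = {d. d < D \<and> 3 dvd 4 * d + 1}"
  have [simp]: "finite Ds" by (simp add: Ds_def)
  have p: "3 * p d = 4 * d + 1" "p d < N" if "d \<in> Ds" for d
    using that by (auto simp: p_def Ds_def N_def)
  obtain \<omega> :: 'k where \<omega>: "\<omega> ^ 3 = 1" "1 + \<omega> + \<omega> ^ 2 = 0" by (rule cube_root_unity)
  \<comment> \<open>Singular \<open>z\<close> are included because \<open>cayley\<close> evaluates
    at sums of elementary matrices.\<close>
  have main: "(\<Sum>d\<in>Ds. det z ^ (N - p d) * S d i z) = det z ^ N * (if i = j then 1 else 0)" for i z
  proof (cases "det z = 0")
    case True
    then show ?thesis using p by (auto simp: N_def intro!: sum.neutral)
  next
    case False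
    have A: "(\<Sum>d<D. u ^ (4 * d + 1) * S d i z) = (if i = j then 1 else 0)" if u: "u ^ 3 * det z = 1" for u
    proof -
      have "det (\<chi> a b. u * z $ a $ b) = u ^ 3 * det z"
        by (simp add: det_3 power3_eq_cube algebra_simps)
      then have "(\<chi> a b. u * z $ a $ b) \<in> SL3" using u by (simp add: SL3_def)
      from S_SL3[OF this] show ?thesis by (simp add: S_scale)
    qed
    obtain u where u: "u ^ 3 = 1 / det z" using nth_root_exists[of 3 "1 / det z"] by auto
    have u1: "u ^ 3 * det z = 1" "(\<omega> * u) ^ 3 * det z = 1" "(\<omega> ^ 2 * u) ^ 3 * det z = 1"
    proof -
      have "(\<omega> ^ 2) ^ 3 = (\<omega> ^ 3) ^ 2" by (simp add: power_mult[symmetric])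
      then show "u ^ 3 * det z = 1" "(\<omega> * u) ^ 3 * det z = 1" "(\<omega> ^ 2 * u) ^ 3 * det z = 1"
        using u \<omega> False by (simp_all add: power_mult_distrib)
    qed
    have "3 * (if i = j then 1 else 0) = (\<Sum>d<D. u ^ (4 * d + 1) * S d i z)
      + (\<Sum>d<D. (\<omega> * u) ^ (4 * d + 1) * S d i z) + (\<Sum>d<D. (\<omega> ^ 2 * u) ^ (4 * d + 1) * S d i z)"
      unfolding A[OF u1(1)] A[OF u1(2)] A[OF u1(3)] by simp
    also have "\<dots> = (\<Sum>d<D. (1 + \<omega> ^ (4 * d + 1) + (\<omega> ^ 2) ^ (4 * d + 1)) * (u ^ (4 * d + 1) * S d i z))"
      by (simp only: sum.distrib[symmetric] power_mult_distrib distrib_right mult_1 mult.assoc)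
    also have "\<dots> = (\<Sum>d<D. if 3 dvd 4 * d + 1 then 3 * (u ^ (4 * d + 1) * S d i z) else 0)"
      unfolding cube_root_filter[OF \<omega>] by (intro sum.cong refl) auto
    also have "\<dots> = (\<Sum>d\<in>{d \<in> {..<D}. 3 dvd 4 * d + 1}. 3 * (u ^ (4 * d + 1) * S d i z))"
      by (rule sum.inter_filter[symmetric]) simp
    also have "\<dots> = 3 * (\<Sum>d\<in>Ds. u ^ (4 * d + 1) * S d i z)"
      by (simp only: sum_distrib_left Ds_def lessThan_iff)
    finally have "(\<Sum>d\<in>Ds. u ^ (4 * d + 1) * S d i z) = (if i = j then 1 else 0)" by simp
    then have "det z ^ N * (if i = j then 1 else 0) = (\<Sum>d\<in>Ds. det z ^ N * (u ^ (4 * d + 1) * S d i z))"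
      by (simp only: sum_distrib_left[symmetric])
    also have "\<dots> = (\<Sum>d\<in>Ds. det z ^ (N - p d) * S d i z)"
    proof (intro sum.cong refl)
      fix d assume d: "d \<in> Ds"
      have "det z ^ N * u ^ (4 * d + 1) = det z ^ (N - p d) * (det z ^ p d * (u ^ 3) ^ p d)"
        using p[OF d] by (simp add: power_add[symmetric] power_mult[symmetric])
      also have "det z ^ p d * (u ^ 3) ^ p d = (u ^ 3 * det z) ^ p d" by (simp add: power_mult_distrib)
      finally show "det z ^ N * (u ^ (4 * d + 1) * S d i z) = det z ^ (N - p d) * S d i z"
        using u1(1) by (simp add: mult.assoc[symmetric])
    qed
    finally show ?thesis by simp
  qed
  define c where "c = cayley N (\<lambda>z. det z ^ N :: 'k)"
  have c: "c \<noteq> 0" unfolding c_def by (rule cayley_det_power)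
  let ?r = "\<lambda>d. reynolds N (N - p d) (q d)"
  have "(\<Sum>d\<in>Ds. ?r d f $ i) = c * (if i = j then 1 else 0)" for i
  proof -
    have "(\<Sum>d\<in>Ds. ?r d f $ i) = cayley N (\<lambda>z. \<Sum>d\<in>Ds. det z ^ (N - p d) * S d i z)"
      by (simp add: reynolds_def S_def cayley_sum)
    also have "\<dots> = cayley N (\<lambda>z. (if i = j then 1 else 0) * det z ^ N)"
      unfolding main by (simp add: mult.commute)
    finally show ?thesis unfolding cayley_scale c_def by (simp add: mult.commute)
  qed
  then have "axis j 1 = (1 / c) *s (\<Sum>d\<in>Ds. ?r d f)"
    using c by (auto simp: vec_eq_iff axis_def)
  also have "\<dots> \<in> vec.span {p f |p. contravariant p}"
  proof (intro vec.span_scale vec.span_sum vec.span_base CollectI exI conjI)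
    show "contravariant (?r d)" if "d \<in> Ds" for d
      by (rule contravariant_reynolds[OF q]) (use p[OF that] in auto)
  qed (rule refl)
  finally show ?thesis .
qed

lemma independent_contravariants:
  "\<exists>p :: 3 \<Rightarrow> (3, 'k) mpoly \<Rightarrow> 'k^3. (\<forall>i. contravariant (p i)) \<and> independent_at p f"
proof -
  let ?U = "{p f |p. contravariant p}"
  have "cart_basis \<subseteq> vec.span ?U" using axis_in_span by (auto simp: cart_basis_def)
  then have "vec.span cart_basis \<subseteq> vec.span ?U" by (rule vec.span_minimal[OF _ vec.subspace_span])
  then have "vec.span ?U = UNIV" by (simp add: top.extremum_unique)
  then have "vec.dim ?U = vec.dim (UNIV :: ('k^3) set)" using vec.dim_span[of ?U] by simp
  then have dim: "vec.dim ?U = CARD(3)" by (simp only: vec.dim_UNIV card_cart_basis)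
  obtain B where B: "B \<subseteq> ?U" "vec.independent B" "?U \<subseteq> vec.span B" "card B = vec.dim ?U"
    by (rule vec.basis_exists)
  then have "card B = CARD(3)" using dim by simp
  moreover have "finite B" using B(2) vec.finiteI_independent by blast
  ultimately obtain b where b: "bij_betw b (UNIV :: 3 set) B"
    using finite_same_card_bij[of "UNIV :: 3 set" B] by auto
  then have "\<forall>i. \<exists>p. contravariant p \<and> b i = p f" using B(1) by (fastforce simp: bij_betw_def)
  then obtain p where p: "\<And>i. contravariant (p i)" "\<And>i. b i = p i f" by metis
  have "independent_at p f"
    using b B(2) by (simp add: independent_at_def p(2)[symmetric] bij_betw_def eta_contract_eq)
  then show ?thesis using p by blast
qed

end

section \<open>The polarised form\<close>

lemma pdiff_superset:
  assumes "finite A" "keys P \<subseteq> A"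
  shows "pdiff i P = (\<Sum>\<alpha>\<in>A. single (\<alpha> - single i 1) (of_nat (lookup \<alpha> i) * lookup P \<alpha>))"
  unfolding pdiff_def using assms by (intro sum.mono_neutral_left) (auto simp: in_keys_iff)

lemma pdiff_0 [simp]: "pdiff i 0 = 0"
  by (simp add: pdiff_def)

lemma pdiff_add: "pdiff i (P + Q) = pdiff i P + pdiff i Q"
  using keys_add[of P Q]
  by (simp add: pdiff_superset[of "keys P \<union> keys Q"] lookup_add distrib_left single_add sum.distrib)

lemma pdiff_single: "pdiff i (single \<alpha> c) = single (\<alpha> - single i 1) (of_nat (lookup \<alpha> i) * c)"
  by (subst pdiff_superset[of "{\<alpha>}"]) auto

text \<open>Agreement is asked only at the terms of \<open>P\<close> itself, so that
  \<open>euler\<close> can use the degree of each of them.\<close>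

lemma additive_eqI:
  fixes L L' :: "('x \<Rightarrow>\<^sub>0 'k::comm_monoid_add) \<Rightarrow> 'b::comm_monoid_add"
  assumes "\<And>P Q. L (P + Q) = L P + L Q" "\<And>P Q. L' (P + Q) = L' P + L' Q" "L 0 = 0" "L' 0 = 0"
    and "\<And>\<alpha>. \<alpha> \<in> keys P \<Longrightarrow> L (single \<alpha> (lookup P \<alpha>)) = L' (single \<alpha> (lookup P \<alpha>))"
  shows "L P = L' P"
proof -
  have "L (sum u I) = (\<Sum>x\<in>I. L (u x))" "L' (sum u I) = (\<Sum>x\<in>I. L' (u x))" for u and I :: "'x set"
    by (induction I rule: infinite_finite_induct) (auto simp: assms)
  then have "L (\<Sum>\<alpha>\<in>keys P. single \<alpha> (lookup P \<alpha>)) = L' (\<Sum>\<alpha>\<in>keys P. single \<alpha> (lookup P \<alpha>))"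
    using assms(5) by simp
  then show ?thesis by (simp only: poly_mapping_sum_single[symmetric])
qed

lemma const_mult_single: "const c * single \<alpha> d = single \<alpha> (c * d)"
  by (simp add: const_def mult_single)

lemma var_mult_single: "var i * single \<alpha> (d :: 'k::comm_semiring_1) = single (single i 1 + \<alpha>) d"
  by (simp add: var_def mult_single)

lemma pdiff_const_mult: "pdiff i (const c * P) = const c * pdiff i P"
  by (rule additive_eqI[of "\<lambda>P. pdiff i (const c * P)" "\<lambda>P. const c * pdiff i P"])
     (auto simp: distrib_left pdiff_add const_mult_single pdiff_single mult_ac)

lemma pdiff_commute: "pdiff i (pdiff j P) = pdiff j (pdiff i P)"
proof (rule additive_eqI[of "\<lambda>P. pdiff i (pdiff j P)" "\<lambda>P. pdiff j (pdiff i P)"])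
  fix \<alpha> :: "'a \<Rightarrow>\<^sub>0 nat"
  show "pdiff i (pdiff j (single \<alpha> (lookup P \<alpha>))) = pdiff j (pdiff i (single \<alpha> (lookup P \<alpha>)))"
  proof (cases "i = j")
    case False
    have "\<alpha> - single j 1 - single i 1 = \<alpha> - single i 1 - single j (1 :: nat)"
      by (rule poly_mapping_eqI) (simp add: lookup_minus)
    then show ?thesis using False by (simp add: pdiff_single lookup_minus lookup_single when_def mult_ac)
  qed simp
qed (auto simp: pdiff_add)

lemma homogeneous_pdiff:
  assumes "homogeneous (Suc d) P"
  shows "homogeneous d (pdiff i P)"
  unfolding pdiff_def
proof (rule homogeneous_sum)
  fix \<alpha> assume "\<alpha> \<in> keys P"
  then have e: "expdeg \<alpha> = Suc d" using assms by (simp add: homogeneous_def)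
  show "homogeneous d (single (\<alpha> - single i 1) (of_nat (lookup \<alpha> i) * lookup P \<alpha>))"
  proof (cases "lookup \<alpha> i = 0")
    case False
    then have "single i 1 + (\<alpha> - single i 1) = \<alpha>"
      by (intro poly_mapping_eqI) (auto simp: lookup_add lookup_minus lookup_single when_def)
    then have "expdeg \<alpha> = 1 + expdeg (\<alpha> - single i 1)" using expdeg_add[of "single i 1" "\<alpha> - single i 1"] by simp
    then show ?thesis using e by (auto simp: homogeneous_def)
  qed simp
qed

lemma euler:
  fixes P :: "('x::finite, 'k::comm_semiring_1) mpoly"
  assumes "homogeneous d P"
  shows "(\<Sum>i\<in>UNIV. var i * pdiff i P) = of_nat d * P"
proof (rule additive_eqI[of "\<lambda>P. \<Sum>i\<in>UNIV. var i * pdiff i P" "\<lambda>P. of_nat d * P"])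
  fix \<alpha> assume "\<alpha> \<in> keys P"
  then have e: "(\<Sum>i\<in>UNIV. lookup \<alpha> i) = d"
    using assms expdeg_superset[of UNIV \<alpha>] by (auto simp: homogeneous_def)
  have "var i * pdiff i (single \<alpha> c) = single \<alpha> (of_nat (lookup \<alpha> i) * c)" for i and c :: 'k
  proof (cases "lookup \<alpha> i = 0")
    case False
    then have "single i 1 + (\<alpha> - single i 1) = \<alpha>"
      by (intro poly_mapping_eqI) (auto simp: lookup_add lookup_minus lookup_single when_def)
    then show ?thesis by (simp add: pdiff_single var_mult_single)
  qed (simp add: pdiff_single)
  then have "(\<Sum>i\<in>UNIV. var i * pdiff i (single \<alpha> (lookup P \<alpha>))) = single \<alpha> (\<Sum>i\<in>UNIV. of_nat (lookup \<alpha> i) * lookup P \<alpha>)"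
    by (intro poly_mapping_eqI) (simp add: lookup_sum lookup_single when_def)
  also have "(\<Sum>i\<in>UNIV. of_nat (lookup \<alpha> i) * lookup P \<alpha>) = of_nat d * lookup P \<alpha>"
    by (simp only: sum_distrib_right[symmetric] of_nat_sum[symmetric] e)
  finally show "(\<Sum>i\<in>UNIV. var i * pdiff i (single \<alpha> (lookup P \<alpha>))) = of_nat d * single \<alpha> (lookup P \<alpha>)"
    by (simp add: single_of_nat[symmetric] mult_single del: single_of_nat)
qed (auto simp: distrib_left pdiff_add sum.distrib)

definition dir_deriv :: "'k::comm_semiring_1^3 \<Rightarrow> (3, 'k) mpoly \<Rightarrow> (3, 'k) mpoly" where
  "dir_deriv v P = (\<Sum>a\<in>UNIV. const (v $ a) * pdiff a P)"

lemma homogeneous_dir_deriv: "homogeneous (Suc d) P \<Longrightarrow> homogeneous d (dir_deriv v P)"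
  unfolding dir_deriv_def using homogeneous_mult[OF homogeneous_const homogeneous_pdiff]
  by (intro homogeneous_sum) fastforce

definition mono_deriv :: "(3 \<Rightarrow>\<^sub>0 nat) \<Rightarrow> (3, 'k::comm_semiring_1) mpoly \<Rightarrow> (3, 'k) mpoly" where
  "mono_deriv \<alpha> P = (pdiff 0 ^^ lookup \<alpha> 0) ((pdiff 1 ^^ lookup \<alpha> 1) ((pdiff 2 ^^ lookup \<alpha> 2) P))"

lemma D_op_superset:
  assumes "finite A" "keys Q \<subseteq> A"
  shows "D_op Q P = (\<Sum>\<alpha>\<in>A. const (lookup Q \<alpha>) * mono_deriv \<alpha> P)"
  unfolding D_op_def mono_deriv_def using assms
  by (intro sum.mono_neutral_left) (auto simp: in_keys_iff const_def)

lemma D_op_0 [simp]: "D_op 0 P = 0"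
  by (simp add: D_op_def)

lemma D_op_add: "D_op (Q + R) P = D_op Q P + D_op R P"
  using keys_add[of Q R]
  by (simp add: D_op_superset[of "keys Q \<union> keys R"] lookup_add sum.distrib distrib_right semiring_homD[OF semiring_hom_const])

lemma D_op_sum: "D_op (sum u I) P = (\<Sum>x\<in>I. D_op (u x) P)"
  by (induction I rule: infinite_finite_induct) (auto simp: D_op_add)

lemma D_op_single: "D_op (single \<alpha> c) P = const c * mono_deriv \<alpha> P"
  by (subst D_op_superset[of "{\<alpha>}"]) auto

lemma D_op_1: "D_op 1 P = P"
proof -
  have "D_op (single 0 1) P = P"
    unfolding D_op_single by (simp add: mono_deriv_def semiring_homD[OF semiring_hom_const])
  then show ?thesis by simp
qed

lemma D_op_const_mult: "D_op (const c * Q) P = const c * D_op Q P"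
  by (rule additive_eqI[of "\<lambda>Q. D_op (const c * Q) P" "\<lambda>Q. const c * D_op Q P"])
     (auto simp: distrib_left D_op_add const_mult_single D_op_single semiring_homD[OF semiring_hom_const] mult_ac)

lemma funpow_commute: "(\<And>x. u (w x) = w (u x)) \<Longrightarrow> (u ^^ n) (w x) = w ((u ^^ n) x)"
  by (induction n) auto

text \<open>\<open>mono_deriv\<close> differentiates in a fixed order; a further derivative can be
  moved into its place because derivatives commute.\<close>

lemma mono_deriv_add_single: "mono_deriv (single a 1 + \<alpha>) P = pdiff a (mono_deriv \<alpha> P)"
proof -
  have c: "(pdiff i ^^ n) (pdiff j Q) = pdiff j ((pdiff i ^^ n) Q)" for i j n and Q :: "(3, 'a) mpoly"
    by (rule funpow_commute) (rule pdiff_commute)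
  have "a = 0 \<or> a = 1 \<or> a = 2" using exhaust_3[of a] by auto
  then show ?thesis by (auto simp: mono_deriv_def lookup_add lookup_single c)
qed

lemma D_op_var_mult: "D_op (var a * Q) P = pdiff a (D_op Q P)"
  by (rule additive_eqI[of "\<lambda>Q. D_op (var a * Q) P" "\<lambda>Q. pdiff a (D_op Q P)"])
     (auto simp: distrib_left D_op_add pdiff_add var_mult_single D_op_single mono_deriv_add_single[unfolded One_nat_def]
       pdiff_const_mult)

text \<open>Through \<open>D_op\<close> a product in the symmetric algebra acts as a composition of
  operators, so a product of vectors becomes an iterated directional derivative.\<close>

lemma D_op_vec_mult: "D_op (vec_to_Sym v * Q) P = dir_deriv v (D_op Q P)"
  by (simp add: vec_to_Sym_def sum_distrib_right D_op_sum mult.assoc D_op_const_mult D_op_var_mult dir_deriv_def)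

text \<open>Euler's identity read at the point \<open>M X\<close>, with the columns of
  \<open>M\<close> as directions; each application removes one of the sums in
  \<open>f_tilde\<close>.\<close>

lemma euler_substitute:
  assumes "homogeneous d P"
  shows "(\<Sum>i\<in>UNIV. substitute M (dir_deriv (column i M) P) * var i) = of_nat d * substitute M P"
proof -
  note sh = semiring_homD[OF semiring_hom_substitute]
  have "of_nat d * substitute M P = substitute M (\<Sum>a\<in>UNIV. var a * pdiff a P)"
    by (simp add: euler[OF assms] sh)
  also have "\<dots> = (\<Sum>a\<in>UNIV. \<Sum>i\<in>UNIV. const (M $ a $ i) * var i * substitute M (pdiff a P))"
    by (simp add: sh sum_distrib_right)
  also have "\<dots> = (\<Sum>i\<in>UNIV. \<Sum>a\<in>UNIV. const (M $ a $ i) * var i * substitute M (pdiff a P))"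
    by (rule sum.swap)
  also have "\<dots> = (\<Sum>i\<in>UNIV. substitute M (dir_deriv (column i M) P) * var i)"
    by (simp add: dir_deriv_def sh column_def sum_distrib_right sum_distrib_left mult_ac)
  finally show ?thesis by simp
qed

lemma substitute_homogeneous_0: "homogeneous 0 P \<Longrightarrow> substitute M P = P"
proof -
  assume P: "homogeneous 0 P"
  have "\<alpha> = 0" if "\<alpha> \<in> keys P" for \<alpha>
  proof (rule poly_mapping_eqI)
    fix i show "lookup \<alpha> i = lookup 0 i"
      using P that expdeg_superset[of UNIV \<alpha>] by (auto simp: homogeneous_def)
  qed
  then have "P = const (lookup P 0)"
    by (intro poly_mapping_eqI) (auto simp: const_def lookup_single when_def in_keys_iff)
  then show ?thesis by (metis substitute_const)
qed

lemma sum_reverse3: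
  fixes F :: "'i \<Rightarrow> 'i \<Rightarrow> 'i \<Rightarrow> 'b::comm_monoid_add"
  shows "(\<Sum>a\<in>A. \<Sum>b\<in>A. \<Sum>c\<in>A. F a b c) = (\<Sum>c\<in>A. \<Sum>b\<in>A. \<Sum>a\<in>A. F a b c)"
proof -
  have "(\<Sum>a\<in>A. \<Sum>b\<in>A. \<Sum>c\<in>A. F a b c) = (\<Sum>a\<in>A. \<Sum>c\<in>A. \<Sum>b\<in>A. F a b c)"
    by (intro sum.cong refl sum.swap)
  also have "\<dots> = (\<Sum>c\<in>A. \<Sum>a\<in>A. \<Sum>b\<in>A. F a b c)" by (rule sum.swap)
  also have "\<dots> = (\<Sum>c\<in>A. \<Sum>b\<in>A. \<Sum>a\<in>A. F a b c)" by (intro sum.cong refl sum.swap)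
  finally show ?thesis .
qed

lemma sum_reverse4:
  fixes F :: "'i \<Rightarrow> 'i \<Rightarrow> 'i \<Rightarrow> 'i \<Rightarrow> 'b::comm_monoid_add"
  shows "(\<Sum>a\<in>A. \<Sum>b\<in>A. \<Sum>c\<in>A. \<Sum>d\<in>A. F a b c d) = (\<Sum>d\<in>A. \<Sum>c\<in>A. \<Sum>b\<in>A. \<Sum>a\<in>A. F a b c d)"
proof -
  have "(\<Sum>a\<in>A. \<Sum>b\<in>A. \<Sum>c\<in>A. \<Sum>d\<in>A. F a b c d) = (\<Sum>a\<in>A. \<Sum>d\<in>A. \<Sum>c\<in>A. \<Sum>b\<in>A. F a b c d)"
    by (intro sum.cong refl sum_reverse3)
  also have "\<dots> = (\<Sum>d\<in>A. \<Sum>a\<in>A. \<Sum>c\<in>A. \<Sum>b\<in>A. F a b c d)" by (rule sum.swap)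
  also have "\<dots> = (\<Sum>d\<in>A. \<Sum>c\<in>A. \<Sum>a\<in>A. \<Sum>b\<in>A. F a b c d)" by (intro sum.cong refl sum.swap)
  also have "\<dots> = (\<Sum>d\<in>A. \<Sum>c\<in>A. \<Sum>b\<in>A. \<Sum>a\<in>A. F a b c d)" by (intro sum.cong refl sum.swap)
  finally show ?thesis .
qed

text \<open>The fourth derivatives are constant, so substituting in them changes nothing; then
  Euler's identity in degrees 1, 2, 3, 4 contributes the factors of 24. The order of summation is
  reversed first, as the index of the derivative taken last has to be summed first.\<close>

lemma f_tilde_eq_substitute:
  assumes f: "f \<in> Sym_pow 4"
  shows "f_tilde p f = const 24 * substitute (\<chi> a i. p i f $ a) f"
proof -
  define M where "M = (\<chi> a i. p i f $ a)"
  let ?d = "\<lambda>i. dir_deriv (column i M)" and ?s = "substitute M"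
  have col: "column i M = p i f" for i by (simp add: column_def M_def vec_eq_iff)
  have h4: "homogeneous 4 f" using f by (simp add: Sym_pow_def)
  have h3: "homogeneous 3 (?d d f)" for d using homogeneous_dir_deriv[of 3 f "column d M"] h4 by simp
  have h2: "homogeneous 2 (?d c (?d d f))" for c d using homogeneous_dir_deriv[of 2 "?d d f" "column c M"] h3[of d] by (simp add: eval_nat_numeral)
  have h1: "homogeneous 1 (?d b (?d c (?d d f)))" for b c d using homogeneous_dir_deriv[of 1 "?d c (?d d f)" "column b M"] h2[of c d] by (simp add: eval_nat_numeral)
  have h0: "homogeneous 0 (?d a (?d b (?d c (?d d f))))" for a b c d using homogeneous_dir_deriv[of 0 "?d b (?d c (?d d f))" "column a M"] h1[of b c d] by (simp add: eval_nat_numeral)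
  have euler_scaled: "(\<Sum>i\<in>UNIV. (k * ?s (?d i P)) * var i) = k * of_nat d * ?s P" if "homogeneous d P" for k d P
    by (simp only: mult.assoc euler_substitute[OF that, symmetric] sum_distrib_left)
  have "f_tilde p f = (\<Sum>a\<in>UNIV. \<Sum>b\<in>UNIV. \<Sum>c\<in>UNIV. \<Sum>d\<in>UNIV.
      ?d a (?d b (?d c (?d d f))) * (var a * var b * var c * var d))"
  proof -
    have "D_op (vec_to_Sym v1 * vec_to_Sym v2 * vec_to_Sym v3 * vec_to_Sym v4) f =
      dir_deriv v1 (dir_deriv v2 (dir_deriv v3 (dir_deriv v4 f)))" for v1 v2 v3 v4
      using D_op_vec_mult[of v4 1 f] by (simp add: mult.assoc D_op_vec_mult D_op_1)
    then show ?thesis unfolding f_tilde_def col by simp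
  qed
  also have "\<dots> = (\<Sum>d\<in>UNIV. \<Sum>c\<in>UNIV. \<Sum>b\<in>UNIV. \<Sum>a\<in>UNIV.
      ?d a (?d b (?d c (?d d f))) * (var a * var b * var c * var d))" by (rule sum_reverse4)
  also have "\<dots> = (\<Sum>d\<in>UNIV. (\<Sum>c\<in>UNIV. (\<Sum>b\<in>UNIV. (\<Sum>a\<in>UNIV.
      ?s (?d a (?d b (?d c (?d d f)))) * var a) * var b) * var c) * var d)"
    by (simp add: substitute_homogeneous_0[OF h0] sum_distrib_left sum_distrib_right mult_ac)
  also have "\<dots> = of_nat 1 * of_nat 2 * of_nat 3 * of_nat 4 * ?s f"
    by (simp only: euler_substitute[OF h1] euler_scaled[OF h2] euler_scaled[OF h3] euler_scaled[OF h4])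
  also have "\<dots> = const 24 * ?s f"
  proof -
    have "const (of_nat 24 :: 'a) = (of_nat 24 :: (3, 'a) mpoly)" by (rule semiring_homD(8)[OF semiring_hom_const])
    then have "const (24 :: 'a) = (of_nat (1 * 2 * 3 * 4) :: (3, 'a) mpoly)" by simp
    then show ?thesis by (simp only: of_nat_mult)
  qed
  finally show ?thesis by (simp add: M_def)
qed

lemma substitute_scale:
  assumes "homogeneous d F"
  shows "substitute (\<chi> i j. c * h $ i $ j) F = const (c ^ d) * substitute h F"
  unfolding substitute_def eval_poly_def sum_distrib_left
proof (intro sum.cong refl)
  fix \<alpha> assume "\<alpha> \<in> keys F"
  then have e: "(\<Sum>i\<in>keys \<alpha>. lookup \<alpha> i) = d" using assms by (simp add: homogeneous_def expdeg_def)
  note ch = semiring_homD[OF semiring_hom_const]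
  have "(\<Sum>j\<in>UNIV. const ((\<chi> i j. c * h $ i $ j) $ i $ j) * var j) = const c * (\<Sum>j\<in>UNIV. const (h $ i $ j) * var j)" for i
    by (simp add: ch sum_distrib_left mult.assoc)
  then have "(\<Prod>i\<in>keys \<alpha>. (\<Sum>j\<in>UNIV. const ((\<chi> i j. c * h $ i $ j) $ i $ j) * var j) ^ lookup \<alpha> i) =
    const c ^ d * (\<Prod>i\<in>keys \<alpha>. (\<Sum>j\<in>UNIV. const (h $ i $ j) * var j) ^ lookup \<alpha> i)"
    by (simp only: power_mult_distrib prod.distrib power_sum[symmetric] e)
  then show "const (lookup F \<alpha>) * (\<Prod>i\<in>keys \<alpha>. (\<Sum>j\<in>UNIV. const ((\<chi> i j. c * h $ i $ j) $ i $ j) * var j) ^ lookup \<alpha> i)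
    = const (c ^ d) * (const (lookup F \<alpha>) * (\<Prod>i\<in>keys \<alpha>. (\<Sum>j\<in>UNIV. const (h $ i $ j) * var j) ^ lookup \<alpha> i))"
    by (simp only: ch(5) mult.left_commute)
qed

lemma invertible_independent_columns:
  assumes "independent_at p f"
  shows "invertible (\<chi> a i. p i f $ a)"
proof -
  let ?M = "\<chi> a i. p i f $ a"
  have inj: "inj (\<lambda>i. p i f)" and ind: "vec.independent (range (\<lambda>i. p i f))"
    using assms by (auto simp: independent_at_def)
  have col: "column i ?M = p i f" for i by (simp add: column_def vec_eq_iff)
  have "c i = 0" if "(\<Sum>i\<in>UNIV. c i *s column i ?M) = 0" for c i
  proof -
    define u where "u = (\<lambda>v. c (the_inv (\<lambda>i. p i f) v))"
    have u: "u (p i f) = c i" for i using the_inv_f_f[OF inj] by (simp add: u_def)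
    have "(\<Sum>v\<in>range (\<lambda>i. p i f). u v *s v) = 0"
      using that by (simp add: sum.reindex[OF inj] u col)
    then have "u (p i f) = 0" using vec.independentD[OF ind, of "range (\<lambda>i. p i f)" u "p i f"] by auto
    then show ?thesis by (simp add: u)
  qed
  then have "\<forall>c. (\<Sum>i\<in>UNIV. c i *s column i ?M) = 0 \<longrightarrow> (\<forall>i. c i = 0)" by blast
  then obtain B where B: "B ** ?M = mat 1"
    unfolding matrix_left_invertible_independent_columns[symmetric] by blast
  then have "?M ** B = mat 1" by (rule matrix_left_right_inverse1)
  with B show ?thesis unfolding invertible_def by blast
qed

lemma GL3_equivalent_f_tilde:
  fixes f :: "(3, 'k::{alg_closed_field, field_char_0}) mpoly"
  assumes f: "f \<in> Sym_pow 4" and p: "independent_at p f"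
  shows "GL3_equivalent (f_tilde p f) f"
proof -
  let ?M = "\<chi> a i. p i f $ a"
  obtain c :: 'k where c: "c ^ 4 = 24" using nth_root_exists[of 4 "24 :: 'k"] by auto
  then have "c \<noteq> 0" by auto
  define N where "N = (\<chi> i j. c * ?M $ i $ j)"
  have "det N = c ^ 3 * det ?M" by (simp add: N_def det_3 power3_eq_cube algebra_simps)
  then have N: "invertible N"
    using invertible_independent_columns[OF p] \<open>c \<noteq> 0\<close> by (simp add: invertible_det_nz)
  have "f_tilde p f = substitute N f"
    unfolding f_tilde_eq_substitute[OF f] N_def
    by (subst substitute_scale[of 4]) (use f c in \<open>auto simp: Sym_pow_def\<close>)
  \<comment> \<open>\<open>act\<close> inverts its matrix, so \<open>N\<close> itself carries the
    form back to \<open>f\<close>.\<close>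
  then have "f = act N (f_tilde p f)"
    by (simp add: act_eq_substitute substitute_substitute matrix_inv_inverse[OF N])
  then show ?thesis using N by (auto simp: GL3_equivalent_def GL3_def)
qed

section \<open>Freeness of the action on \<open>f\<close>, and the theorem\<close>

text \<open>In a trivial factor group the coset of \<open>g\<close> is the subgroup itself, and it
  contains \<open>g\<close>.\<close>

lemma trivial_reduced_stabilizer:
  fixes f :: "(3, 'k::field) mpoly"
  assumes "trivial_group (reduced_stabilizer f)" "invertible g" "act g f = f"
  obtains \<mu> where "g = mat \<mu>" "\<mu> ^ 4 = 1"
proof -
  let ?N = "{mat \<mu> | \<mu>. \<mu> ^ 4 = 1} :: ('k^3^3) set"
  have "g \<in> carrier (GL3_stabilizer f)" using assms by (simp add: GL3_stabilizer_def GL3_def)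
  then have "?N #>\<^bsub>GL3_stabilizer f\<^esub> g \<in> carrier (reduced_stabilizer f)"
    by (auto simp: reduced_stabilizer_def FactGroup_def RCOSETS_def)
  then have "?N #>\<^bsub>GL3_stabilizer f\<^esub> g = ?N"
    using assms(1) by (simp add: trivial_group_def reduced_stabilizer_def FactGroup_def)
  moreover have "g \<in> ?N #>\<^bsub>GL3_stabilizer f\<^esub> g"
  proof -
    have "mat 1 \<in> ?N" by (intro CollectI exI[of _ 1]) auto
    then have "mat 1 \<otimes>\<^bsub>GL3_stabilizer f\<^esub> g \<in> ?N #>\<^bsub>GL3_stabilizer f\<^esub> g" unfolding r_coset_def by blast
    then show ?thesis by (simp add: GL3_stabilizer_def GL3_def)
  qed
  ultimately show ?thesis using that by blast
qed

text \<open>The quotient of \<open>g\<close> and \<open>h\<close> fixes \<open>f\<close>, so its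
  inverse is a scalar matrix with \<open>\<mu> ^ 4 = 1\<close>; determinant 1 adds
  \<open>\<mu> ^ 3 = 1\<close>, and hence \<open>\<mu> = 1\<close>.\<close>

lemma free_on_SL3:
  fixes f :: "(3, 'k::field) mpoly"
  assumes triv: "trivial_group (reduced_stabilizer f)" and g: "g \<in> SL3" and h: "h \<in> SL3"
    and eq: "substitute g f = substitute h f"
  shows "g = h"
proof -
  define k where "k = g ** matrix_inv h"
  have k: "k \<in> SL3" unfolding k_def by (intro SL3_mult g matrix_inv_SL3 h)
  have "substitute k f = substitute (matrix_inv h) (substitute h f)"
    by (simp add: k_def substitute_substitute[symmetric] eq)
  then have "substitute k f = f" by (simp add: substitute_substitute matrix_inv_SL3[OF h])
  then have "act (matrix_inv k) f = f" by (simp add: act_eq_substitute matrix_inv_SL3[OF k])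
  moreover have k': "matrix_inv k \<in> SL3" by (rule matrix_inv_SL3(1)[OF k])
  then have "invertible (matrix_inv k)" by (simp add: SL3_def invertible_det_nz)
  ultimately obtain \<mu> where \<mu>: "matrix_inv k = mat \<mu>" "\<mu> ^ 4 = 1"
    using trivial_reduced_stabilizer[OF triv] by metis
  have "det (mat \<mu> :: 'k^3^3) = \<mu> ^ 3" by (simp add: det_3 mat_def power3_eq_cube)
  then have "\<mu> ^ 3 = 1" using k' \<mu>(1) by (simp add: SL3_def)
  moreover have "\<mu> ^ 4 = \<mu> ^ 3 * \<mu>" by (simp add: eval_nat_numeral)
  ultimately have "matrix_inv k = mat 1" using \<mu> by simp
  then have "k = mat 1" using matrix_inv_SL3(3)[OF k] by simp
  then have "g ** (matrix_inv h ** h) = h" by (simp add: k_def matrix_mul_assoc)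
  then show ?thesis by (simp add: matrix_inv_SL3[OF h])
qed

theorem theorem5p2p1:
  fixes f :: "(3, 'k::{alg_closed_field, field_char_0}) mpoly"
  assumes "f \<in> Sym_pow 4"
    and "stable_quartic f"
    and "trivial_group (reduced_stabilizer f)"
  shows "(\<exists>p :: 3 \<Rightarrow> (3, 'k) mpoly \<Rightarrow> 'k^3. (\<forall>i. contravariant (p i)) \<and> independent_at p f)
    \<and> (\<forall>p :: 3 \<Rightarrow> (3, 'k) mpoly \<Rightarrow> 'k^3. (\<forall>i. contravariant (p i)) \<and> independent_at p f \<longrightarrow>
         GL3_equivalent (f_tilde p f) f)"
proof (intro conjI allI impI)
  interpret closed_free_orbit f
  proof
    show "f \<in> Sym_pow 4" by fact
    show "Zariski_closed_quartics (SL3_orbit f)" using assms(2) by (simp add: stable_quartic_def)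
    show "g = h" if "g \<in> SL3" "h \<in> SL3" "substitute g f = substitute h f" for g h
      using free_on_SL3[OF assms(3) that] .
  qed
  show "\<exists>p :: 3 \<Rightarrow> (3, 'k) mpoly \<Rightarrow> 'k^3. (\<forall>i. contravariant (p i)) \<and> independent_at p f"
    by (rule independent_contravariants)
  show "GL3_equivalent (f_tilde p f) f"
    if "(\<forall>i. contravariant (p i)) \<and> independent_at p f" for p :: "3 \<Rightarrow> (3, 'k) mpoly \<Rightarrow> 'k^3"
    using that GL3_equivalent_f_tilde[OF assms(1)] by blast
qed

end
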